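(* Suppose $\cos(\alpha) < \kappa \le 1$. Then for every $g \in SU_2$ the infimum of the cost of admissible decompositions of $g$ is attained either (a) on a reduced $n$-optimal word $$g = \exp(t_1 C_1)\exp(t_2 C_2)\cdots\exp(t_n C_n)$$ (for some $n \ge 0$) which satisfies the strong $\pi$-condition, satisfies $t_p = t_{p+2}$ for all $2 \le p \le n-3$, whose middle time parameters satisfy $\frac{\pi}{2} \le t_x < \pi$ and $\frac{\pi}{2} \le t_y < \pi$, and which, when $n \ge 4$, satisfies $$\frac{\tan(t_y)}{\tan(t_x)} = \frac{\kappa - \cos(\alpha)}{1 - \kappa\cos(\alpha)},$$ understood as $(1-\kappa\cos(\alpha))\sin(t_y)\cos(t_x) = (\kappa-\cos(\alpha))\cos(t_y)\sin(t_x)$; or (b) on a word $$g = \exp(t_1 C_1)\exp(t_2 W)\exp(t_3 C_3),$$ where $C_1, C_3 \in \{X, Y\}$, $t_1, t_2, t_3 \ge 0$, and $$W = (1 - \kappa\cos(\alpha))X + (\kappa - \cos(\alpha))Y,$$ with the cost of $\exp(t_2 W)$ equal to $(\kappa^2 - 2\kappa\cos(\alpha) + 1)\,t_2$ (and the costs of $\exp(t_1C_1)$, $\exp(t_3C_3)$ as for admissible words).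
   Context: Setting. $SU_2$ is realized as the group of unit quaternions, and its Lie algebra $su_2$ as the space of purely imaginary quaternions with orthonormal basis $i,j,k$. $X, Y \in su_2$ have norm $1$, and $\alpha \in (0,\pi)$ is the angle between them (e.g. $X = i$, $Y = i\cos\alpha + j\sin\alpha$). The set of controls is $S = \{X,Y\}$. The cost factor of $X$ is $1$ and the cost factor of $Y$ is $\kappa$, where $0 \le \kappa \le 1$. An admissible word of length $n \ge 0$ is an expression $\exp(t_1 C_1)\cdots\exp(t_n C_n)$ with $t_i \ge 0$, $C_i \in S$ (for $n=0$ it is the identity). Its cost is $\sum_i \kappa_i t_i$, with $\kappa_i = 1$ if $C_i = X$ and $\kappa_i = \kappa$ if $C_i = Y$. It is reduced if all $t_i > 0$ and $C_i \ne C_{i+1}$ for all $i$. It is $n$-optimal if it has minimum cost among all admissible words of length $n$ equal to the same element of $SU_2$. The infimum of the cost for $g$ is taken over all admissible words of all lengths equal to $g$. The middle time parameters are the $t_i$ with $2 \le i \le n-1$. Here $t_x$ (resp. $t_y$) denotes the common value of the middle time parameters corresponding to $X$ (resp. $Y$); conditions on $t_x$ or $t_y$ are imposed only if a corresponding middle parameter exists. $\pi$-condition: at most one time parameter is $\ge \pi$, and if there is such a parameter, it corresponds to the generator $Y$ and is not a middle time parameter. Strong $\pi$-condition: the $\pi$-condition together with, when $n > 1$, the additional restriction $t_1, t_n \le \pi$. *)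

theory Defs
  imports "HOL-Analysis.Analysis"
begin

section \<open>Quaternions\<close>

text \<open>
  The quaternions are made an instance of the library classes for Euclidean spaces and normed
  algebras, so that the library's inner product, norm and exponential series apply to them.
\<close>

datatype quat = Quat (qRe: real) (qI: real) (qJ: real) (qK: real)

lemma quat_eq_iff: "p = q \<longleftrightarrow> qRe p = qRe q \<and> qI p = qI q \<and> qJ p = qJ q \<and> qK p = qK q"
  by (cases p; cases q) auto

instantiation quat :: ring_1
begin

definition zero_quat :: quat where "0 = Quat 0 0 0 0"
definition one_quat :: quat where "1 = Quat 1 0 0 0"
definition uminus_quat :: "quat \<Rightarrow> quat" where
  "- p = Quat (- qRe p) (- qI p) (- qJ p) (- qK p)"
definition plus_quat :: "quat \<Rightarrow> quat \<Rightarrow> quat" where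
  "p + q = Quat (qRe p + qRe q) (qI p + qI q) (qJ p + qJ q) (qK p + qK q)"
definition minus_quat :: "quat \<Rightarrow> quat \<Rightarrow> quat" where
  "p - q = Quat (qRe p - qRe q) (qI p - qI q) (qJ p - qJ q) (qK p - qK q)"
definition times_quat :: "quat \<Rightarrow> quat \<Rightarrow> quat" where
  "p * q = Quat
     (qRe p * qRe q - qI p * qI q - qJ p * qJ q - qK p * qK q)
     (qRe p * qI q + qI p * qRe q + qJ p * qK q - qK p * qJ q)
     (qRe p * qJ q - qI p * qK q + qJ p * qRe q + qK p * qI q)
     (qRe p * qK q + qI p * qJ q - qJ p * qI q + qK p * qRe q)"

instance
  by standard
    (simp_all add: zero_quat_def one_quat_def uminus_quat_def plus_quat_def minus_quat_def
      times_quat_def, simp_all add: algebra_simps)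

end

instantiation quat :: real_algebra_1
begin

definition scaleR_quat :: "real \<Rightarrow> quat \<Rightarrow> quat" where
  "r *\<^sub>R p = Quat (r * qRe p) (r * qI p) (r * qJ p) (r * qK p)"

instance
  by standard
    (auto simp: scaleR_quat_def plus_quat_def times_quat_def algebra_simps)

end

lemma quat_sel_simps [simp]:
  "qRe 0 = 0" "qI 0 = 0" "qJ 0 = 0" "qK 0 = 0"
  "qRe 1 = 1" "qI 1 = 0" "qJ 1 = 0" "qK 1 = 0"
  "qRe (- p) = - qRe p" "qI (- p) = - qI p" "qJ (- p) = - qJ p" "qK (- p) = - qK p"
  "qRe (p + q) = qRe p + qRe q" "qI (p + q) = qI p + qI q"
  "qJ (p + q) = qJ p + qJ q" "qK (p + q) = qK p + qK q"
  "qRe (p - q) = qRe p - qRe q" "qI (p - q) = qI p - qI q"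
  "qJ (p - q) = qJ p - qJ q" "qK (p - q) = qK p - qK q"
  "qRe (r *\<^sub>R p) = r * qRe p" "qI (r *\<^sub>R p) = r * qI p"
  "qJ (r *\<^sub>R p) = r * qJ p" "qK (r *\<^sub>R p) = r * qK p"
  by (simp_all add: zero_quat_def one_quat_def uminus_quat_def plus_quat_def minus_quat_def
      scaleR_quat_def)

lemma quat_units_mult:
  "Quat 0 1 0 0 * Quat 0 1 0 0 = - 1" "Quat 0 0 1 0 * Quat 0 0 1 0 = - 1"
  "Quat 0 0 0 1 * Quat 0 0 0 1 = - 1"
  "Quat 0 1 0 0 * Quat 0 0 1 0 = Quat 0 0 0 1" "Quat 0 0 1 0 * Quat 0 0 0 1 = Quat 0 1 0 0"
  "Quat 0 0 0 1 * Quat 0 1 0 0 = Quat 0 0 1 0"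
  by (simp_all add: times_quat_def quat_eq_iff)

instantiation quat :: real_normed_vector
begin

definition norm_quat_def:
  "norm p = sqrt ((qRe p)\<^sup>2 + (qI p)\<^sup>2 + (qJ p)\<^sup>2 + (qK p)\<^sup>2)" for p :: quat
definition sgn_quat_def: "sgn p = p /\<^sub>R norm p" for p :: quat
definition dist_quat_def: "dist p q = norm (p - q)" for p q :: quat
definition uniformity_quat_def:
  "(uniformity :: (quat \<times> quat) filter) = (INF e\<in>{0 <..}. principal {(p, q). dist p q < e})"
definition open_quat_def:
  "open U \<longleftrightarrow> (\<forall>p\<in>U. eventually (\<lambda>(p', q). p' = p \<longrightarrow> q \<in> U) uniformity)"
  for U :: "quat set"

instance
proof
  fix p q :: quat and r :: real
  have norm_tuple: "norm s = norm (qRe s, qI s, qJ s, qK s)" for s :: quat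
    by (simp add: norm_quat_def norm_prod_def add.assoc)
  show "norm p = 0 \<longleftrightarrow> p = 0"
    unfolding norm_tuple norm_eq_zero by (simp add: quat_eq_iff zero_prod_def)
  show "norm (p + q) \<le> norm p + norm q"
    unfolding norm_tuple
    using norm_triangle_ineq[of "(qRe p, qI p, qJ p, qK p)" "(qRe q, qI q, qJ q, qK q)"] by simp
  show "norm (r *\<^sub>R p) = \<bar>r\<bar> * norm p"
    unfolding norm_tuple using norm_scaleR[of r "(qRe p, qI p, qJ p, qK p)"] by simp
qed (rule sgn_quat_def dist_quat_def uniformity_quat_def open_quat_def)+

end

instantiation quat :: real_inner
begin

definition inner_quat :: "quat \<Rightarrow> quat \<Rightarrow> real" where
  "p \<bullet> q = qRe p * qRe q + qI p * qI q + qJ p * qJ q + qK p * qK q"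

instance
proof
  fix p q s :: quat and r :: real
  show "p \<bullet> q = q \<bullet> p" "(p + q) \<bullet> s = p \<bullet> s + q \<bullet> s" "(r *\<^sub>R p) \<bullet> q = r * (p \<bullet> q)" "0 \<le> p \<bullet> p"
    by (simp_all add: inner_quat_def algebra_simps)
  show "norm p = sqrt (p \<bullet> p)"
    by (simp add: norm_quat_def inner_quat_def power2_eq_square)
  then show "p \<bullet> p = 0 \<longleftrightarrow> p = 0"
    by (metis norm_eq_zero real_sqrt_eq_zero_cancel_iff)
qed

end

instantiation quat :: euclidean_space
begin

definition Basis_quat :: "quat set" where
  "Basis = {Quat 1 0 0 0, Quat 0 1 0 0, Quat 0 0 1 0, Quat 0 0 0 1}"

instance
proof
  show "(Basis :: quat set) \<noteq> {}" "finite (Basis :: quat set)"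
    by (simp_all add: Basis_quat_def)
next
  fix u v :: quat
  assume "u \<in> Basis" "v \<in> Basis"
  then show "u \<bullet> v = (if u = v then 1 else 0)"
    unfolding Basis_quat_def by (elim insertE emptyE) (simp_all add: inner_quat_def)
next
  fix p :: quat
  show "(\<forall>u\<in>Basis. p \<bullet> u = 0) \<longleftrightarrow> p = 0"
    by (cases p) (simp add: Basis_quat_def inner_quat_def zero_quat_def)
qed

end

lemma quat_norm_mult: "norm (p * q) = norm p * norm (q :: quat)"
proof -
  have "(p * q) \<bullet> (p * q) = (p \<bullet> p) * (q \<bullet> q)"
    unfolding inner_quat_def times_quat_def quat.sel by algebra
  then show ?thesis by (simp add: norm_eq_sqrt_inner real_sqrt_mult)
qed

instance quat :: real_normed_algebra_1
proof
  fix p q :: quat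
  show "norm (p * q) \<le> norm p * norm q" by (simp add: quat_norm_mult)
  show "norm (1 :: quat) = 1" by (simp add: norm_quat_def inner_quat_def)
qed

definition SU2 :: "quat set" where
  "SU2 = {q. norm q = 1}"

definition su2 :: "quat set" where
  "su2 = {q. qRe q = 0}"

section \<open>Admissible words\<close>

text \<open>
  A word is the list of pairs \<open>(t, C)\<close> of its time parameters and controls, read from left to right.
  The accessors below count positions from 1.
\<close>

type_synonym word = "(real \<times> quat) list"

definition tm :: "word \<Rightarrow> nat \<Rightarrow> real" where
  "tm w i = fst (w ! (i - 1))"

definition ctrl :: "word \<Rightarrow> nat \<Rightarrow> quat" where
  "ctrl w i = snd (w ! (i - 1))"

definition word_val :: "word \<Rightarrow> quat" where
  "word_val w = prod_list (map (\<lambda>(t, C). exp (t *\<^sub>R C)) w)"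

definition admissible :: "quat \<Rightarrow> quat \<Rightarrow> word \<Rightarrow> bool" where
  "admissible X Y w \<longleftrightarrow> (\<forall>(t, C)\<in>set w. 0 \<le> t \<and> C \<in> {X, Y})"

text \<open>The cost factor of a control in \<open>{X, Y}\<close>; it is only meaningful for \<open>X \<noteq> Y\<close>.\<close>

definition cost_factor :: "quat \<Rightarrow> real \<Rightarrow> quat \<Rightarrow> real" where
  "cost_factor X \<kappa> C = (if C = X then 1 else \<kappa>)"

definition cost :: "quat \<Rightarrow> real \<Rightarrow> word \<Rightarrow> real" where
  "cost X \<kappa> w = (\<Sum>(t, C)\<leftarrow>w. cost_factor X \<kappa> C * t)"

definition reduced_word :: "word \<Rightarrow> bool" where
  "reduced_word w \<longleftrightarrow> (\<forall>(t, C)\<in>set w. 0 < t) \<and> distinct_adj (map snd w)"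

definition n_optimal :: "quat \<Rightarrow> quat \<Rightarrow> real \<Rightarrow> nat \<Rightarrow> word \<Rightarrow> bool" where
  "n_optimal X Y \<kappa> n w \<longleftrightarrow> admissible X Y w \<and> length w = n \<and>
     (\<forall>v. admissible X Y v \<and> length v = n \<and> word_val v = word_val w \<longrightarrow> cost X \<kappa> w \<le> cost X \<kappa> v)"

text \<open>
  The infimum is taken in the extended reals, so that it is \<open>\<infinity>\<close> (rather than an unspecified real
  number) in case there is no admissible word for \<open>g\<close>.
\<close>

definition inf_cost :: "quat \<Rightarrow> quat \<Rightarrow> real \<Rightarrow> quat \<Rightarrow> ereal" where
  "inf_cost X Y \<kappa> g = (INF w\<in>{w. admissible X Y w \<and> word_val w = g}. ereal (cost X \<kappa> w))"

definition middle :: "word \<Rightarrow> nat set" where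
  "middle w = {i. 2 \<le> i \<and> i + 1 \<le> length w}"

definition pi_condition :: "quat \<Rightarrow> word \<Rightarrow> bool" where
  "pi_condition Y w \<longleftrightarrow>
     (\<forall>i\<in>{1..length w}. \<forall>j\<in>{1..length w}. pi \<le> tm w i \<and> pi \<le> tm w j \<longrightarrow> i = j) \<and>
     (\<forall>i\<in>{1..length w}. pi \<le> tm w i \<longrightarrow> ctrl w i = Y \<and> i \<notin> middle w)"

definition strong_pi_condition :: "quat \<Rightarrow> word \<Rightarrow> bool" where
  "strong_pi_condition Y w \<longleftrightarrow> pi_condition Y w \<and>
     (1 < length w \<longrightarrow> tm w 1 \<le> pi \<and> tm w (length w) \<le> pi)"

end

theory Submission
  imports Defs
begin

text \<open>
  The cost of a word is a linear functional of its time parameters, so the infimum is studied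
  through first-order variations. If the cone of variations of (cost, value) of a word is the whole
  space, then the word can be improved by an open mapping argument; otherwise a supporting
  hyperplane gives a multiplier: a real \<open>l \<ge> 0\<close> and an imaginary quaternion \<open>p\<close>, transported along
  the word by conjugation, such that \<open>p \<bullet> C \<le> l k(C)\<close> with equality for the active control. At every
  switch both products are prescribed, so a middle letter rotates the third coordinate \<open>z\<close> of \<open>p\<close>
  to \<open>-z\<close>; this makes the middle parameters periodic and gives the relation between their tangents.
  Inserting trivial letters into an optimal word shows that the middle parameters are at least
  \<open>\<pi> / 2\<close> and that the outer ones are less than \<open>\<pi>\<close>.

  If the infimum is not attained, there are almost minimal words of unbounded length which are
  optimal for their sequence of controls. Their middle parameters tend to \<open>0\<close>, and by the Lie product
  formula the middle parts converge to \<open>exp (\<tau> W)\<close>, since the relation between the tangents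
  linearizes to the direction \<open>W\<close>.
\<close>

section \<open>Imaginary quaternions and rotations\<close>

text \<open>Cost and value are merged into the quaternion \<open>exp (cost) * value\<close>: its
  norm records the cost and its direction the value, so an open mapping theorem in four dimensions
  applies without charts of the sphere. The multiplier may be abnormal (\<open>l = 0\<close>); then
  its coordinate \<open>z\<close> along \<open>crossq A B\<close> is still nonzero at a switch, so
  deriving both \<open>l = 0\<close> and \<open>z = 0\<close> is a contradiction. At a switch the
  remaining coordinates are governed by \<open>k A - c * k B\<close> and
  \<open>k B - c * k A\<close>. These weights are the coefficients of \<open>W\<close>, and the
  assumptions on \<kappa> make both positive; \<open>W\<close> itself is, up to scale, the
  multiplier with \<open>z = 0\<close>. The obstacle is that the number of letters of the
  competitors is unbounded. For a fixed length an optimum exists by compactness, but it is optimal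
  only for its own control sequence; hence the two notions \<open>opt_times\<close> and
  \<open>opt_word\<close>. The lower bound \<open>pi / 2\<close> depends on the latter, while the
  relations between middle parameters follow from the former and so remain available when the
  infimum is not attained.\<close>

definition imq :: "quat \<Rightarrow> quat" where
  "imq q = q - of_real (qRe q)"

definition crossq :: "quat \<Rightarrow> quat \<Rightarrow> quat" where
  "crossq A B = imq (A * B)"

lemma qsel_of_real [simp]:
  "qRe (of_real r) = r" "qI (of_real r) = 0" "qJ (of_real r) = 0" "qK (of_real r) = 0"
  by (simp_all add: of_real_def)

lemma qsel_times:
  "qRe (p * q) = qRe p * qRe q - qI p * qI q - qJ p * qJ q - qK p * qK q"
  "qI (p * q) = qRe p * qI q + qI p * qRe q + qJ p * qK q - qK p * qJ q"
  "qJ (p * q) = qRe p * qJ q - qI p * qK q + qJ p * qRe q + qK p * qI q"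
  "qK (p * q) = qRe p * qK q + qI p * qJ q - qJ p * qI q + qK p * qRe q"
  by (simp_all add: times_quat_def)

lemma crossq_in_su2 [simp]: "crossq A B \<in> su2"
  by (simp add: crossq_def imq_def su2_def)

lemma su2_square:
  assumes "C \<in> su2" "norm C = 1"
  shows "C * C = - 1"
proof -
  have "C \<bullet> C = 1"
    using assms(2) by (simp add: dot_square_norm)
  then show ?thesis
    using assms(1) by (simp add: quat_eq_iff qsel_times su2_def inner_quat_def)
qed

text \<open>Euler's formula: \<open>C * C = - 1\<close> turns the even and odd terms of the
  exponential series into those of cosine and sine.\<close>

lemma exp_su2:
  assumes "C \<in> su2" "norm C = 1"
  shows "exp (t *\<^sub>R C) = of_real (cos t) + sin t *\<^sub>R C"
proof -
  have "(t *\<^sub>R C) ^ n /\<^sub>R fact n = (cos_coeff n * t ^ n) *\<^sub>R 1 + (sin_coeff n * t ^ n) *\<^sub>R C" for n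
  proof -
    have ev: "C ^ (2 * m) = (-1) ^ m" for m
      using su2_square[OF assms] by (simp add: power_mult power2_eq_square)
    show ?thesis
    proof (cases "even n")
      case True
      then obtain m where n: "n = 2 * m" by blast
      have "C ^ n = (-1) ^ m *\<^sub>R 1"
        unfolding n ev by (induction m) auto
      then show ?thesis
        using n by (simp add: scaleR_power cos_coeff_def sin_coeff_def field_simps)
    next
      case False
      then obtain m where n: "n = 2 * m + 1" by (blast elim: oddE)
      have "C ^ (2 * m) = (-1) ^ m *\<^sub>R 1"
        unfolding ev by (induction m) auto
      then have "C ^ n = (-1) ^ m *\<^sub>R C"
        using n by (simp add: power_add)
      then show ?thesis
        using n by (simp add: scaleR_power cos_coeff_def sin_coeff_def field_simps)
    qed
  qed
  moreover have "(\<lambda>n. (t *\<^sub>R C) ^ n /\<^sub>R fact n) sums exp (t *\<^sub>R C)"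
    by (rule exp_converges)
  moreover have "(\<lambda>n. (cos_coeff n * t ^ n) *\<^sub>R 1 + (sin_coeff n * t ^ n) *\<^sub>R C) sums
      (cos t *\<^sub>R 1 + sin t *\<^sub>R C)"
    using cos_converges[of t] sin_converges[of t]
    by (intro sums_add sums_scaleR_left) auto
  ultimately show ?thesis
    using sums_unique2 by (force simp: of_real_def)
qed

lemma norm_exp_su2 [simp]:
  assumes "C \<in> su2" "norm C = 1"
  shows "norm (exp (t *\<^sub>R C)) = 1"
proof -
  have "C \<bullet> C = 1"
    using assms(2) by (simp add: dot_square_norm)
  then have "qI C * qI C + qJ C * qJ C + qK C * qK C = 1"
    using assms(1) by (simp add: inner_quat_def su2_def)
  moreover have "exp (t *\<^sub>R C) \<bullet> exp (t *\<^sub>R C) =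
      (cos t)\<^sup>2 + (sin t)\<^sup>2 * (qI C * qI C + qJ C * qJ C + qK C * qK C)"
    unfolding exp_su2[OF assms] inner_quat_def using assms(1)
    by (simp add: su2_def power2_eq_square algebra_simps)
  ultimately have "(norm (exp (t *\<^sub>R C)))\<^sup>2 = 1"
    by (simp add: dot_square_norm)
  then show ?thesis
    by (metis abs_norm_cancel real_sqrt_abs real_sqrt_one)
qed

lemma exp_su2_pi:
  assumes "C \<in> su2" "norm C = 1"
  shows "exp (pi *\<^sub>R C) = - 1"
  by (simp add: exp_su2[OF assms])

lemma exp_add_scaleR:
  fixes C :: "'a::{real_normed_algebra_1,banach}"
  shows "exp ((s + t) *\<^sub>R C) = exp (s *\<^sub>R C) * exp (t *\<^sub>R C)"
  by (simp add: scaleR_add_left exp_add_commuting)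

lemma exp_scaleR_minus:
  fixes C :: "'a::{real_normed_algebra_1,banach}"
  shows "exp (- (t *\<^sub>R C)) * exp (t *\<^sub>R C) = 1" "exp (t *\<^sub>R C) * exp (- (t *\<^sub>R C)) = 1"
  by (simp_all add: exp_minus_inverse exp_minus_inverse[of "- (t *\<^sub>R C)", simplified])

text \<open>For a unit \<open>C\<close> in \<open>su2\<close>, this is the adjoint of the
  conjugation that moves variations past a letter. On \<open>su2\<close> it is a rotation about
  \<open>C\<close> through twice the time, hence the doubled angles below.\<close>

definition rot :: "real \<Rightarrow> quat \<Rightarrow> quat \<Rightarrow> quat" where
  "rot t C p = exp (- (t *\<^sub>R C)) * p * exp (t *\<^sub>R C)"

lemma rot_0 [simp]: "rot 0 C p = p"
  by (simp add: rot_def)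

lemma rot_rot: "rot s C (rot t C p) = rot (t + s) C p"
proof -
  have "exp (- ((t + s) *\<^sub>R C)) = exp (- (s *\<^sub>R C)) * exp (- (t *\<^sub>R C))"
    using exp_add_scaleR[of "-s" "-t" C] by (simp add: algebra_simps)
  then show ?thesis
    unfolding rot_def exp_add_scaleR by (simp add: mult.assoc)
qed

lemma rot_eq:
  assumes "C \<in> su2" "norm C = 1"
  shows "rot t C p = (cos t)\<^sup>2 *\<^sub>R p + (cos t * sin t) *\<^sub>R (p * C - C * p) - (sin t)\<^sup>2 *\<^sub>R (C * p * C)"
proof -
  have E: "exp (- (t *\<^sub>R C)) = of_real (cos t) - sin t *\<^sub>R C"
    using exp_su2[OF assms, of "-t"] by simp
  show ?thesis
    unfolding rot_def exp_su2[OF assms] E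
    by (simp add: algebra_simps power2_eq_square of_real_def)
qed

lemma rot_in_su2:
  assumes "C \<in> su2" "norm C = 1" "p \<in> su2"
  shows "rot t C p \<in> su2"
  unfolding rot_eq[OF assms(1,2)] using assms(1,3)
  by (simp add: su2_def qsel_times algebra_simps)

lemma rot_inner_gen:
  assumes "C \<in> su2" "norm C = 1" "p \<in> su2" "D \<in> su2"
  shows "rot t C p \<bullet> D = cos (2*t) * (p \<bullet> D) - sin (2*t) * (p \<bullet> crossq D C) + (1 - cos (2*t)) * (p \<bullet> C) * (C \<bullet> D)"
proof -
  have CC: "C \<bullet> C = 1"
    using assms(2) by (simp add: dot_square_norm)
  have 1: "(p * C - C * p) \<bullet> D = - 2 * (p \<bullet> crossq D C)"
    using assms by (simp add: su2_def crossq_def imq_def inner_quat_def qsel_times algebra_simps)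
  have "(C * p * C) \<bullet> D = (C \<bullet> C) * (p \<bullet> D) - 2 * (p \<bullet> C) * (C \<bullet> D)"
    using assms by (simp add: su2_def crossq_def imq_def inner_quat_def qsel_times algebra_simps)
  then have 2: "(C * p * C) \<bullet> D = p \<bullet> D - 2 * (p \<bullet> C) * (C \<bullet> D)"
    by (simp add: CC)
  have c2: "cos (2 * t) = 1 - 2 * (sin t)\<^sup>2" and s2: "sin (2 * t) = 2 * (cos t * sin t)"
    by (simp_all add: cos_double_sin sin_double)
  show ?thesis
    unfolding rot_eq[OF assms(1,2)]
    unfolding inner_add_left inner_diff_left[of _ "(sin t)\<^sup>2 *\<^sub>R (C * p * C)"] inner_scaleR_left 1 2
      c2 s2 cos_squared_eq
    by (simp add: algebra_simps)
qed

text \<open>\<open>C\<close>, the component of \<open>D\<close> orthogonal to \<open>C\<close>, and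
  \<open>crossq D C\<close> are pairwise orthogonal, and the last two have equal length: one
  coordinate of \<open>p\<close> is fixed and the other two turn in their plane.\<close>

lemma rot_inner:
  assumes C: "C \<in> su2" "norm C = 1" and "p \<in> su2" "D \<in> su2"
  shows "rot t C p \<bullet> C = p \<bullet> C"
    and "rot t C p \<bullet> D - (C \<bullet> D) * (rot t C p \<bullet> C) =
      cos (2*t) * (p \<bullet> D - (C \<bullet> D) * (p \<bullet> C)) - sin (2*t) * (p \<bullet> crossq D C)"
    and "rot t C p \<bullet> crossq D C =
      sin (2*t) * (p \<bullet> D - (C \<bullet> D) * (p \<bullet> C)) + cos (2*t) * (p \<bullet> crossq D C)"
proof -
  have CC: "C \<bullet> C = 1"
    using assms(2) by (simp add: dot_square_norm)
  have z: "crossq C C = 0"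
    using C by (simp add: su2_square crossq_def imq_def quat_eq_iff)
  show e: "rot t C p \<bullet> C = p \<bullet> C"
    by (simp add: rot_inner_gen assms CC z algebra_simps)
  show "rot t C p \<bullet> D - (C \<bullet> D) * (rot t C p \<bullet> C) =
      cos (2*t) * (p \<bullet> D - (C \<bullet> D) * (p \<bullet> C)) - sin (2*t) * (p \<bullet> crossq D C)"
    unfolding e by (simp add: rot_inner_gen assms algebra_simps)
  have "crossq (crossq D C) C = (C \<bullet> D) *\<^sub>R C - (C \<bullet> C) *\<^sub>R D"
    using assms
    by (simp add: su2_def crossq_def imq_def inner_quat_def quat_eq_iff qsel_times algebra_simps)
  then have pz: "p \<bullet> crossq (crossq D C) C = (C \<bullet> D) * (p \<bullet> C) - p \<bullet> D"
    by (simp only: CC inner_diff_right inner_scaleR_right)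
  moreover have "C \<bullet> crossq D C = 0"
    using assms
    by (simp add: su2_def crossq_def imq_def inner_quat_def quat_eq_iff qsel_times algebra_simps)
  ultimately show "rot t C p \<bullet> crossq D C =
      sin (2*t) * (p \<bullet> D - (C \<bullet> D) * (p \<bullet> C)) + cos (2*t) * (p \<bullet> crossq D C)"
    by (simp add: rot_inner_gen assms pz) (simp add: algebra_simps)
qed

lemma crossq_swap:
  assumes "A \<in> su2" "B \<in> su2"
  shows "crossq B A = - crossq A B"
  using assms by (simp add: su2_def crossq_def imq_def quat_eq_iff qsel_times)

lemma su2_eq_0I:
  assumes "p \<in> su2" "A \<in> su2" "B \<in> su2" "norm A = 1" "norm B = 1" "\<bar>A \<bullet> B\<bar> < 1"
    and "p \<bullet> A = 0" "p \<bullet> B = 0" "p \<bullet> crossq A B = 0"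
  shows "p = 0"
proof -
  define D where "D = crossq A B"
  have AB: "A \<bullet> A = 1" "B \<bullet> B = 1"
    using assms(4,5) by (simp_all add: dot_square_norm)
  \<comment> \<open>Lagrange's identity.\<close>
  have "D \<bullet> D + (A \<bullet> B)\<^sup>2 = (A \<bullet> A) * (B \<bullet> B)"
    using assms(2,3)
    by (simp add: D_def su2_def crossq_def imq_def inner_quat_def qsel_times power2_eq_square algebra_simps)
  then have "D \<bullet> D \<noteq> 0"
    using assms(6) AB by (auto simp: abs_square_less_1 dest: sym)
      (metis abs_square_less_1 less_irrefl)
  \<comment> \<open>Expansion of \<open>p\<close> in the basis dual to \<open>A\<close>,
    \<open>B\<close>, \<open>D\<close>, scaled by \<open>D \<bullet> D\<close>.\<close>
  have "(D \<bullet> D) *\<^sub>R p = (p \<bullet> D) *\<^sub>R D + (p \<bullet> A) *\<^sub>R crossq B D - (p \<bullet> B) *\<^sub>R crossq A D"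
    using assms(1-3)
    by (simp add: D_def su2_def crossq_def imq_def quat_eq_iff inner_quat_def qsel_times algebra_simps)
  then have "(D \<bullet> D) *\<^sub>R p = 0"
    using assms(7-9) by (simp add: D_def)
  with \<open>D \<bullet> D \<noteq> 0\<close> show ?thesis by simp
qed

section \<open>First-order variations of words\<close>

text \<open>Arbitrary weights, also negative ones, are allowed, since reachability is proved below
  with an auxiliary cost of mixed sign.\<close>

definition wcost :: "(quat \<Rightarrow> real) \<Rightarrow> word \<Rightarrow> real" where
  "wcost k w = (\<Sum>(t, C)\<leftarrow>w. k C * t)"

lemma cost_eq_wcost: "cost X \<kappa> w = wcost (cost_factor X \<kappa>) w"
  by (simp add: cost_def wcost_def)

lemma wcost_simps [simp]:
  "wcost k [] = 0" "wcost k ((t, C) # w) = k C * t + wcost k w"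
  "wcost k (v @ w) = wcost k v + wcost k w"
  by (simp_all add: wcost_def)

lemma word_val_simps [simp]:
  "word_val [] = 1" "word_val ((t, C) # w) = exp (t *\<^sub>R C) * word_val w"
  "word_val (v @ w) = word_val v * word_val w"
  by (simp_all add: word_val_def)

definition nonneg_word :: "word \<Rightarrow> bool" where
  "nonneg_word w \<longleftrightarrow> (\<forall>(t, C)\<in>set w. 0 \<le> t)"

lemma nonneg_word_simps [simp]:
  "nonneg_word []" "nonneg_word ((t, C) # w) \<longleftrightarrow> 0 \<le> t \<and> nonneg_word w"
  "nonneg_word (v @ w) \<longleftrightarrow> nonneg_word v \<and> nonneg_word w"
  by (auto simp: nonneg_word_def)

definition unit_word :: "word \<Rightarrow> bool" where
  "unit_word w \<longleftrightarrow> (\<forall>C\<in>snd ` set w. C \<in> su2 \<and> norm C = 1)"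

lemma unit_word_simps [simp]:
  "unit_word []" "unit_word ((t, C) # w) \<longleftrightarrow> C \<in> su2 \<and> norm C = 1 \<and> unit_word w"
  "unit_word (v @ w) \<longleftrightarrow> unit_word v \<and> unit_word w"
  by (auto simp: unit_word_def)

lemma unit_word_cong: "map snd v = map snd w \<Longrightarrow> unit_word v \<longleftrightarrow> unit_word w"
  unfolding unit_word_def by (metis list.set_map)

lemma norm_word_val: "unit_word w \<Longrightarrow> norm (word_val w) = 1"
  by (induction w) (auto simp: quat_norm_mult)

lemma word_val_inverse: "\<exists>h. word_val w * h = 1 \<and> h * word_val w = 1"
proof (induction w)
  case (Cons a w)
  obtain t C where a: "a = (t, C)" by (cases a)
  from Cons obtain h where h: "word_val w * h = 1" "h * word_val w = 1" by blast
  have "exp (t *\<^sub>R C) * word_val w * (h * exp (- (t *\<^sub>R C))) = exp (t *\<^sub>R C) * (word_val w * h) * exp (- (t *\<^sub>R C))"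
    "h * exp (- (t *\<^sub>R C)) * (exp (t *\<^sub>R C) * word_val w) = h * (exp (- (t *\<^sub>R C)) * exp (t *\<^sub>R C)) * word_val w"
    by (simp_all only: mult.assoc)
  then show ?case
    unfolding a by (auto simp: h exp_scaleR_minus intro!: exI[of _ "h * exp (- (t *\<^sub>R C))"])
qed (auto intro: exI[of _ 1])

text \<open>
  First-order variations of the quaternion \<open>exp (cost) * value\<close>, multiplied by the inverse of the
  value: the real part is the increase of the cost, with slack, the imaginary part the displacement.
\<close>

fun varcone :: "(quat \<Rightarrow> real) \<Rightarrow> word \<Rightarrow> quat set" where
  "varcone k [] = {of_real s | s. 0 \<le> s}"
| "varcone k ((t, C) # w) =
    {s *\<^sub>R (of_real (k C) + C) + exp (t *\<^sub>R C) * u * exp (- (t *\<^sub>R C)) | s u. u \<in> varcone k w \<and> (0 \<le> s \<or> 0 < t)}"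

lemma varcone_scaleR: "u \<in> varcone k w \<Longrightarrow> 0 \<le> r \<Longrightarrow> r *\<^sub>R u \<in> varcone k w"
proof (induction k w arbitrary: u rule: varcone.induct)
  case (1 k)
  then show ?case by (auto simp: of_real_def)
next
  case (2 k t C w)
  from 2(2) obtain s v where s: "u = s *\<^sub>R (of_real (k C) + C) + exp (t *\<^sub>R C) * v * exp (- (t *\<^sub>R C))" "v \<in> varcone k w" "0 \<le> s \<or> 0 < t" by auto
  show ?case
    unfolding varcone.simps mem_Collect_eq s(1)
    using s(2,3) 2(1)[OF s(2) 2(3)] 2(3)
    by (intro exI[of _ "r * s"] exI[of _ "r *\<^sub>R v"]) (auto simp: algebra_simps)
qed

lemma varcone_add: "u \<in> varcone k w \<Longrightarrow> v \<in> varcone k w \<Longrightarrow> u + v \<in> varcone k w"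
proof (induction k w arbitrary: u v rule: varcone.induct)
  case (1 k)
  then show ?case by (force simp flip: of_real_add)
next
  case (2 k t C w)
  from 2(2) obtain s u' where s: "u = s *\<^sub>R (of_real (k C) + C) + exp (t *\<^sub>R C) * u' * exp (- (t *\<^sub>R C))" "u' \<in> varcone k w" "0 \<le> s \<or> 0 < t" by auto
  from 2(3) obtain r v' where r: "v = r *\<^sub>R (of_real (k C) + C) + exp (t *\<^sub>R C) * v' * exp (- (t *\<^sub>R C))" "v' \<in> varcone k w" "0 \<le> r \<or> 0 < t" by auto
  show ?case
    unfolding varcone.simps mem_Collect_eq s(1) r(1)
    using s(2,3) r(2,3) 2(1)[OF s(2) r(2)]
    by (intro exI[of _ "s + r"] exI[of _ "u' + v'"]) (auto simp: algebra_simps)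
qed

lemma varcone_of_real: "0 \<le> s \<Longrightarrow> of_real s \<in> varcone k w"
proof (induction k w rule: varcone.induct)
  case (2 k t C w)
  have "of_real s = 0 *\<^sub>R (of_real (k C) + C) + exp (t *\<^sub>R C) * of_real s * exp (- (t *\<^sub>R C))"
    by (simp add: of_real_def exp_scaleR_minus)
  with 2 show ?case
    unfolding varcone.simps mem_Collect_eq by (metis order_refl)
qed auto

lemma convex_varcone: "convex (varcone k w)"
  unfolding convex_def by (auto intro: varcone_add varcone_scaleR)

text \<open>Fritz John conditions for the time parameters: \<open>l\<close> is dual to the cost and \<open>p\<close> to the value.\<close>

fun is_multiplier :: "(quat \<Rightarrow> real) \<Rightarrow> real \<Rightarrow> quat \<Rightarrow> word \<Rightarrow> bool" where
  "is_multiplier k l p [] \<longleftrightarrow> True"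
| "is_multiplier k l p ((t, C) # w) \<longleftrightarrow>
    p \<bullet> C \<le> l * k C \<and> (0 < t \<longrightarrow> p \<bullet> C = l * k C) \<and> is_multiplier k l (rot t C p) w"

lemma inner_rotate:
  assumes "C \<in> su2" "norm C = 1"
  shows "a \<bullet> (exp (t *\<^sub>R C) * u * exp (- (t *\<^sub>R C))) = rot t C a \<bullet> u"
proof -
  have E: "exp (- (t *\<^sub>R C)) = of_real (cos t) - sin t *\<^sub>R C"
    using exp_su2[OF assms, of "-t"] by simp
  show ?thesis
    unfolding rot_def exp_su2[OF assms] E using assms(1)
    by (simp add: inner_quat_def su2_def qsel_times algebra_simps)
qed

text \<open>The sign of \<open>p\<close> is chosen so that nonnegativity of the functional on the
  variation of a single letter reads \<open>p \<bullet> C \<le> l * k C\<close>. A positive time can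
  be varied in both directions, which gives equality. Later letters see the functional through the
  adjoint rotation.\<close>

lemma is_multiplier_of_supporting:
  assumes "unit_word w" "\<forall>u\<in>varcone k w. 0 \<le> a \<bullet> u"
  shows "is_multiplier k (qRe a) (- imq a) w"
  using assms
proof (induction w arbitrary: a)
  case (Cons x w)
  obtain t C where x: "x = (t, C)" by (cases x)
  have C: "C \<in> su2" "norm C = 1" and w: "unit_word w"
    using Cons.prems(1) by (auto simp: x)
  have aC: "a \<bullet> (s *\<^sub>R (of_real (k C) + C)) = s * (qRe a * k C + imq a \<bullet> C)" for s
    using C by (simp add: inner_quat_def imq_def su2_def algebra_simps)
  have 1: "0 \<le> s * (qRe a * k C + imq a \<bullet> C)" if "0 \<le> s \<or> 0 < t" for s
  proof -
    have "s *\<^sub>R (of_real (k C) + C) + exp (t *\<^sub>R C) * of_real 0 * exp (- (t *\<^sub>R C)) \<in> varcone k (x # w)"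
      unfolding x varcone.simps mem_Collect_eq using that varcone_of_real[of 0] by blast
    with Cons.prems(2) have "0 \<le> a \<bullet> (s *\<^sub>R (of_real (k C) + C) + exp (t *\<^sub>R C) * of_real 0 * exp (- (t *\<^sub>R C)))"
      by blast
    then show ?thesis by (simp only: aC of_real_0 mult_zero_right mult_zero_left add_0_right)
  qed
  have "0 \<le> rot t C a \<bullet> u" if "u \<in> varcone k w" for u
  proof -
    have "0 *\<^sub>R (of_real (k C) + C) + exp (t *\<^sub>R C) * u * exp (- (t *\<^sub>R C)) \<in> varcone k (x # w)"
      unfolding x varcone.simps mem_Collect_eq using that by blast
    with Cons.prems(2) have "0 \<le> a \<bullet> (exp (t *\<^sub>R C) * u * exp (- (t *\<^sub>R C)))"
      by fastforce
    then show ?thesis by (simp add: inner_rotate[OF C])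
  qed
  then have "is_multiplier k (qRe (rot t C a)) (- imq (rot t C a)) w"
    by (intro Cons.IH w) blast
  moreover have "rot t C (imq a) = rot t C a - of_real (qRe a)"
    by (simp add: imq_def rot_def algebra_simps of_real_def exp_scaleR_minus)
  moreover have "imq a \<in> su2"
    by (simp add: imq_def su2_def)
  then have "rot t C (imq a) \<in> su2"
    by (intro rot_in_su2 C)
  moreover have "rot t C (- imq a) = - rot t C (imq a)"
    by (simp add: rot_def)
  ultimately have 2: "is_multiplier k (qRe a) (rot t C (- imq a)) w"
    by (simp add: su2_def imq_def)
  show ?case
    unfolding x using 1[of 1] 1[of "-1"] 2 by auto
qed auto

lemma multiplier_exists:
  assumes "unit_word w" "varcone k w \<noteq> UNIV"
  obtains l p where "0 \<le> l" "p \<in> su2" "l \<noteq> 0 \<or> p \<noteq> 0" "is_multiplier k l p w"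
proof -
  obtain y where y: "y \<notin> varcone k w" using assms(2) by blast
  define S where "S = (\<lambda>u. u - y) ` varcone k w"
  have "convex S"
    unfolding S_def using convex_varcone convex_translation[of "varcone k w" "-y"] by simp
  moreover have "0 \<notin> S" using y by (auto simp: S_def)
  ultimately obtain a where a: "a \<noteq> 0" "\<forall>x\<in>S. 0 \<le> a \<bullet> x"
    using separating_hyperplane_set_0 by blast
  have ge: "0 \<le> a \<bullet> u" if u: "u \<in> varcone k w" for u
  proof (rule ccontr)
    assume neg: "\<not> 0 \<le> a \<bullet> u"
    \<comment> \<open>A functional bounded below on a cone is nonnegative there: scaling
      \<open>u\<close> by \<open>r\<close> would push it below \<open>a \<bullet> y\<close>.\<close>
    define r where "r = \<bar>a \<bullet> y\<bar> / - (a \<bullet> u) + 1"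
    have "r *\<^sub>R u \<in> varcone k w"
      using neg by (intro varcone_scaleR u) (auto simp: r_def intro!: add_nonneg_nonneg divide_nonneg_pos)
    with a(2) have "0 \<le> r * (a \<bullet> u) - a \<bullet> y"
      by (auto simp: S_def inner_diff_right)
    moreover have "r * (a \<bullet> u) = - \<bar>a \<bullet> y\<bar> + a \<bullet> u"
      using neg by (simp add: r_def field_simps)
    ultimately show False using neg by simp
  qed
  show ?thesis
  proof
    show "is_multiplier k (qRe a) (- imq a) w"
      using ge by (intro is_multiplier_of_supporting assms) blast
    show "0 \<le> qRe a"
      using ge[OF varcone_of_real[of 1]] by (simp add: inner_quat_def)
    show "- imq a \<in> su2" by (simp add: imq_def su2_def)
    show "qRe a \<noteq> 0 \<or> - imq a \<noteq> 0"
      using a(1) by (auto simp: imq_def)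
  qed
qed

section \<open>Perturbing the time parameters\<close>

lemma letter_has_derivative:
  fixes C :: quat and q :: "'a::euclidean_space"
  shows "((\<lambda>r. exp ((r \<bullet> q) * k) *\<^sub>R exp ((t + r \<bullet> q) *\<^sub>R C)) has_derivative
      (\<lambda>r. (r \<bullet> q) *\<^sub>R ((of_real k + C) * exp (t *\<^sub>R C)))) (at 0)"
proof -
  \<comment> \<open>Real factors are central, so weight and control merge into a single
    exponential.\<close>
  have eq: "exp ((r \<bullet> q) * k) *\<^sub>R exp ((t + r \<bullet> q) *\<^sub>R C) = exp ((r \<bullet> q) *\<^sub>R (of_real k + C)) * exp (t *\<^sub>R C)" for r
  proof -
    have "(r \<bullet> q) *\<^sub>R (of_real k + C) = of_real ((r \<bullet> q) * k) + (r \<bullet> q) *\<^sub>R C"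
      by (simp add: of_real_def scaleR_add_right)
    then have "exp ((r \<bullet> q) *\<^sub>R (of_real k + C)) = exp (of_real ((r \<bullet> q) * k)) * exp ((r \<bullet> q) *\<^sub>R C)"
      by (simp only:) (subst exp_add_commuting, auto simp: of_real_def)
    also have "\<dots> = exp ((r \<bullet> q) * k) *\<^sub>R exp ((r \<bullet> q) *\<^sub>R C)"
      by (simp only: exp_of_real[of "(r \<bullet> q) * k"]) (simp add: of_real_def)
    finally show ?thesis
      by (simp add: exp_add_scaleR[of "r \<bullet> q" t C] add.commute[of t])
  qed
  have "((\<lambda>s. exp (s *\<^sub>R (of_real k + C))) has_vector_derivative exp (0 *\<^sub>R (of_real k + C)) * (of_real k + C)) (at ((0::'a) \<bullet> q))"
    using exp_scaleR_has_vector_derivative_right[of "of_real k + C" 0 UNIV] by simp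
  then have "((\<lambda>s. exp (s *\<^sub>R (of_real k + C))) has_derivative (\<lambda>s. s *\<^sub>R (of_real k + C))) (at ((0::'a) \<bullet> q))"
    by (simp add: has_vector_derivative_def)
  moreover have "((\<lambda>r. r \<bullet> q) has_derivative (\<lambda>r. r \<bullet> q)) (at (0::'a))"
    by (auto intro!: derivative_eq_intros)
  ultimately have "((\<lambda>r. exp ((r \<bullet> q) *\<^sub>R (of_real k + C))) has_derivative (\<lambda>r. (r \<bullet> q) *\<^sub>R (of_real k + C))) (at (0::'a))"
    by (rule has_derivative_compose[rotated])
  then show ?thesis
    unfolding eq by (auto intro!: derivative_eq_intros)
qed

text \<open>
  The perturbed words depend on a parameter in a Euclidean space whose positive orthant
  parametrizes the admissible perturbations, so that the derivative may be taken in the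
  interior of the domain.
\<close>

lemma continuous_exp_scaleR:
  fixes A :: "'a::{real_normed_algebra_1,banach}"
  assumes "continuous_on S f"
  shows "continuous_on S (\<lambda>x. exp (f x *\<^sub>R A))"
proof -
  have "continuous_on UNIV (\<lambda>t. exp (t *\<^sub>R A))"
    using exp_scaleR_has_vector_derivative_right
    by (intro continuous_on_vector_derivative)
  then show ?thesis using assms by (rule continuous_on_compose2) auto
qed

text \<open>The slack \<open>\<sigma>\<close> lets the cost be overstated, which supplies the real
  direction of the cone. Outside the orthant a letter of time zero may receive a negative time: the
  quaternion is defined there, but the word is no candidate.\<close>

definition perturbation ::
  "(quat \<Rightarrow> real) \<Rightarrow> word \<Rightarrow> ('a::euclidean_space \<Rightarrow> quat) \<Rightarrow> ('a \<Rightarrow> word) \<Rightarrow> ('a \<Rightarrow> real) \<Rightarrow> real \<Rightarrow> bool"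
  where "perturbation k w U S \<sigma> \<delta> \<longleftrightarrow> 0 < \<delta> \<and> (\<forall>r. map snd (S r) = map snd w) \<and>
    (\<forall>r. (\<forall>b\<in>Basis. 0 \<le> r \<bullet> b) \<longrightarrow> 0 \<le> \<sigma> r \<and> (norm r < \<delta> \<longrightarrow> nonneg_word (S r))) \<and>
    continuous_on UNIV (\<lambda>r. exp (wcost k (S r) - wcost k w + \<sigma> r) *\<^sub>R word_val (S r)) \<and>
    exp (wcost k (S 0) - wcost k w + \<sigma> 0) *\<^sub>R word_val (S 0) = word_val w \<and>
    ((\<lambda>r. exp (wcost k (S r) - wcost k w + \<sigma> r) *\<^sub>R word_val (S r)) has_derivative (\<lambda>r. U r * word_val w)) (at 0)"

lemma word_perturbation:
  fixes U :: "'a::euclidean_space \<Rightarrow> quat"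
  assumes "linear U" "\<forall>b\<in>Basis. U b \<in> varcone k w" "nonneg_word w"
  shows "\<exists>S \<sigma> \<delta>. perturbation k w U S \<sigma> \<delta>"
  using assms
proof (induction w arbitrary: U)
  case Nil
  define q where "q = (\<Sum>b\<in>Basis. qRe (U b) *\<^sub>R b)"
  have qb: "q \<bullet> b = qRe (U b)" if "b \<in> Basis" for b
    using that by (simp add: q_def inner_sum_left inner_Basis if_distrib sum.delta cong: if_cong)
  have Ub: "U b = of_real (q \<bullet> b)" "0 \<le> q \<bullet> b" if "b \<in> Basis" for b
    using Nil.prems(2) that by (auto simp: qb)
  have U: "U r = of_real (r \<bullet> q)" for r
  proof -
    have "U r = U (\<Sum>b\<in>Basis. (r \<bullet> b) *\<^sub>R b)"
      by (simp add: euclidean_representation)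
    also have "\<dots> = (\<Sum>b\<in>Basis. (r \<bullet> b) *\<^sub>R U b)"
      by (simp add: linear_sum[OF Nil.prems(1)] linear_scale[OF Nil.prems(1)])
    also have "\<dots> = (\<Sum>b\<in>Basis. of_real ((r \<bullet> b) * (q \<bullet> b)))"
      by (intro sum.cong refl) (simp add: Ub(1) of_real_def)
    also have "\<dots> = of_real (r \<bullet> q)"
      by (simp add: euclidean_inner[of r q])
    finally show ?thesis .
  qed
  have "((\<lambda>r. exp (r \<bullet> q) *\<^sub>R (1::quat)) has_derivative (\<lambda>r. U r * word_val [])) (at 0)"
    unfolding U by (auto intro!: derivative_eq_intros simp: of_real_def)
  moreover have "continuous_on UNIV (\<lambda>r. exp (r \<bullet> q) *\<^sub>R (1::quat))"
    by (intro continuous_intros)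
  moreover have "0 \<le> r \<bullet> q" if "\<forall>b\<in>Basis. 0 \<le> r \<bullet> b" for r
    using that Ub(2) by (subst euclidean_inner) (auto intro!: sum_nonneg)
  ultimately show ?case
    by (intro exI[of _ "\<lambda>r. []"] exI[of _ "\<lambda>r. r \<bullet> q"] exI[of _ 1]) (simp add: perturbation_def)
next
  case (Cons x w)
  obtain t C where x: "x = (t, C)" by (cases x)
  define K where "K = of_real (k C) + C"
  define E where "E = exp (t *\<^sub>R C)"
  define E' where "E' = exp (- (t *\<^sub>R C))"
  have EE: "E * E' = 1" "E' * E = 1"
    by (simp_all add: E_def E'_def exp_scaleR_minus)
  have EE': "E * (E' * a) = a" "E' * (E * a) = a" for a
    by (simp_all add: EE flip: mult.assoc)
  have "\<exists>s u. U b = s *\<^sub>R K + E * u * E' \<and> u \<in> varcone k w \<and> (0 \<le> s \<or> 0 < t)" if "b \<in> Basis" for b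
    using Cons.prems(2) that by (auto simp: x K_def E_def E'_def)
  then obtain s u where su: "\<And>b. b \<in> Basis \<Longrightarrow> U b = s b *\<^sub>R K + E * u b * E' \<and> u b \<in> varcone k w \<and> (0 \<le> s b \<or> 0 < t)"
    by metis
  \<comment> \<open>The coefficients of the first letter are extended to a linear functional,
    represented by \<open>q\<close>.\<close>
  define q where "q = (\<Sum>b\<in>Basis. s b *\<^sub>R b)"
  have qb: "b \<bullet> q = s b" if "b \<in> Basis" for b
    using that by (simp add: q_def inner_sum_right inner_Basis if_distrib sum.delta' cong: if_cong)
  \<comment> \<open>What remains of \<open>U\<close> after the first letter, conjugated back past
    it: the derivative demanded of the tail.\<close>
  define V where "V = (\<lambda>r. E' * (U r - (r \<bullet> q) *\<^sub>R K) * E)"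
  have "linear V"
    using Cons.prems(1) unfolding V_def
    by (intro linearI) (auto simp: linear_add linear_scale inner_add_left algebra_simps)
  moreover have "V b = u b" if "b \<in> Basis" for b
    using su[OF that] by (simp add: V_def qb[OF that] mult.assoc EE EE')
  then have "\<forall>b\<in>Basis. V b \<in> varcone k w" using su by auto
  moreover have "nonneg_word w" "0 \<le> t" using Cons.prems(3) by (auto simp: x)
  ultimately obtain S \<sigma> \<delta> where "perturbation k w V S \<sigma> \<delta>"
    using Cons.IH by blast
  note IH = this[unfolded perturbation_def]
  define S' where "S' = (\<lambda>r. (t + r \<bullet> q, C) # S r)"
  define G where "G = (\<lambda>r. exp (wcost k (S r) - wcost k w + \<sigma> r) *\<^sub>R word_val (S r))"
  have G': "exp (wcost k (S' r) - wcost k (x # w) + \<sigma> r) *\<^sub>R word_val (S' r) =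
      (exp ((r \<bullet> q) * k C) *\<^sub>R exp ((t + r \<bullet> q) *\<^sub>R C)) * G r" for r
  proof -
    have "wcost k (S' r) - wcost k (x # w) + \<sigma> r = (r \<bullet> q) * k C + (wcost k (S r) - wcost k w + \<sigma> r)"
      by (simp add: S'_def x algebra_simps)
    then show ?thesis
      unfolding G_def by (simp only: exp_add) (simp add: S'_def)
  qed
  have contG: "continuous_on UNIV G"
    using IH by (simp add: G_def)
  have c1: "continuous_on UNIV (\<lambda>r. (exp ((r \<bullet> q) * k C) *\<^sub>R exp ((t + r \<bullet> q) *\<^sub>R C)) * G r)"
    by (intro continuous_intros contG continuous_exp_scaleR)
  have c2: "((\<lambda>r. (exp ((r \<bullet> q) * k C) *\<^sub>R exp ((t + r \<bullet> q) *\<^sub>R C)) * G r) has_derivative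
     (\<lambda>r. U r * word_val (x # w))) (at 0)"
  proof -
    have G: "(G has_derivative (\<lambda>r. V r * word_val w)) (at 0)" and G0: "G 0 = word_val w"
      using IH by (simp_all add: G_def)
    have "E * (V r * word_val w) = U r * E * word_val w - (r \<bullet> q) *\<^sub>R (K * E * word_val w)" for r
    proof -
      have "E * (V r * word_val w) = (E * E') * (U r - (r \<bullet> q) *\<^sub>R K) * E * word_val w"
        unfolding V_def by (simp only: mult.assoc)
      then show ?thesis by (simp only: EE mult_1_left left_diff_distrib mult_scaleR_left)
    qed
    then have eq: "exp ((0 \<bullet> q) * k C) *\<^sub>R exp ((t + 0 \<bullet> q) *\<^sub>R C) * (V r * word_val w) +
        (r \<bullet> q) *\<^sub>R ((of_real (k C) + C) * exp (t *\<^sub>R C)) * G 0 = U r * word_val (x # w)" for r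
      unfolding G0 E_def[symmetric] K_def[symmetric] by (simp add: x E_def[symmetric] mult.assoc)
    show ?thesis
      using has_derivative_mult[OF letter_has_derivative[of q "k C" t C] G] unfolding eq .
  qed
  have c3: "exp (wcost k (S' 0) - wcost k (x # w) + \<sigma> 0) *\<^sub>R word_val (S' 0) = word_val (x # w)"
    unfolding G' using IH by (simp add: x G_def)
  \<comment> \<open>A positive time stays nonnegative on a small ball by Cauchy-Schwarz. For time
    zero the coefficients \<open>s b\<close> are nonnegative, so the new time is nonnegative on the
    whole orthant.\<close>
  obtain \<delta>' where \<delta>': "0 < \<delta>'"
    "\<And>r. (\<forall>b\<in>Basis. 0 \<le> r \<bullet> b) \<Longrightarrow> norm r < \<delta>' \<Longrightarrow> 0 \<le> t + r \<bullet> q"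
  proof (cases "0 < t")
    case True
    have nq: "0 < norm q + 1" by (simp add: add_nonneg_pos)
    show ?thesis
    proof (rule that[of "t / (norm q + 1)"])
      show "0 < t / (norm q + 1)" using True nq by (rule divide_pos_pos)
      fix r :: 'a assume "norm r < t / (norm q + 1)"
      then have "norm r * (norm q + 1) < t"
        by (simp only: pos_less_divide_eq[OF nq])
      moreover have "\<bar>r \<bullet> q\<bar> \<le> norm r * norm q" by (rule Cauchy_Schwarz_ineq2)
      moreover have "0 \<le> norm r" by simp
      ultimately show "0 \<le> t + r \<bullet> q" unfolding distrib_left by linarith
    qed
  next
    case False
    show ?thesis
    proof (rule that[of 1])
      show "(0::real) < 1" by simp
      fix r :: 'a assume r: "\<forall>b\<in>Basis. 0 \<le> r \<bullet> b"
      have "0 \<le> q \<bullet> b" if "b \<in> Basis" for b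
        using su[OF that] False unfolding inner_commute[of q b] qb[OF that] by blast
      then have "0 \<le> r \<bullet> q"
        using r by (subst euclidean_inner) (auto intro!: sum_nonneg)
      then show "0 \<le> t + r \<bullet> q" using \<open>0 \<le> t\<close> by simp
    qed
  qed
  have c4: "\<forall>r. map snd (S' r) = map snd (x # w)"
    using IH by (simp add: S'_def x)
  have c5: "\<forall>r. (\<forall>b\<in>Basis. 0 \<le> r \<bullet> b) \<longrightarrow> 0 \<le> \<sigma> r \<and> (norm r < min \<delta> \<delta>' \<longrightarrow> nonneg_word (S' r))"
    using IH \<delta>'(2) by (auto simp: S'_def)
  have "0 < min \<delta> \<delta>'" using IH \<delta>'(1) by simp
  with c1 c2 c3 c4 c5 have "perturbation k (x # w) U S' \<sigma> (min \<delta> \<delta>')"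
    unfolding perturbation_def G' by blast
  then show ?case by blast
qed

section \<open>Full cones give neighbourhoods\<close>

definition pos_part :: "quat \<Rightarrow> quat" where
  "pos_part z = (\<Sum>b\<in>Basis. max 0 (z \<bullet> b) *\<^sub>R b)"

lemma pos_part_inner: "b \<in> Basis \<Longrightarrow> pos_part z \<bullet> b = max 0 (z \<bullet> b)"
  by (simp add: pos_part_def inner_sum_left inner_Basis if_distrib sum.delta cong: if_cong)

lemma pos_part_diff: "pos_part z - pos_part (- z) = z"
  by (rule euclidean_eqI) (auto simp: inner_diff_left pos_part_inner)

lemma norm_pos_part: "norm (pos_part z) \<le> norm z"
  by (rule norm_le_componentwise) (auto simp: pos_part_inner)

lemma continuous_pos_part: "continuous_on S pos_part"
  unfolding pos_part_def by (intro continuous_intros)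

text \<open>\<open>U\<close> maps the orthant of pairs of quaternions onto all quaternions, and
  positive and negative parts give a right inverse \<open>R\<close> of it. \<open>R\<close> is not
  differentiable at \<open>0\<close>, but it is continuous with
  \<open>norm (R z) \<le> 2 * norm z\<close> and \<open>U (R z) = z\<close>, so
  \<open>G (R z)\<close> still has the invertible derivative \<open>z * word_val w\<close> at
  \<open>0\<close>. This is enough for Sussmann's open mapping theorem.\<close>

lemma reachable_nearby:
  assumes "varcone k w = UNIV" "nonneg_word w"
  obtains \<epsilon> where "0 < \<epsilon>" "\<And>y. dist y (word_val w) < \<epsilon> \<Longrightarrow>
    \<exists>v s. map snd v = map snd w \<and> nonneg_word v \<and> 0 \<le> s \<and> y = exp (wcost k v - wcost k w + s) *\<^sub>R word_val v"
proof -
  define U where "U = (\<lambda>r :: quat \<times> quat. fst r - snd r)"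
  have "linear U" unfolding U_def by (intro linearI) (auto simp: algebra_simps)
  then obtain S \<sigma> \<delta> where "perturbation k w U S \<sigma> \<delta>"
    using word_perturbation[of U k w] assms by blast
  note S = this[unfolded perturbation_def]
  define G where "G = (\<lambda>r. exp (wcost k (S r) - wcost k w + \<sigma> r) *\<^sub>R word_val (S r))"
  define R where "R = (\<lambda>z. (pos_part z, pos_part (- z)))"
  have UR: "U (R z) = z" for z
    by (simp add: U_def R_def pos_part_diff)
  have R0: "R 0 = 0"
    by (simp add: R_def pos_part_def zero_prod_def)
  have normR: "norm (R z) \<le> 2 * norm z" for z
    using norm_Pair_le[of "pos_part z" "pos_part (- z)"] norm_pos_part[of z] norm_pos_part[of "-z"]
    by (simp add: R_def)
  have contR: "continuous_on UNIV R"
    unfolding R_def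
    by (intro continuous_intros continuous_on_compose2[OF continuous_pos_part[of UNIV]]) auto
  have orthant: "\<forall>b\<in>Basis. 0 \<le> R z \<bullet> b" for z
    by (auto simp: R_def Basis_prod_def inner_Pair pos_part_inner)
  have deriv: "((\<lambda>z. G (R z)) has_derivative (\<lambda>z. z * word_val w)) (at 0)"
  proof -
    have D: "(G has_derivative (\<lambda>r. U r * word_val w)) (at 0)"
      using S by (simp add: G_def)
    show ?thesis
      unfolding has_derivative_at_alt
    proof (intro conjI allI impI)
      show "bounded_linear (\<lambda>z. z * word_val w)" by (rule bounded_linear_mult_left)
      fix e :: real assume "0 < e"
      then have "0 < e / 2" by simp
      with D obtain d where d: "0 < d" "\<And>y. norm (y - 0) < d \<Longrightarrow> norm (G y - G 0 - U (y - 0) * word_val w) \<le> e / 2 * norm (y - 0)"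
        unfolding has_derivative_at_alt by metis
      show "\<exists>d>0. \<forall>y. norm (y - 0) < d \<longrightarrow> norm (G (R y) - G (R 0) - (y - 0) * word_val w) \<le> e * norm (y - 0)"
      proof (intro exI[of _ "d / 2"] conjI allI impI)
        show "0 < d / 2" using d by simp
        fix y :: quat assume "norm (y - 0) < d / 2"
        then have "norm (R y) < d" using normR[of y] by simp
        then have "norm (G (R y) - G 0 - y * word_val w) \<le> e / 2 * norm (R y)"
          using d(2)[of "R y"] by (simp add: UR)
        also have "\<dots> \<le> e / 2 * (2 * norm y)"
          using normR[of y] \<open>0 < e\<close> by (intro mult_left_mono) auto
        finally show "norm (G (R y) - G (R 0) - (y - 0) * word_val w) \<le> e * norm (y - 0)"
          by (simp add: R0)
      qed
    qed
  qed
  have cont: "continuous_on UNIV (\<lambda>z. G (R z))"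
  proof (rule continuous_on_compose2[of UNIV G UNIV R])
    show "continuous_on UNIV G" using S by (simp add: G_def)
  qed (rule contR, simp)
  obtain h where h: "word_val w * h = 1" "h * word_val w = 1"
    using word_val_inverse by blast
  have "(\<lambda>z. G (R z)) 0 \<in> interior ((\<lambda>z. G (R z)) ` ball 0 (\<delta> / 2))"
  proof (rule sussmann_open_mapping[OF open_UNIV cont UNIV_I deriv bounded_linear_mult_left[of h]])
    show "(\<lambda>z. z * word_val w) \<circ> (\<lambda>z. z * h) = id"
      by (simp add: fun_eq_iff mult.assoc h)
    show "0 \<in> interior (ball (0 :: quat) (\<delta> / 2))"
      using S by simp
  qed simp
  moreover have "G (R 0) = word_val w"
    using S by (simp add: G_def R0)
  ultimately obtain \<epsilon> where \<epsilon>: "0 < \<epsilon>" "ball (word_val w) \<epsilon> \<subseteq> (\<lambda>z. G (R z)) ` ball 0 (\<delta> / 2)"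
    by (metis mem_interior)
  show ?thesis
  proof
    fix y assume "dist y (word_val w) < \<epsilon>"
    then obtain z where z: "norm z < \<delta> / 2" "y = G (R z)"
      using \<epsilon>(2) by (auto simp: dist_commute)
    have "norm (R z) < \<delta>" using normR[of z] z by simp
    then show "\<exists>v s. map snd v = map snd w \<and> nonneg_word v \<and> 0 \<le> s \<and> y = exp (wcost k v - wcost k w + s) *\<^sub>R word_val v"
    proof (intro exI conjI)
      show "map snd (S (R z)) = map snd w" "0 \<le> \<sigma> (R z)"
        using S orthant[of z] by blast+
      show "nonneg_word (S (R z))" if "norm (R z) < \<delta>"
        using S orthant[of z] that by blast
      show "y = exp (wcost k (S (R z)) - wcost k w + \<sigma> (R z)) *\<^sub>R word_val (S (R z))"
        using z by (simp add: G_def)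
    qed
  qed fact
qed

definition opt_times :: "(quat \<Rightarrow> real) \<Rightarrow> word \<Rightarrow> bool" where
  "opt_times k w \<longleftrightarrow> (\<forall>v. map snd v = map snd w \<and> nonneg_word v \<and> word_val v = word_val w \<longrightarrow> wcost k w \<le> wcost k v)"

text \<open>If the cone were everything, \<open>(1 - d) *\<^sub>R word_val w\<close> would be
  reached. Values of words have norm one, so comparing norms yields the same value at a cost lower
  by at least \<open>- ln (1 - d)\<close>.\<close>

lemma opt_times_multiplier:
  assumes "unit_word w" "nonneg_word w" "opt_times k w"
  obtains l p where "0 \<le> l" "p \<in> su2" "l \<noteq> 0 \<or> p \<noteq> 0" "is_multiplier k l p w"
proof (rule multiplier_exists[OF assms(1)])
  show "varcone k w \<noteq> UNIV"
  proof
    assume "varcone k w = UNIV"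
    then obtain \<epsilon> where \<epsilon>: "0 < \<epsilon>" "\<And>y. dist y (word_val w) < \<epsilon> \<Longrightarrow>
      \<exists>v s. map snd v = map snd w \<and> nonneg_word v \<and> 0 \<le> s \<and> y = exp (wcost k v - wcost k w + s) *\<^sub>R word_val v"
      using reachable_nearby assms(2) by metis
    have nw: "norm (word_val w) = 1" using norm_word_val assms(1) by blast
    define d where "d = min (\<epsilon> / 2) (1 / 2)"
    have d: "0 < d" "d < \<epsilon>" "d < 1" using \<epsilon>(1) by (auto simp: d_def)
    have "(1 - d) *\<^sub>R word_val w - word_val w = - d *\<^sub>R word_val w"
      by (simp add: algebra_simps)
    then have "dist ((1 - d) *\<^sub>R word_val w) (word_val w) < \<epsilon>"
      using d nw by (simp add: dist_norm)
    then obtain v s where v: "map snd v = map snd w" "nonneg_word v" "0 \<le> s"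
      "(1 - d) *\<^sub>R word_val w = exp (wcost k v - wcost k w + s) *\<^sub>R word_val v"
      using \<epsilon>(2) by blast
    have nv: "norm (word_val v) = 1" using norm_word_val unit_word_cong v(1) assms(1) by blast
    have "norm ((1 - d) *\<^sub>R word_val w) = norm (exp (wcost k v - wcost k w + s) *\<^sub>R word_val v)"
      using v(4) by simp
    then have e: "1 - d = exp (wcost k v - wcost k w + s)"
      using d nw nv by simp
    then have "word_val w = word_val v" using v(4) d by simp
    with assms(3) v have "wcost k w \<le> wcost k v" by (auto simp: opt_times_def)
    then have "1 \<le> 1 - d"
      unfolding e using v(3) by simp
    then show False using d by simp
  qed
qed

section \<open>Multipliers along alternating words\<close>

fun altw :: "quat \<Rightarrow> quat \<Rightarrow> real list \<Rightarrow> word" where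
  "altw A B [] = []"
| "altw A B (t # ts) = (t, A) # altw B A ts"

fun transport :: "word \<Rightarrow> quat \<Rightarrow> quat" where
  "transport [] p = p"
| "transport ((t, C) # w) p = transport w (rot t C p)"

lemma is_multiplier_append: "is_multiplier k l p (v @ w) \<longleftrightarrow> is_multiplier k l p v \<and> is_multiplier k l (transport v p) w"
  by (induction v arbitrary: p) auto

lemma transport_in_su2: "unit_word w \<Longrightarrow> p \<in> su2 \<Longrightarrow> transport w p \<in> su2"
  by (induction w arbitrary: p) (auto simp: rot_in_su2)

lemma rot_eq_0: "rot t C p = 0 \<Longrightarrow> p = 0"
  using rot_rot[of "-t" C t p] by (simp add: rot_def)

lemma transport_eq_0: "transport w p = 0 \<Longrightarrow> p = 0"
  by (induction w arbitrary: p) (auto, metis rot_eq_0)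

locale control_pair =
  fixes A B :: quat and c :: real
  assumes A: "A \<in> su2" "norm A = 1" and B: "B \<in> su2" "norm B = 1"
    and AB: "A \<bullet> B = c" and c: "\<bar>c\<bar> < 1"
begin

lemma swap: "control_pair B A c"
  using A B AB c by unfold_locales (simp_all add: inner_commute)

text \<open>At both ends of the letter \<open>B\<close> the control \<open>A\<close> satisfies its
  equality too, so the rotation through \<open>2 * t\<close> in the plane of the coordinates
  \<open>x\<close> (along \<open>A - c B\<close>) and \<open>z\<close> (along
  \<open>crossq A B\<close>) returns to the same \<open>x\<close>. It preserves the length of
  \<open>(x, z)\<close> and is not the identity when \<open>sin t \<noteq> 0\<close>, so
  \<open>z\<close> changes sign.\<close>

lemma letter_between_switches:
  assumes p: "p \<in> su2" and "p \<bullet> A = l * k A" "p \<bullet> B = l * k B" "rot t B p \<bullet> A = l * k A" "sin t \<noteq> 0"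
  shows "l * (k A - c * k B) * sin t = - (p \<bullet> crossq A B) * cos t"
    and "rot t B p \<bullet> crossq A B = - (p \<bullet> crossq A B)"
proof -
  define x where "x = l * (k A - c * k B)"
  define z where "z = p \<bullet> crossq A B"
  have x: "p \<bullet> A - (B \<bullet> A) * (p \<bullet> B) = x"
    using assms AB by (simp add: x_def inner_commute algebra_simps)
  have x': "rot t B p \<bullet> A - (B \<bullet> A) * (rot t B p \<bullet> B) = x"
    using assms AB rot_inner(1)[OF B p A(1)] by (simp add: x_def inner_commute algebra_simps)
  have "x = cos (2 * t) * x - sin (2 * t) * z"
    using rot_inner(2)[OF B p A(1), of t] unfolding x x' z_def .
  then have "sin t * (x * sin t + z * cos t) = 0"
    unfolding cos_double_sin sin_double by (simp add: power2_eq_square algebra_simps)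
  with assms(5) have xz: "x * sin t = - z * cos t" by simp
  then show "l * (k A - c * k B) * sin t = - (p \<bullet> crossq A B) * cos t"
    by (simp add: x_def z_def)
  have "rot t B p \<bullet> crossq A B = sin (2 * t) * x + cos (2 * t) * z"
    using rot_inner(3)[OF B p A(1), of t] unfolding x z_def .
  also have "\<dots> = 2 * cos t * (x * sin t) + (2 * (cos t)\<^sup>2 - 1) * z"
    unfolding cos_double_cos sin_double by (simp add: algebra_simps)
  also have "\<dots> = - z" unfolding xz by (simp add: power2_eq_square algebra_simps)
  finally show "rot t B p \<bullet> crossq A B = - (p \<bullet> crossq A B)" by (simp add: z_def)
qed

text \<open>\<open>A\<close>, \<open>B\<close> and \<open>crossq A B\<close> span
  \<open>su2\<close>, so an abnormal multiplier keeps a nonzero third coordinate at a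
  switch.\<close>

lemma multiplier_nondegenerate:
  assumes "p \<in> su2" "p \<bullet> A = l * k A" "p \<bullet> B = l * k B" "l \<noteq> 0 \<or> p \<noteq> 0"
  shows "l \<noteq> 0 \<or> p \<bullet> crossq A B \<noteq> 0"
  using su2_eq_0I[OF assms(1) A(1) B(1) A(2) B(2)] assms AB c by auto

end

text \<open>Exchanging the controls reverses \<open>crossq\<close>, and a letter reverses
  \<open>z\<close>; the two signs cancel, so the same \<open>z\<close> serves all middle letters.
  The last letter is exempt, as no switch follows it.\<close>

lemma alternating_multiplier_relation:
  assumes "control_pair A B c" "is_multiplier k l p (altw B A ts)" "p \<in> su2"
    "p \<bullet> A = l * k A" "p \<bullet> B = l * k B" "\<forall>t\<in>set ts. 0 < t"
    "\<forall>i. Suc i < length ts \<longrightarrow> sin (ts ! i) \<noteq> 0" "Suc i < length ts"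
  shows "l * (if even i then k A - c * k B else k B - c * k A) * sin (ts ! i) = - (p \<bullet> crossq A B) * cos (ts ! i)"
  using assms
proof (induction ts arbitrary: A B p i)
  case (Cons t ts)
  interpret control_pair A B c by fact
  from Cons.prems obtain u us where ts: "ts = u # us" by (cases ts) auto
  have e: "is_multiplier k l (rot t B p) (altw A B ts)" using Cons.prems(2) by simp
  have sA: "rot t B p \<bullet> A = l * k A" using e Cons.prems(6) by (simp add: ts)
  have t: "sin t \<noteq> 0" using Cons.prems(7) by (auto simp: ts dest: spec[of _ 0])
  note L = letter_between_switches[OF Cons.prems(3,4,5) sA t]
  show ?case
  proof (cases i)
    case 0
    then show ?thesis using L(1) by simp
  next
    case (Suc j)
    have sB: "rot t B p \<bullet> B = l * k B"
      using rot_inner(1)[OF B Cons.prems(3) A(1)] Cons.prems(5) by simp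
    have "\<forall>i. Suc i < length ts \<longrightarrow> sin (ts ! i) \<noteq> 0"
      using Cons.prems(7) by (metis Suc_less_eq length_Cons nth_Cons_Suc)
    then have "l * (if even j then k B - c * k A else k A - c * k B) * sin (ts ! j) =
        - (rot t B p \<bullet> crossq B A) * cos (ts ! j)"
      using Cons.prems Suc by (intro Cons.IH[OF swap e rot_in_su2[OF B Cons.prems(3)] sB sA]) auto
    moreover have "rot t B p \<bullet> crossq B A = p \<bullet> crossq A B"
      using L(2) crossq_swap[OF A(1) B(1)] by simp
    ultimately show ?thesis using Suc by (cases "even j") simp_all
  qed
qed simp

context control_pair
begin

lemma alternating_multiplier:
  assumes "is_multiplier k l p (altw A B (s # ts))" "p \<in> su2" "l \<noteq> 0 \<or> p \<noteq> 0" "ts \<noteq> []"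
    "0 < s" "\<forall>t\<in>set ts. 0 < t" "\<forall>i. Suc i < length ts \<longrightarrow> sin (ts ! i) \<noteq> 0"
  obtains z where "l \<noteq> 0 \<or> z \<noteq> 0"
    "\<And>i. Suc i < length ts \<Longrightarrow>
      l * (if even i then k A - c * k B else k B - c * k A) * sin (ts ! i) = - z * cos (ts ! i)"
proof -
  obtain u us where ts: "ts = u # us" using assms(4) by (cases ts) auto
  define q where "q = rot s A p"
  have e: "is_multiplier k l q (altw B A ts)" using assms(1) by (simp add: q_def)
  have q: "q \<in> su2" unfolding q_def by (intro rot_in_su2 A assms)
  have qA: "q \<bullet> A = l * k A"
    using assms(1,5) rot_inner(1)[OF A assms(2) B(1)] by (simp add: q_def)
  have qB: "q \<bullet> B = l * k B"
    using e assms(6) by (simp add: ts)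
  have "l \<noteq> 0 \<or> q \<noteq> 0" using assms(3) rot_eq_0 by (auto simp: q_def)
  then have "l \<noteq> 0 \<or> q \<bullet> crossq A B \<noteq> 0"
    using multiplier_nondegenerate q qA qB by blast
  then show ?thesis
    using alternating_multiplier_relation[OF control_pair_axioms e q qA qB assms(6,7)] that by blast
qed

text \<open>
  Inserting a trivial letter in the middle of a letter detects that the multiplier violates the
  maximum principle there if the letter is too short.
\<close>

lemma middle_letter_ge:
  assumes "is_multiplier k l p ((s, A) # (t / 2, B) # (0, A) # (t / 2, B) # (u, A) # w)"
    and p: "p \<in> su2" "l \<noteq> 0 \<or> p \<noteq> 0" "0 \<le> l" and "0 < s" "0 < t" "t < pi" "0 < u"
    and m: "0 < k A - c * k B"
  shows "pi / 2 \<le> t"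
proof (rule ccontr)
  assume "\<not> pi / 2 \<le> t"
  then have ct: "0 < cos t" using \<open>0 < t\<close> by (intro cos_gt_zero_pi) auto
  have st: "0 < sin t" using assms by (intro sin_gt_zero) auto
  define q where "q = rot s A p"
  define q' where "q' = rot (t / 2) B q"
  have q: "q \<in> su2" "q' \<in> su2" unfolding q'_def q_def by (intro rot_in_su2 A B p)+
  have qA: "q \<bullet> A = l * k A"
    using assms(1,5) rot_inner(1)[OF A p(1) B(1)] by (simp add: q_def)
  have qB: "q \<bullet> B = l * k B" and q'A: "q' \<bullet> A \<le> l * k A" and q'B: "q' \<bullet> B = l * k B"
    and eA: "rot t B q \<bullet> A = l * k A"
    using assms(1,6,8) by (simp_all add: q_def[symmetric] q'_def[symmetric])
      (simp add: q'_def rot_rot)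
  define x where "x = l * (k A - c * k B)"
  define z where "z = q \<bullet> crossq A B"
  have xz: "x * sin t = - z * cos t"
    using letter_between_switches(1)[OF q(1) qA qB eA] st by (simp add: x_def z_def)
  have "q \<bullet> A - (B \<bullet> A) * (q \<bullet> B) = x"
    using qA qB AB by (simp add: x_def inner_commute algebra_simps)
  then have "q' \<bullet> A - (B \<bullet> A) * (q' \<bullet> B) = cos t * x - sin t * z"
    using rot_inner(2)[OF B q(1) A(1), of "t / 2"] by (simp add: q'_def z_def)
  moreover have "q' \<bullet> A - (B \<bullet> A) * (q' \<bullet> B) \<le> x"
    using q'A q'B AB by (simp add: x_def inner_commute algebra_simps)
  \<comment> \<open>The maximum principle at the midpoint, where the rotation angle is twice
    \<open>t / 2\<close>. Multiplied by \<open>cos t\<close>, the left side collapses to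
    \<open>x\<close> because of \<open>xz\<close>, so \<open>x \<le> cos t * x\<close>.\<close>
  ultimately have "cos t * x - sin t * z \<le> x" by simp
  then have "cos t * (cos t * x - sin t * z) \<le> cos t * x"
    using ct by simp
  moreover have "cos t * (cos t * x - sin t * z) = x"
  proof -
    have "cos t * (cos t * x - sin t * z) = (cos t)\<^sup>2 * x + sin t * (- z * cos t)"
      by (simp add: power2_eq_square algebra_simps)
    also have "\<dots> = (cos t)\<^sup>2 * x + sin t * (x * sin t)"
      by (simp only: xz)
    also have "\<dots> = x"
      unfolding cos_squared_eq by (simp add: power2_eq_square algebra_simps)
    finally show ?thesis .
  qed
  ultimately have "(1 - cos t) * x \<le> 0" by (simp add: algebra_simps)
  moreover have "cos t < 1"
    using cos_monotone_0_pi[of 0 t] assms by simp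
  ultimately have "x \<le> 0" by (simp add: mult_le_0_iff)
  then have l: "l = 0"
    using p(3) m by (simp add: x_def mult_le_0_iff)
  then have "z = 0" using xz ct by (simp add: x_def)
  with l show False
    using multiplier_nondegenerate[OF q(1) qA qB] p(2) rot_eq_0 by (auto simp: q_def z_def)
qed

text \<open>
  Just after the start and just before the end of a full turn, \<open>p\<close> is close to its position at the
  switch, but on opposite sides; unless \<open>z = 0\<close>, one of them violates the maximum principle.
\<close>

lemma end_letter_lt:
  assumes t: "0 < t" "t < pi" and m: "0 < k A - c * k B" "0 < k B - c * k A"
  obtains \<epsilon> where "0 < \<epsilon>" "\<epsilon> < pi / 2" "\<And>l p s u w. \<lbrakk>0 < u; 0 < s; 0 \<le> l; p \<in> su2; l \<noteq> 0 \<or> p \<noteq> 0;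
    is_multiplier k l p ((s, A) # (0, B) # (pi - 2 * \<epsilon>, A) # (0, B) # (\<epsilon>, A) # (t, B) # (u, A) # w)\<rbrakk> \<Longrightarrow> False"
proof -
  define a where "a = k A - c * k B"
  define b where "b = k B - c * k A"
  have ab: "0 < a" "0 < b" using m by (auto simp: a_def b_def)
  have st: "0 < sin t" using t by (intro sin_gt_zero) auto
  \<comment> \<open>Chosen independently of the multiplier such that
    \<open>b * tan \<epsilon>\<close> is half of \<open>a * sin t\<close>; this gap forces
    \<open>z = 0\<close> at the end.\<close>
  define \<epsilon> where "\<epsilon> = arctan (a * sin t / (2 * b))"
  have \<epsilon>: "0 < \<epsilon>" "\<epsilon> < pi / 2"
    unfolding \<epsilon>_def using ab st arctan_ubound by (auto simp: zero_less_arctan_iff)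
  have ce: "0 < cos \<epsilon>" and se: "0 < sin \<epsilon>"
    using \<epsilon> by (auto intro!: cos_gt_zero_pi sin_gt_zero)
  have "tan \<epsilon> = a * sin t / (2 * b)" by (simp add: \<epsilon>_def tan_arctan)
  then have "2 * b * sin \<epsilon> = a * sin t * cos \<epsilon>"
    using ab ce by (simp add: tan_def field_simps)
  moreover have "0 < b * sin \<epsilon>" using ab se by simp
  ultimately have less: "b * sin \<epsilon> < a * sin t * cos \<epsilon>" by linarith
  show ?thesis
  proof
    fix l p s u w assume u: "0 < u" and s: "0 < s" and l: "0 \<le> l" and p: "p \<in> su2" and nz: "l \<noteq> 0 \<or> p \<noteq> 0"
      and e: "is_multiplier k l p ((s, A) # (0, B) # (pi - 2 * \<epsilon>, A) # (0, B) # (\<epsilon>, A) # (t, B) # (u, A) # w)"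
    define q1 where "q1 = rot s A p"
    define q2 where "q2 = rot (pi - 2 * \<epsilon>) A q1"
    define q where "q = rot \<epsilon> A q2"
    have su2: "q1 \<in> su2" "q2 \<in> su2" "q \<in> su2"
      unfolding q_def q2_def q1_def by (intro rot_in_su2 A p)+
    have q1A: "q1 \<bullet> A = l * k A" and q2A: "q2 \<bullet> A = l * k A" and qA: "q \<bullet> A = l * k A"
      using e s rot_inner(1)[OF A p B(1)] rot_inner(1)[OF A su2(1) B(1)] rot_inner(1)[OF A su2(2) B(1)]
      by (simp_all add: q_def q2_def q1_def)
    have q1B: "q1 \<bullet> B \<le> l * k B" and q2B: "q2 \<bullet> B \<le> l * k B" and qB: "q \<bullet> B = l * k B"
      using e t by (simp_all add: q_def q2_def q1_def)
    have eA: "rot t B q \<bullet> A = l * k A"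
      using e u by (simp add: q_def q2_def q1_def)
    define x where "x = l * b"
    define z where "z = q \<bullet> crossq B A"
    \<comment> \<open>Seen from the switch \<open>q\<close>, the inserted letters sit at times
      \<open>- \<epsilon>\<close> and \<open>- (pi - \<epsilon>)\<close>. As rotations double the
      time, the latter acts like \<open>\<epsilon>\<close>.\<close>
    have q2: "q2 = rot (- \<epsilon>) A q" and q1: "q1 = rot (- (pi - \<epsilon>)) A q"
      by (simp_all add: q_def q2_def rot_rot)
    have qx: "q \<bullet> B - (A \<bullet> B) * (q \<bullet> A) = x"
      using qA qB AB by (simp add: x_def b_def algebra_simps)
    have "cos (2 * \<epsilon>) * x + sin (2 * \<epsilon>) * z = q2 \<bullet> B - (A \<bullet> B) * (q2 \<bullet> A)"
      using rot_inner(2)[OF A su2(3) B(1), of "- \<epsilon>"] unfolding qx q2[symmetric] z_def[symmetric] by simp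
    also have "\<dots> \<le> x"
      using q2A q2B AB by (simp add: x_def b_def algebra_simps)
    finally have 1: "cos (2 * \<epsilon>) * x + sin (2 * \<epsilon>) * z \<le> x" .
    have "cos (2 * (- (pi - \<epsilon>))) = cos (2 * \<epsilon>)" "sin (2 * (- (pi - \<epsilon>))) = sin (2 * \<epsilon>)"
      by (simp_all add: cos_diff sin_diff algebra_simps)
    then have "cos (2 * \<epsilon>) * x - sin (2 * \<epsilon>) * z = q1 \<bullet> B - (A \<bullet> B) * (q1 \<bullet> A)"
      using rot_inner(2)[OF A su2(3) B(1), of "- (pi - \<epsilon>)"] unfolding qx q1[symmetric] z_def[symmetric] by simp
    also have "\<dots> \<le> x"
      using q1A q1B AB by (simp add: x_def b_def algebra_simps)
    finally have 2: "cos (2 * \<epsilon>) * x - sin (2 * \<epsilon>) * z \<le> x" .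
    have "2 * sin \<epsilon> * (cos \<epsilon> * z) \<le> 2 * sin \<epsilon> * (sin \<epsilon> * x)" "2 * sin \<epsilon> * (cos \<epsilon> * (- z)) \<le> 2 * sin \<epsilon> * (sin \<epsilon> * x)"
      using 1 2 unfolding cos_double_sin sin_double by (simp_all add: power2_eq_square algebra_simps)
    then have "cos \<epsilon> * z \<le> sin \<epsilon> * x" "cos \<epsilon> * (- z) \<le> sin \<epsilon> * x"
      using se by (auto simp only: mult_le_cancel_left_pos[of "2 * sin \<epsilon>"])
    then have 3: "cos \<epsilon> * \<bar>z\<bar> \<le> sin \<epsilon> * x" by (auto simp: abs_real_def)
    have "l * a * sin t = - (q \<bullet> crossq A B) * cos t"
      using letter_between_switches(1)[OF su2(3) qA qB eA] st by (simp add: a_def)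
    then have lz: "l * a * sin t = z * cos t"
      using crossq_swap[OF A(1) B(1)] by (simp add: z_def)
    have "z * cos t \<le> \<bar>z\<bar>"
      using abs_mult[of z "cos t"] abs_cos_le_one[of t] mult_left_mono[of "\<bar>cos t\<bar>" 1 "\<bar>z\<bar>"] by linarith
    then have 4: "l * a * sin t \<le> \<bar>z\<bar>" using lz by simp
    \<comment> \<open>Facts \<open>3\<close> and \<open>4\<close> together bound
      \<open>\<bar>z\<bar>\<close> by itself times a factor that is below one by
      \<open>less\<close>.\<close>
    have "\<bar>z\<bar> * (a * sin t * cos \<epsilon>) = (a * sin t) * (cos \<epsilon> * \<bar>z\<bar>)" by simp
    also have "\<dots> \<le> (a * sin t) * (sin \<epsilon> * x)"
      using 3 ab st by (intro mult_left_mono) auto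
    also have "\<dots> = (b * sin \<epsilon>) * (l * a * sin t)" by (simp add: x_def)
    also have "\<dots> \<le> (b * sin \<epsilon>) * \<bar>z\<bar>"
      using 4 ab se by (intro mult_left_mono) auto
    finally have "\<bar>z\<bar> * (a * sin t * cos \<epsilon> - b * sin \<epsilon>) \<le> 0" by (simp add: algebra_simps)
    then have "\<bar>z\<bar> \<le> 0" using less by (simp add: mult_le_0_iff)
    then have z: "z = 0" by simp
    then have "l = 0" using lz ab st by simp
    moreover have "q \<bullet> crossq A B = 0"
      using z crossq_swap[OF A(1) B(1)] by (simp add: z_def)
    moreover have "p \<noteq> 0 \<Longrightarrow> q \<noteq> 0"
      unfolding q_def q2_def q1_def using rot_eq_0 by blast
    ultimately show False
      using multiplier_nondegenerate[OF su2(3) qA qB] nz by auto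
  qed (use \<epsilon> in auto)
qed

end

section \<open>Normal forms and reachability\<close>

lemma exp_su2_npi:
  assumes "C \<in> su2" "norm C = 1"
  shows "exp ((real n * pi) *\<^sub>R C) = (-1) ^ n"
proof (induction n)
  case (Suc n)
  have "exp ((real (Suc n) * pi) *\<^sub>R C) = exp (pi *\<^sub>R C) * exp ((real n * pi) *\<^sub>R C)"
    by (simp add: distrib_right flip: exp_add_scaleR)
  then show ?case by (simp add: exp_su2_pi[OF assms] Suc)
qed simp

lemma exp_su2_inverse:
  assumes "C \<in> su2" "norm C = 1"
  obtains s where "0 \<le> s" "exp (s *\<^sub>R C) * exp (t *\<^sub>R C) = 1"
proof -
  define n where "n = nat \<lceil>t / (2 * pi)\<rceil>"
  have "t / (2 * pi) \<le> real n" unfolding n_def by linarith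
  then have "0 \<le> real (2 * n) * pi - t" by (simp add: field_simps)
  moreover have "exp ((real (2 * n) * pi - t) *\<^sub>R C) * exp (t *\<^sub>R C) = 1"
    using exp_su2_npi[OF assms, of "2 * n"] by (simp flip: exp_add_scaleR)
  ultimately show ?thesis using that by blast
qed

abbreviation nonneg_list :: "real list \<Rightarrow> bool" where
  "nonneg_list ts \<equiv> \<forall>t\<in>set ts. 0 \<le> t"

lemma nonneg_word_altw [simp]: "nonneg_word (altw A B ts) \<longleftrightarrow> nonneg_list ts"
  by (induction A B ts rule: altw.induct) auto

lemma length_altw [simp]: "length (altw A B ts) = length ts"
  by (induction A B ts rule: altw.induct) auto

lemma map_fst_altw [simp]: "map fst (altw A B ts) = ts"
  by (induction A B ts rule: altw.induct) auto

lemma controls_altw: "snd ` set (altw A B ts) \<subseteq> {A, B}"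
  by (induction A B ts rule: altw.induct) auto

lemma admissible_iff: "admissible X Y w \<longleftrightarrow> nonneg_word w \<and> snd ` set w \<subseteq> {X, Y}"
  by (auto simp: admissible_def nonneg_word_def)

lemma altw_of_controls:
  "map snd w = map snd (altw A B ts) \<Longrightarrow> w = altw A B (map fst w)"
proof (induction A B ts arbitrary: w rule: altw.induct)
  case (2 A B t ts)
  then show ?case by (cases w) auto
qed simp

text \<open>The neighbours of a vanishing letter share a control and merge. The first letter is
  exempt: dropping it would change the control with which the word begins.\<close>

lemma altw_shorten:
  assumes "Suc i < length ts" "ts ! Suc i = 0" "nonneg_list ts"
  shows "\<exists>us. length us < length ts \<and> nonneg_list us \<and>
    word_val (altw A B us) = word_val (altw A B ts) \<and> wcost k (altw A B us) = wcost k (altw A B ts)"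
  using assms
proof (induction ts arbitrary: A B i)
  case (Cons a ts)
  then obtain b rs where ts: "ts = b # rs" by (cases ts) auto
  show ?case
  proof (cases i)
    case 0
    then have b: "b = 0" using Cons.prems by (simp add: ts)
    show ?thesis
    proof (cases rs)
      case Nil
      then show ?thesis using Cons.prems b by (intro exI[of _ "[a]"]) (auto simp: ts)
    next
      case (Cons d us)
      then show ?thesis using Cons.prems b
        by (intro exI[of _ "(a + d) # us"]) (auto simp: ts exp_add_scaleR mult.assoc distrib_left)
    qed
  next
    case (Suc j)
    then obtain us where us: "length us < length ts" "nonneg_list us"
      "word_val (altw B A us) = word_val (altw B A ts)" "wcost k (altw B A us) = wcost k (altw B A ts)"
      using Cons.IH[of j B A] Cons.prems by auto
    then show ?thesis
      using Cons.prems by (intro exI[of _ "a # us"]) auto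
  qed
qed simp

context control_pair
begin

lemma unit_word_controls: "snd ` set w \<subseteq> {A, B} \<Longrightarrow> unit_word w"
  using A B by (auto simp: unit_word_def)

lemma unit_word_altw: "unit_word (altw A B ts)"
  by (intro unit_word_controls controls_altw)

lemma A_neq_B: "A \<noteq> B"
proof
  assume "A = B"
  then have "A \<bullet> B = 1" using A by (simp add: dot_square_norm)
  then show False using AB c by simp
qed

lemma altw_of_admissible:
  assumes "nonneg_word w" "snd ` set w \<subseteq> {A, B}"
  shows "\<exists>ts. nonneg_list ts \<and> word_val (altw A B ts) = word_val w \<and> wcost k (altw A B ts) = wcost k w"
  using assms
proof (induction w)
  case Nil
  then show ?case by (intro exI[of _ "[]"]) simp
next
  case (Cons x w)
  obtain t C where x: "x = (t, C)" by (cases x)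
  from Cons obtain ts where ts: "nonneg_list ts" "word_val (altw A B ts) = word_val w" "wcost k (altw A B ts) = wcost k w"
    by (auto simp: x)
  show ?case
  proof (cases "C = A")
    case True
    then show ?thesis using ts Cons.prems by (intro exI[of _ "t # 0 # ts"]) (auto simp: x)
  next
    case False
    then show ?thesis using ts Cons.prems by (intro exI[of _ "0 # t # ts"]) (auto simp: x)
  qed
qed

text \<open>Since \<open>exp (\<pi> C) = -1\<close> is central, half turns may be moved to the cheaper control.\<close>

lemma collect_half_turns:
  assumes "nonneg_list ts" "m \<le> k A" "m \<le> k B"
  shows "\<exists>us n. length us = length ts \<and> (\<forall>u\<in>set us. 0 \<le> u \<and> u < pi) \<and>
    word_val (altw A B ts) = (-1) ^ n * word_val (altw A B us) \<and>
    wcost k (altw A B us) + m * (real n * pi) \<le> wcost k (altw A B ts)"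
proof -
  have "\<exists>us n. length us = length ts \<and> (\<forall>u\<in>set us. 0 \<le> u \<and> u < pi) \<and>
    word_val (altw A' B' ts) = (-1) ^ n * word_val (altw A' B' us) \<and>
    wcost k (altw A' B' us) + m * (real n * pi) \<le> wcost k (altw A' B' ts)"
    if "{A', B'} = {A, B}" for A' B'
    using assms(1) that
  proof (induction ts arbitrary: A' B')
    case (Cons t ts)
    have AB': "A' \<in> su2" "norm A' = 1" "m \<le> k A'"
      using Cons.prems A B assms(2,3) by (auto simp: doubleton_eq_iff)
    obtain us n where us: "length us = length ts" "\<forall>u\<in>set us. 0 \<le> u \<and> u < pi"
      "word_val (altw B' A' ts) = (-1) ^ n * word_val (altw B' A' us)"
      "wcost k (altw B' A' us) + m * (real n * pi) \<le> wcost k (altw B' A' ts)"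
      using Cons.IH[of B' A'] Cons.prems by (auto simp: insert_commute)
    define j where "j = nat \<lfloor>t / pi\<rfloor>"
    define r where "r = t - real j * pi"
    have t: "0 \<le> t" using Cons.prems by simp
    have j: "real j \<le> t / pi" "t / pi < real j + 1"
      using t unfolding j_def by (auto simp: divide_nonneg_pos)
    have r: "0 \<le> r" "r < pi"
      using j by (auto simp: r_def field_simps)
    have t_eq: "t = real j * pi + r" by (simp add: r_def)
    have "word_val (altw A' B' (t # ts)) = (-1) ^ (j + n) * word_val (altw A' B' (r # us))"
    proof -
      have c: "exp (r *\<^sub>R A') * (-1) ^ n = (-1) ^ n * exp (r *\<^sub>R A')"
        by (induction n) auto
      have "word_val (altw A' B' (t # ts)) = (-1) ^ j * (exp (r *\<^sub>R A') * (-1) ^ n) * word_val (altw B' A' us)"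
        by (simp add: t_eq exp_add_scaleR exp_su2_npi[OF AB'(1,2)] us(3) mult.assoc)
      then show ?thesis unfolding c by (simp add: power_add mult.assoc)
    qed
    moreover have "wcost k (altw A' B' (r # us)) + m * (real (j + n) * pi) \<le> wcost k (altw A' B' (t # ts))"
    proof -
      have "m * (real j * pi) \<le> k A' * (real j * pi)"
        using AB'(3) by (intro mult_right_mono) auto
      moreover have "m * (real (j + n) * pi) = m * (real j * pi) + m * (real n * pi)"
        by (simp add: algebra_simps)
      moreover have "wcost k (altw A' B' (t # ts)) = k A' * (real j * pi) + k A' * r + wcost k (altw B' A' ts)"
        by (simp add: t_eq distrib_left)
      ultimately show ?thesis using us(4) by simp
    qed
    ultimately show ?case
      using us r by (intro exI[of _ "r # us"] exI[of _ "j + n"]) auto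
  qed (auto intro!: exI[of _ 0])
  then show ?thesis by blast
qed

text \<open>The half turns are gathered in the first letter, which carries the cheaper control, and
  only their parity is kept. This is the origin of the bound \<open>2 * pi\<close> there and
  \<open>pi\<close> elsewhere.\<close>

lemma normalize_times:
  assumes "nonneg_list ts" "0 \<le> k A" "k A \<le> k B"
  shows "\<exists>us. length us = length ts \<and> nonneg_list us \<and>
    (\<forall>i<length us. us ! i < (if i = 0 then 2 * pi else pi)) \<and>
    word_val (altw A B us) = word_val (altw A B ts) \<and> wcost k (altw A B us) \<le> wcost k (altw A B ts)"
proof (cases ts)
  case Nil
  then show ?thesis by (intro exI[of _ "[]"]) simp
next
  case (Cons t ts')
  obtain us n where us: "length us = length ts" "\<forall>u\<in>set us. 0 \<le> u \<and> u < pi"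
    "word_val (altw A B ts) = (-1) ^ n * word_val (altw A B us)"
    "wcost k (altw A B us) + k A * (real n * pi) \<le> wcost k (altw A B ts)"
    using collect_half_turns[of ts "k A" k] assms by auto
  then obtain r rs where rs: "us = r # rs" using Cons by (cases us) auto
  define j where "j = n mod 2"
  have j: "j < 2" "j \<le> n" by (simp_all add: j_def)
  have sg: "(-1 :: quat) ^ n = (-1) ^ j"
    unfolding j_def by (simp add: even_iff_mod_2_eq_zero minus_one_power_iff odd_iff_mod_2_eq_one split: if_splits)
  have v: "word_val (altw A B ((real j * pi + r) # rs)) = word_val (altw A B ts)"
    by (simp add: us(3) rs sg exp_add_scaleR exp_su2_npi[OF A] mult.assoc)
  have "k A * (real j * pi) \<le> k A * (real n * pi)"
    using j assms(2) by (intro mult_left_mono) auto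
  then have c: "wcost k (altw A B ((real j * pi + r) # rs)) \<le> wcost k (altw A B ts)"
    using us(4) by (simp add: rs distrib_left)
  have "real j * pi \<le> pi" using j by (auto simp: less_2_cases_iff)
  moreover have "r < pi" using us(2) by (simp add: rs)
  ultimately have "real j * pi + r < 2 * pi" by linarith
  then have "\<forall>i<length us. ((real j * pi + r) # rs) ! i < (if i = 0 then 2 * pi else pi)"
    using us(2) by (auto simp: rs nth_Cons split: nat.splits)
  with v c show ?thesis
    using us(1,2) by (intro exI[of _ "(real j * pi + r) # rs"]) (auto simp: rs)
qed

end

section \<open>Optimal times for a fixed length, and reachability\<close>

lemma compact_altw_values:
  "compact {(word_val (altw A B ts), wcost k (altw A B ts)) |ts. length ts = n \<and> (\<forall>t\<in>set ts. 0 \<le> t \<and> t \<le> M)}"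
  (is "compact (?P A B n)")
proof (induction n arbitrary: A B)
  case 0
  have "?P A B 0 = {(1, 0)}" by auto
  then show ?case by simp
next
  case (Suc n)
  define f where "f = (\<lambda>(t, q :: quat, s). (exp (t *\<^sub>R A) * q, k A * t + s))"
  have "?P A B (Suc n) = f ` ({0..M} \<times> ?P B A n)"
  proof (intro equalityI subsetI)
    fix x assume "x \<in> ?P A B (Suc n)"
    then obtain ts where ts: "x = (word_val (altw A B ts), wcost k (altw A B ts))" "length ts = Suc n" "\<forall>t\<in>set ts. 0 \<le> t \<and> t \<le> M"
      by blast
    then obtain t us where us: "ts = t # us" by (cases ts) auto
    have "x = f (t, word_val (altw B A us), wcost k (altw B A us))"
      by (simp add: f_def ts us)
    moreover have "(word_val (altw B A us), wcost k (altw B A us)) \<in> ?P B A n" "t \<in> {0..M}"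
      using ts us by auto
    ultimately show "x \<in> f ` ({0..M} \<times> ?P B A n)" by blast
  next
    fix x assume "x \<in> f ` ({0..M} \<times> ?P B A n)"
    then obtain t us where "x = f (t, word_val (altw B A us), wcost k (altw B A us))" "t \<in> {0..M}" "length us = n" "\<forall>t\<in>set us. 0 \<le> t \<and> t \<le> M"
      by blast
    then show "x \<in> ?P A B (Suc n)"
      by (auto simp: f_def intro!: exI[of _ "t # us"])
  qed
  moreover have "continuous_on ({0..M} \<times> ?P B A n) f"
    unfolding f_def case_prod_unfold by (intro continuous_intros continuous_exp_scaleR)
  moreover have "compact ({0..M} \<times> ?P B A n)"
    by (intro compact_Times compact_Icc Suc)
  ultimately show ?case
    by (simp only: compact_continuous_image)
qed

context control_pair
begin

text \<open>Nonnegative times do not form a compact set, but normalization sends every competitor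
  into the box of times up to \<open>2 * pi\<close> without raising its cost, and there the minimum
  over the words of the given value exists.\<close>

lemma optimal_times_exist:
  assumes "nonneg_list us" "0 \<le> k A" "k A \<le> k B"
  obtains ts where "length ts = length us" "nonneg_list ts"
    "\<forall>i<length ts. ts ! i < (if i = 0 then 2 * pi else pi)"
    "word_val (altw A B ts) = word_val (altw A B us)"
    "\<And>vs. length vs = length us \<Longrightarrow> nonneg_list vs \<Longrightarrow> word_val (altw A B vs) = word_val (altw A B us) \<Longrightarrow>
      wcost k (altw A B ts) \<le> wcost k (altw A B vs)"
proof -
  define g where "g = word_val (altw A B us)"
  define P where "P = {(word_val (altw A B ts), wcost k (altw A B ts)) |ts. length ts = length us \<and> (\<forall>t\<in>set ts. 0 \<le> t \<and> t \<le> 2 * pi)}"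
  have box: "\<exists>ts. length ts = length us \<and> (\<forall>t\<in>set ts. 0 \<le> t \<and> t \<le> 2 * pi) \<and>
    word_val (altw A B ts) = g \<and> wcost k (altw A B ts) \<le> wcost k (altw A B vs)"
    if vs: "length vs = length us" "nonneg_list vs" "word_val (altw A B vs) = g" for vs
  proof -
    obtain ts where ts: "length ts = length vs" "nonneg_list ts" "\<forall>i<length ts. ts ! i < (if i = 0 then 2 * pi else pi)"
      "word_val (altw A B ts) = word_val (altw A B vs)" "wcost k (altw A B ts) \<le> wcost k (altw A B vs)"
      using normalize_times[OF vs(2) assms(2,3)] by blast
    have "t \<le> 2 * pi" if t: "t \<in> set ts" for t
    proof -
      obtain i where "i < length ts" "t = ts ! i" using t by (metis in_set_conv_nth)
      then have "t < (if i = 0 then 2 * pi else pi)" using ts(3) by blast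
      also have "\<dots> \<le> 2 * pi" by simp
      finally show ?thesis by simp
    qed
    then show ?thesis using ts vs by auto
  qed
  have "compact P"
    unfolding P_def by (rule compact_altw_values)
  then have "compact (P \<inter> {g} \<times> UNIV)"
    by (intro compact_Int_closed closed_Times) auto
  moreover have "P \<inter> {g} \<times> UNIV \<noteq> {}"
    using box[of us] assms(1) by (auto simp: P_def g_def)
  moreover have "continuous_on (P \<inter> {g} \<times> UNIV) snd" by (intro continuous_intros)
  ultimately obtain y where y: "y \<in> P \<inter> {g} \<times> UNIV" "\<And>z. z \<in> P \<inter> {g} \<times> UNIV \<Longrightarrow> snd y \<le> snd z"
    using continuous_attains_inf by metis
  from y(1) obtain t0 where t0: "length t0 = length us" "\<forall>t\<in>set t0. 0 \<le> t \<and> t \<le> 2 * pi" "word_val (altw A B t0) = g" "snd y = wcost k (altw A B t0)"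
    by (auto simp: P_def)
  \<comment> \<open>The minimizer is only known to lie in the closed box; normalizing it once more
    gives the strict bounds.\<close>
  then obtain ts where ts: "length ts = length t0" "nonneg_list ts" "\<forall>i<length ts. ts ! i < (if i = 0 then 2 * pi else pi)"
    "word_val (altw A B ts) = word_val (altw A B t0)" "wcost k (altw A B ts) \<le> wcost k (altw A B t0)"
    using normalize_times[OF _ assms(2,3), of t0] by blast
  show ?thesis
  proof
    fix vs assume vs: "length vs = length us" "nonneg_list vs" "word_val (altw A B vs) = word_val (altw A B us)"
    then obtain v' where "length v' = length us" "\<forall>t\<in>set v'. 0 \<le> t \<and> t \<le> 2 * pi" "word_val (altw A B v') = g" "wcost k (altw A B v') \<le> wcost k (altw A B vs)"
      using box[of vs] by (auto simp: g_def)
    moreover from this have "snd y \<le> wcost k (altw A B v')"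
      using y(2)[of "(g, wcost k (altw A B v'))"] by (auto simp: P_def)
    ultimately show "wcost k (altw A B ts) \<le> wcost k (altw A B vs)"
      using ts(5) t0(4) by linarith
  qed (use ts t0 in \<open>auto simp: g_def\<close>)
qed

text \<open>The values form a semigroup, and even a group because the exponentials of the controls
  are periodic. An interior point is translated to all others with the same radius, so
  \<open>G\<close> and its complement are both open in the sphere, which is connected.\<close>

lemma word_reachable:
  assumes "norm g = 1"
  obtains w where "nonneg_word w" "snd ` set w \<subseteq> {A, B}" "word_val w = g"
proof -
  define W where "W = {w. nonneg_word w \<and> snd ` set w \<subseteq> {A, B}}"
  define G where "G = word_val ` W"
  define k where "k = (\<lambda>C. if C = A then 1 else - 1 :: real)"
  define w where "w = altw A B [1, 1, 1, 1]"
  have ww: "w \<in> W" using controls_altw[of A B] by (simp add: W_def w_def)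
  \<comment> \<open>For costs of opposite sign the relations for the two middle letters leave only the zero multiplier.\<close>
  have "varcone k w = UNIV"
  proof (rule ccontr)
    assume "varcone k w \<noteq> UNIV"
    then obtain l p where lp: "0 \<le> l" "p \<in> su2" "l \<noteq> 0 \<or> p \<noteq> 0" "is_multiplier k l p w"
      using multiplier_exists unit_word_altw w_def by metis
    have pi2: "1 < pi / 2" "1 < pi" using pi_gt3 by simp_all
    then have cs: "0 < cos (1::real)" "0 < sin (1::real)"
      by (auto intro!: cos_gt_zero_pi sin_gt_zero simp del: sin_gt_zero)
    have sin: "\<forall>i. Suc i < length [1, 1, 1 :: real] \<longrightarrow> sin ([1, 1, 1 :: real] ! i) \<noteq> 0"
      using cs by (auto simp: less_Suc_eq)
    obtain z where z: "l \<noteq> 0 \<or> z \<noteq> 0" "\<And>i. Suc i < length [1, 1, 1 :: real] \<Longrightarrow>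
      l * (if even i then k A - c * k B else k B - c * k A) * sin ([1, 1, 1] ! i) = - z * cos ([1, 1, 1] ! i)"
      using alternating_multiplier[OF lp(4)[unfolded w_def] lp(2,3) _ _ _ sin] by auto
    have kk: "k A = 1" "k B = -1" using A_neq_B by (auto simp: k_def)
    have 1: "l * (1 + c) * sin 1 = - z * cos 1" "l * (- 1 - c) * sin 1 = - z * cos 1"
      using z(2)[of 0] z(2)[of 1] by (simp_all add: kk)
    then have "z * cos 1 = 0" by (simp add: algebra_simps)
    then have "z = 0" using cs by simp
    with 1(1) cs c have "l = 0" by auto
    with \<open>z = 0\<close> z(1) show False by simp
  qed
  then obtain \<epsilon> where \<epsilon>: "0 < \<epsilon>" "\<And>y. dist y (word_val w) < \<epsilon> \<Longrightarrow>
    \<exists>v s. map snd v = map snd w \<and> nonneg_word v \<and> 0 \<le> s \<and> y = exp (wcost k v - wcost k w + s) *\<^sub>R word_val v"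
    using reachable_nearby ww W_def by (metis (mono_tags, lifting) mem_Collect_eq)
  have unit: "norm (word_val v) = 1" if "v \<in> W" for v
    using that unit_word_controls norm_word_val by (simp add: W_def)
  have near: "y \<in> G" if y: "norm y = 1" "dist y (word_val w) < \<epsilon>" for y
  proof -
    obtain v s where v: "map snd v = map snd w" "nonneg_word v" "y = exp (wcost k v - wcost k w + s) *\<^sub>R word_val v"
      using \<epsilon>(2)[OF y(2)] by blast
    have "snd ` set v = snd ` set w" using v(1) by (metis list.set_map)
    then have vW: "v \<in> W" using ww v(2) by (simp add: W_def)
    have "norm y = exp (wcost k v - wcost k w + s)" using unit[OF vW] by (simp add: v(3))
    then have "y = word_val v" using v(3) y(1) by simp
    then show ?thesis using vW by (simp add: G_def)
  qed
  have mult: "x * y \<in> G" if xy: "x \<in> G" "y \<in> G" for x y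
  proof -
    obtain u v where "u \<in> W" "x = word_val u" "v \<in> W" "y = word_val v" using xy unfolding G_def by blast
    then show ?thesis unfolding G_def by (intro image_eqI[of _ _ "u @ v"]) (auto simp: W_def)
  qed
  have inv: "\<exists>h\<in>G. h * x = 1" if "x \<in> G" for x
  proof -
    have "\<exists>u\<in>W. word_val u * word_val v = 1" if "v \<in> W" for v
      using that
    proof (induction v)
      case Nil
      then show ?case by (intro bexI[of _ "[]"]) auto
    next
      case (Cons a v)
      obtain t C where a: "a = (t, C)" by (cases a)
      from Cons obtain u where u: "u \<in> W" "word_val u * word_val v = 1" by (auto simp: W_def a)
      have "C \<in> su2" "norm C = 1" "C \<in> {A, B}" using Cons.prems A B by (auto simp: W_def a)
      then obtain s where s: "0 \<le> s" "exp (s *\<^sub>R C) * exp (t *\<^sub>R C) = 1" using exp_su2_inverse by metis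
      have "word_val (u @ [(s, C)]) * word_val (a # v) = word_val u * (exp (s *\<^sub>R C) * exp (t *\<^sub>R C)) * word_val v"
        by (simp add: a mult.assoc)
      then show ?case
        using s u \<open>C \<in> {A, B}\<close> by (intro bexI[of _ "u @ [(s, C)]"]) (auto simp: W_def)
    qed
    then show ?thesis using that by (auto simp: G_def)
  qed
  have inverse: "\<exists>h\<in>G. h * x = 1 \<and> x * h = 1" if x: "x \<in> G" for x
  proof -
    obtain h where h: "h \<in> G" "h * x = 1" using inv x by blast
    obtain h' where h': "h' * h = 1" using inv h(1) by blast
    have "x = (h' * h) * x" by (simp add: h')
    also have "\<dots> = h'" using h(2) by (simp add: mult.assoc)
    finally show ?thesis using h h' by blast
  qed
  have op: "y \<in> G" if x: "x \<in> G" and y: "norm y = 1" "dist y x < \<epsilon>" for x y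
  proof -
    obtain h where h: "h \<in> G" "h * x = 1" and xh: "x * h = 1" using inverse x by blast
    have nh: "norm h = 1" "norm x = 1" using h(1) x unit by (auto simp: G_def)
    define q where "q = word_val w"
    have q: "q \<in> G" "norm q = 1" using ww unit by (auto simp: G_def q_def)
    \<comment> \<open>Right translation by \<open>h * q\<close> is an isometry taking
      \<open>x\<close> to \<open>q\<close>, so \<open>y\<close> lands in the ball known to consist
      of values; translating back by elements of \<open>G\<close> recovers \<open>y\<close>.\<close>
    have "y * (h * q) - q = (y - x) * (h * q)"
      using xh by (simp add: left_diff_distrib flip: mult.assoc)
    then have "dist (y * (h * q)) q < \<epsilon>"
      using y(2) nh q by (simp add: dist_norm quat_norm_mult)
    then have "y * (h * q) \<in> G" using near y(1) nh q by (simp add: quat_norm_mult q_def)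
    moreover obtain q' where q': "q' \<in> G" "q * q' = 1" using inverse q(1) by blast
    ultimately have "y * (h * q) * q' * x \<in> G" using q' x mult by blast
    moreover have "y * (h * q) * q' * x = y * (h * (q * q') * x)" by (simp add: mult.assoc)
    ultimately show ?thesis by (simp add: q'(2) h(2))
  qed
  have "G \<noteq> {}" using ww by (auto simp: G_def)
  have "sphere 0 1 \<subseteq> G"
  proof (rule ccontr)
    assume n: "\<not> sphere 0 1 \<subseteq> G"
    define U where "U = (\<Union>x\<in>G. ball x \<epsilon>)"
    define V where "V = (\<Union>x\<in>sphere 0 1 - G. ball x \<epsilon>)"
    have D: "DIM(quat) = 4"
      unfolding Basis_quat_def by simp
    have "connected (sphere (0::quat) 1)"
      by (intro connected_sphere) (simp add: D)
    moreover have "open U" "open V" by (auto simp: U_def V_def)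
    moreover have "sphere 0 1 \<subseteq> U \<union> V"
    proof
      fix x :: quat assume "x \<in> sphere 0 1"
      then show "x \<in> U \<union> V"
        using \<epsilon>(1) by (cases "x \<in> G") (auto simp: U_def V_def intro!: bexI[of _ x])
    qed
    moreover have "U \<inter> V \<inter> sphere 0 1 = {}"
    proof (rule ccontr)
      assume "U \<inter> V \<inter> sphere 0 1 \<noteq> {}"
      then obtain y x z where "norm y = 1" "x \<in> G" "dist x y < \<epsilon>" "norm z = 1" "z \<notin> G" "dist z y < \<epsilon>"
        by (auto simp: U_def V_def)
      then show False using op[of x y] op[of y z] by (simp add: dist_commute)
    qed
    moreover have "U \<inter> sphere 0 1 \<noteq> {}"
    proof -
      obtain x where "x \<in> G" using \<open>G \<noteq> {}\<close> by blast
      then have "x \<in> U" unfolding U_def using \<epsilon>(1) by (intro UN_I[of x]) auto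
      moreover have "norm x = 1" using \<open>x \<in> G\<close> unit by (auto simp: G_def)
      ultimately have "x \<in> U \<inter> sphere 0 1" by simp
      then show ?thesis by blast
    qed
    moreover have "V \<inter> sphere 0 1 \<noteq> {}"
    proof -
      obtain x where x: "x \<in> sphere 0 1" "x \<notin> G" using n by blast
      then have "x \<in> V" unfolding V_def using \<epsilon>(1) by (intro UN_I[of x]) auto
      then show ?thesis using x by blast
    qed
    ultimately show False using connectedD[of "sphere 0 1" U V] by blast
  qed
  then have "g \<in> G" using assms by auto
  then show ?thesis using that by (auto simp: G_def W_def)
qed

end

section \<open>Optimal alternating words\<close>

lemma altw_append:
  "altw A B (us @ vs) = altw A B us @ (if even (length us) then altw A B vs else altw B A vs)"
  by (induction us arbitrary: A B) auto

lemma nth_altw: "i < length ts \<Longrightarrow> altw A B ts ! i = (ts ! i, if even i then A else B)"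
  by (induction A B ts arbitrary: i rule: altw.induct) (auto simp: nth_Cons split: nat.splits)

lemma altw_replicate_zero [simp]:
  "word_val (altw A B (replicate n 0)) = 1" "wcost k (altw A B (replicate n 0)) = 0"
  by (induction n arbitrary: A B) auto

lemma altw_pad:
  assumes "nonneg_list ts" "length ts \<le> n"
  shows "\<exists>us. length us = n \<and> nonneg_list us \<and> word_val (altw A B us) = word_val (altw A B ts) \<and>
    wcost k (altw A B us) = wcost k (altw A B ts)"
  using assms by (intro exI[of _ "ts @ replicate (n - length ts) 0"]) (auto simp: altw_append)

context control_pair
begin

text \<open>The list \<open>ts\<close> omits the first letter, so its even indices carry
  \<open>B\<close>. Positive sines and weights exclude \<open>z = 0\<close> in the multiplier
  relations, and \<open>l\<close> is then eliminated between two of them.\<close>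

lemma middle_times:
  assumes "opt_times k (altw A B (s # ts))" "0 < s" "\<forall>t\<in>set ts. 0 < t"
    and lt: "\<forall>i. Suc i < length ts \<longrightarrow> ts ! i < pi"
    and m: "0 < k A - c * k B" "0 < k B - c * k A"
  shows "\<lbrakk>Suc i < length ts; Suc j < length ts; even i = even j\<rbrakk> \<Longrightarrow> ts ! i = ts ! j"
    and "\<lbrakk>Suc i < length ts; Suc j < length ts; even i; odd j\<rbrakk> \<Longrightarrow>
      (k A - c * k B) * sin (ts ! i) * cos (ts ! j) = (k B - c * k A) * cos (ts ! i) * sin (ts ! j)"
proof -
  have pos: "0 < sin (ts ! i)" if "Suc i < length ts" for i
    using that assms(3) lt by (intro sin_gt_zero) auto
  have *: "(even i = even j \<longrightarrow> ts ! i = ts ! j) \<and> (even i \<and> odd j \<longrightarrow>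
      (k A - c * k B) * sin (ts ! i) * cos (ts ! j) = (k B - c * k A) * cos (ts ! i) * sin (ts ! j))"
    if i: "Suc i < length ts" and j: "Suc j < length ts" for i j
  proof -
    have ts: "ts \<noteq> []" using i by auto
    have "unit_word (altw A B (s # ts))" by (rule unit_word_altw)
    moreover have "nonneg_word (altw A B (s # ts))"
      unfolding nonneg_word_altw using assms(2,3) by (auto simp: less_imp_le)
    ultimately obtain l p where lp: "0 \<le> l" "p \<in> su2" "l \<noteq> 0 \<or> p \<noteq> 0" "is_multiplier k l p (altw A B (s # ts))"
      using opt_times_multiplier assms(1) by metis
    have "\<forall>i. Suc i < length ts \<longrightarrow> sin (ts ! i) \<noteq> 0" using pos by fastforce
    then obtain z where z: "l \<noteq> 0 \<or> z \<noteq> 0" "\<And>i. Suc i < length ts \<Longrightarrow>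
      l * (if even i then k A - c * k B else k B - c * k A) * sin (ts ! i) = - z * cos (ts ! i)"
      using alternating_multiplier[OF lp(4,2,3) ts assms(2,3)] by metis
    have "z \<noteq> 0"
    proof
      assume "z = 0"
      then show False using z(1) z(2)[OF i] pos[OF i] m by (auto split: if_splits)
    qed
    show ?thesis
    proof (intro conjI impI)
      assume par: "even i = even j"
      define x where "x = l * (if even i then k A - c * k B else k B - c * k A)"
      have x: "x * sin (ts ! i) = - z * cos (ts ! i)" "x * sin (ts ! j) = - z * cos (ts ! j)"
        using z(2)[OF i] z(2)[OF j] par by (simp_all add: x_def)
      have "z * sin (ts ! i - ts ! j) = sin (ts ! j) * (- z * cos (ts ! i)) - sin (ts ! i) * (- z * cos (ts ! j))"
        by (simp add: sin_diff algebra_simps)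
      also have "\<dots> = 0"
        unfolding x[symmetric] by simp
      finally have "sin (ts ! i - ts ! j) = 0" using \<open>z \<noteq> 0\<close> by simp
      moreover have "0 < ts ! i" "0 < ts ! j" "ts ! i < pi" "ts ! j < pi"
        using assms(3) lt i j by auto
      then have "- pi < ts ! i - ts ! j" "ts ! i - ts ! j < pi" by linarith+
      ultimately have "ts ! i - ts ! j = 0" using sin_eq_0_pi by blast
      then show "ts ! i = ts ! j" by simp
    next
      assume par: "even i \<and> odd j"
      define a where "a = k A - c * k B"
      define b where "b = k B - c * k A"
      have x: "l * a * sin (ts ! i) = - z * cos (ts ! i)" "l * b * sin (ts ! j) = - z * cos (ts ! j)"
        using z(2)[OF i] z(2)[OF j] par by (simp_all add: a_def b_def)
      have "z * (a * sin (ts ! i) * cos (ts ! j)) = (- a * sin (ts ! i)) * (- z * cos (ts ! j))"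
        by (simp only: minus_mult_minus ac_simps)
      also have "\<dots> = (- a * sin (ts ! i)) * (l * b * sin (ts ! j))"
        by (simp only: x)
      also have "\<dots> = (l * a * sin (ts ! i)) * (- b * sin (ts ! j))"
        by (simp only: minus_mult_left[symmetric] minus_mult_right[symmetric] ac_simps)
      also have "\<dots> = (- z * cos (ts ! i)) * (- b * sin (ts ! j))"
        by (simp only: x)
      also have "\<dots> = z * (b * cos (ts ! i) * sin (ts ! j))"
        by (simp only: minus_mult_minus ac_simps)
      finally show "a * sin (ts ! i) * cos (ts ! j) = b * cos (ts ! i) * sin (ts ! j)"
        using \<open>z \<noteq> 0\<close> by simp
    qed
  qed
  show "\<lbrakk>Suc i < length ts; Suc j < length ts; even i = even j\<rbrakk> \<Longrightarrow> ts ! i = ts ! j"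
    and "\<lbrakk>Suc i < length ts; Suc j < length ts; even i; odd j\<rbrakk> \<Longrightarrow>
      (k A - c * k B) * sin (ts ! i) * cos (ts ! j) = (k B - c * k A) * cos (ts ! i) * sin (ts ! j)"
    using * by blast+
qed

text \<open>Unlike \<open>opt_times\<close>, this competes against all control sequences, so it
  survives the insertion of letters of time zero.\<close>

definition opt_word :: "(quat \<Rightarrow> real) \<Rightarrow> word \<Rightarrow> bool" where
  "opt_word k w \<longleftrightarrow> nonneg_word w \<and> snd ` set w \<subseteq> {A, B} \<and>
    (\<forall>v. nonneg_word v \<and> snd ` set v \<subseteq> {A, B} \<and> word_val v = word_val w \<longrightarrow> wcost k w \<le> wcost k v)"

text \<open>Meant for \<open>r\<close> obtained from \<open>w\<close> by inserting trivial letters: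
  each adds an inequality at an instant inside a letter of \<open>w\<close>, where \<open>w\<close>
  alone gives no condition on the other control.\<close>

lemma opt_word_multiplier:
  assumes "opt_word k w" "nonneg_word r" "snd ` set r \<subseteq> {A, B}" "word_val r = word_val w" "wcost k r = wcost k w"
  obtains l p where "0 \<le> l" "p \<in> su2" "l \<noteq> 0 \<or> p \<noteq> 0" "is_multiplier k l p r"
proof -
  have "opt_times k r"
    unfolding opt_times_def
  proof (intro allI impI)
    fix v assume v: "map snd v = map snd r \<and> nonneg_word v \<and> word_val v = word_val r"
    then have "snd ` set v = snd ` set r" by (metis list.set_map)
    then show "wcost k r \<le> wcost k v"
      using v assms by (auto simp: opt_word_def)
  qed
  then show ?thesis
    using opt_times_multiplier unit_word_controls assms(2,3) that by metis
qed

lemma opt_word_middle_ge: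
  assumes "opt_word k (w @ (s, A) # (t, B) # (u, A) # w')" "0 < s" "0 < t" "t < pi" "0 < u"
    and m: "0 < k A - c * k B"
  shows "pi / 2 \<le> t"
proof -
  define r where "r = w @ (s, A) # (t / 2, B) # (0, A) # (t / 2, B) # (u, A) # w'"
  have "exp (t *\<^sub>R B) = exp ((t / 2) *\<^sub>R B) * exp ((t / 2) *\<^sub>R B)"
    by (simp flip: exp_add_scaleR)
  then have "word_val r = word_val (w @ (s, A) # (t, B) # (u, A) # w')"
    by (simp add: r_def mult.assoc)
  moreover have "wcost k r = wcost k (w @ (s, A) # (t, B) # (u, A) # w')"
    by (simp add: r_def)
  moreover have "nonneg_word r" "snd ` set r \<subseteq> {A, B}"
    using assms(1) by (auto simp: r_def opt_word_def)
  ultimately obtain l p where lp: "0 \<le> l" "p \<in> su2" "l \<noteq> 0 \<or> p \<noteq> 0" "is_multiplier k l p r"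
    using opt_word_multiplier assms(1) by metis
  have "unit_word w"
    using assms(1) by (intro unit_word_controls) (auto simp: opt_word_def)
  then have "transport w p \<in> su2" "l \<noteq> 0 \<or> transport w p \<noteq> 0"
    using lp transport_in_su2 transport_eq_0 by blast+
  moreover have "is_multiplier k l (transport w p) ((s, A) # (t / 2, B) # (0, A) # (t / 2, B) # (u, A) # w')"
    using lp(4) by (simp only: r_def is_multiplier_append)
  ultimately show ?thesis
    using middle_letter_ge lp(1) assms(2-) by blast
qed

lemma opt_word_first_lt:
  assumes "opt_word k ((s, A) # (t, B) # (u, A) # w)" "0 < t" "t < pi" "0 < u"
    and m: "0 < k A - c * k B" "0 < k B - c * k A"
  shows "s < pi"
proof (rule ccontr)
  assume s: "\<not> s < pi"
  obtain \<epsilon> where \<epsilon>: "0 < \<epsilon>" "\<epsilon> < pi / 2" "\<And>l p s u w. \<lbrakk>0 < u; 0 < s; 0 \<le> l; p \<in> su2; l \<noteq> 0 \<or> p \<noteq> 0;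
    is_multiplier k l p ((s, A) # (0, B) # (pi - 2 * \<epsilon>, A) # (0, B) # (\<epsilon>, A) # (t, B) # (u, A) # w)\<rbrakk> \<Longrightarrow> False"
    using end_letter_lt[OF assms(2,3) m] by blast
  \<comment> \<open>The trivial letters sit \<open>pi - \<epsilon>\<close> and
    \<open>\<epsilon>\<close> before the first switch; \<open>pi \<le> s\<close> leaves a positive
    time in front of them.\<close>
  define r where "r = (s - pi + \<epsilon>, A) # (0, B) # (pi - 2 * \<epsilon>, A) # (0, B) # (\<epsilon>, A) # (t, B) # (u, A) # w"
  have "s = (s - pi + \<epsilon>) + ((pi - 2 * \<epsilon>) + \<epsilon>)" by simp
  then have "exp (s *\<^sub>R A) = exp ((s - pi + \<epsilon>) *\<^sub>R A) * (exp ((pi - 2 * \<epsilon>) *\<^sub>R A) * exp (\<epsilon> *\<^sub>R A))"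
    by (metis exp_add_scaleR)
  then have "word_val r = word_val ((s, A) # (t, B) # (u, A) # w)"
    by (simp add: r_def mult.assoc)
  moreover have "wcost k r = wcost k ((s, A) # (t, B) # (u, A) # w)"
    by (simp add: r_def algebra_simps)
  moreover have "nonneg_word r" "snd ` set r \<subseteq> {A, B}"
    using assms(1) s \<epsilon> by (auto simp: r_def opt_word_def)
  ultimately obtain l p where lp: "0 \<le> l" "p \<in> su2" "l \<noteq> 0 \<or> p \<noteq> 0" "is_multiplier k l p r"
    using opt_word_multiplier assms(1) by metis
  have "0 < s - pi + \<epsilon>" using s \<epsilon>(1) by simp
  then show False using \<epsilon>(3)[OF assms(4) _ lp(1,2,3)] lp(4) r_def by blast
qed

text \<open>By hypothesis only the first letter can vanish; if it does, it is dropped and the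
  controls exchange roles. Competitors of the shortened word are compared after the zero letter is
  put back.\<close>

lemma opt_times_drop_zero:
  assumes "length ts = n" "nonneg_list ts" "\<forall>i. Suc i < length ts \<longrightarrow> 0 < ts ! Suc i"
    and opt: "\<And>vs. length vs = length ts \<Longrightarrow> nonneg_list vs \<Longrightarrow> word_val (altw A B vs) = word_val (altw A B ts) \<Longrightarrow>
      wcost k (altw A B ts) \<le> wcost k (altw A B vs)"
    and lt: "\<forall>i<length ts. ts ! i < (if i = 0 then 2 * pi else pi)"
  obtains A' B' us where "(A', B') = (A, B) \<or> (A', B') = (B, A)" "length us \<le> n" "n \<le> Suc (length us)"
    "\<forall>t\<in>set us. 0 < t" "\<forall>i<length us. us ! i < (if i = 0 then 2 * pi else pi)"
    "word_val (altw A' B' us) = word_val (altw A B ts)" "wcost k (altw A' B' us) = wcost k (altw A B ts)"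
    "opt_times k (altw A' B' us)"
proof -
  have pos: "\<forall>t\<in>set (tl ts). 0 < t"
  proof
    fix t assume "t \<in> set (tl ts)"
    then obtain i where "i < length (tl ts)" "t = tl ts ! i" by (metis in_set_conv_nth)
    then show "0 < t" using assms(3) by (simp add: nth_tl)
  qed
  show ?thesis
  proof (cases "ts \<noteq> [] \<and> hd ts = 0")
    case True
    then obtain us where us: "ts = 0 # us" by (cases ts) auto
    show ?thesis
    proof (rule that[of B A us])
      show "\<forall>i<length us. us ! i < (if i = 0 then 2 * pi else pi)"
      proof (intro allI impI)
        fix i assume "i < length us"
        then have "us ! i < pi" using lt by (auto simp: us dest: spec[of _ "Suc i"])
        also have "pi \<le> (if i = 0 then 2 * pi else pi)" by simp
        finally show "us ! i < (if i = 0 then 2 * pi else pi)" .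
      qed
      show "opt_times k (altw B A us)"
        unfolding opt_times_def
      proof (intro allI impI)
        fix v assume v: "map snd v = map snd (altw B A us) \<and> nonneg_word v \<and> word_val v = word_val (altw B A us)"
        then obtain vs where vs: "v = altw B A vs" using altw_of_controls by metis
        have "length vs = length us" using v by (metis vs length_altw length_map)
        then show "wcost k (altw B A us) \<le> wcost k v"
          using opt[of "0 # vs"] v by (simp add: us vs)
      qed
    qed (use pos assms(1) us in auto)
  next
    case False
    show ?thesis
    proof (rule that[of A B ts])
      show "\<forall>t\<in>set ts. 0 < t"
        using False pos assms(2) by (cases ts) (auto simp: less_le)
      show "opt_times k (altw A B ts)"
        unfolding opt_times_def
      proof (intro allI impI)
        fix v assume v: "map snd v = map snd (altw A B ts) \<and> nonneg_word v \<and> word_val v = word_val (altw A B ts)"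
        then obtain vs where vs: "v = altw A B vs" using altw_of_controls by metis
        have "length vs = length ts" using v by (metis vs length_altw length_map)
        then show "wcost k (altw A B ts) \<le> wcost k v"
          using opt[of vs] v by (simp add: vs)
      qed
    qed (use lt assms(1) in auto)
  qed
qed

end

section \<open>Limits of long words\<close>

text \<open>Telescoping; all powers involved have norm at most one.\<close>

lemma norm_power_diff_le:
  fixes x y :: "'a::real_normed_algebra_1"
  assumes "norm x \<le> 1" "norm y \<le> 1"
  shows "norm (x ^ n - y ^ n) \<le> real n * norm (x - y)"
proof (induction n)
  case (Suc n)
  have "x ^ Suc n - y ^ Suc n = x * (x ^ n - y ^ n) + (x - y) * y ^ n"
    by (simp add: algebra_simps)
  also have "norm \<dots> \<le> norm x * norm (x ^ n - y ^ n) + norm (x - y) * norm (y ^ n)"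
    by (intro order_trans[OF norm_triangle_ineq] add_mono norm_mult_ineq)
  also have "\<dots> \<le> 1 * (real n * norm (x - y)) + norm (x - y) * 1"
    using assms Suc order_trans[OF norm_power_ineq[of y n] power_le_one[of "norm y" n]]
    by (intro add_mono mult_mono) auto
  finally show ?case by (simp add: algebra_simps)
qed simp

lemma exp_scaleR_quotient_limit:
  fixes C :: "'a::{real_normed_algebra_1,banach}"
  assumes n: "filterlim n at_top F" and nx: "((\<lambda>i. n i * x i) \<longlongrightarrow> \<alpha>) F"
  shows "((\<lambda>i. n i *\<^sub>R (exp (x i *\<^sub>R C) - 1)) \<longlongrightarrow> \<alpha> *\<^sub>R C) F"
proof -
  have "((\<lambda>t. exp (t *\<^sub>R C)) has_vector_derivative C) (at 0)"
    using exp_scaleR_has_vector_derivative_right[of C 0 UNIV] by simp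
  then have D: "((\<lambda>h. (1 / norm h) *\<^sub>R (exp (h *\<^sub>R C) - (1 + h *\<^sub>R C))) \<longlongrightarrow> 0) (at 0)"
    unfolding has_vector_derivative_def has_derivative_within by simp
  \<comment> \<open>\<open>f 0 = 0\<close>, so \<open>D\<close> is continuity at \<open>0\<close>,
    and the family \<open>x\<close> may take the value \<open>0\<close>.\<close>
  define f where "f = (\<lambda>h. (1 / norm h) *\<^sub>R (exp (h *\<^sub>R C) - (1 + h *\<^sub>R C)))"
  have "isCont f 0" using D by (simp add: f_def isCont_def)
  have x0: "(x \<longlongrightarrow> 0) F"
  proof -
    have "((\<lambda>i. inverse (n i) * (n i * x i)) \<longlongrightarrow> 0 * \<alpha>) F"
      by (intro tendsto_mult nx tendsto_inverse_0_at_top n)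
    moreover have "\<forall>\<^sub>F i in F. inverse (n i) * (n i * x i) = x i"
      using filterlim_at_top_dense[THEN iffD1, OF n, rule_format, of 0]
      by eventually_elim simp
    ultimately show ?thesis by (simp add: tendsto_cong)
  qed
  have "((\<lambda>i. f (x i)) \<longlongrightarrow> f 0) F"
    using isCont_tendsto_compose[OF \<open>isCont f 0\<close> x0] .
  then have "((\<lambda>i. \<bar>n i * x i\<bar> *\<^sub>R f (x i)) \<longlongrightarrow> \<bar>\<alpha>\<bar> *\<^sub>R f 0) F"
    by (intro tendsto_intros nx)
  then have "((\<lambda>i. \<bar>n i * x i\<bar> *\<^sub>R f (x i) + (n i * x i) *\<^sub>R C) \<longlongrightarrow> \<bar>\<alpha>\<bar> *\<^sub>R f 0 + \<alpha> *\<^sub>R C) F"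
    by (rule tendsto_add) (intro tendsto_intros nx)
  moreover have "\<forall>\<^sub>F i in F. \<bar>n i * x i\<bar> *\<^sub>R f (x i) + (n i * x i) *\<^sub>R C = n i *\<^sub>R (exp (x i *\<^sub>R C) - 1)"
    using filterlim_at_top_dense[THEN iffD1, OF n, rule_format, of 0]
  proof eventually_elim
    case (elim i)
    then show ?case
      by (cases "x i = 0") (auto simp: f_def abs_mult algebra_simps)
  qed
  ultimately show ?thesis by (simp add: tendsto_cong f_def)
qed

lemma norm_exp_su2_le: "W \<in> su2 \<Longrightarrow> norm (exp W) = 1"
proof (cases "W = 0")
  case False
  assume "W \<in> su2"
  then have "norm (exp (norm W *\<^sub>R (W /\<^sub>R norm W))) = 1"
    using False by (intro norm_exp_su2) (auto simp: su2_def)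
  then show ?thesis using False by simp
qed simp

lemma exp_real_scaleR:
  fixes C :: "'a::{real_normed_algebra_1,banach}"
  shows "exp (real n *\<^sub>R C) = exp C ^ n"
proof (induction n)
  case (Suc n)
  have "exp (real (Suc n) *\<^sub>R C) = exp (1 *\<^sub>R C) * exp (real n *\<^sub>R C)"
    by (simp only: of_nat_Suc exp_add_scaleR)
  then show ?case by (simp add: Suc)
qed simp

text \<open>Let \<open>Q\<close> be the exponential of \<open>W\<close> divided by \<open>n\<close>.
  Both \<open>P - 1\<close> and \<open>Q - 1\<close>, multiplied by \<open>n\<close>, tend to
  \<open>W\<close>, so \<open>n\<close> times the norm of \<open>P - Q\<close> tends to
  \<open>0\<close> and bounds the difference of the \<open>n\<close>-th powers. For positive
  \<open>n\<close> the power of \<open>Q\<close> is exactly \<open>exp W\<close>.\<close>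

lemma lie_product_limit:
  assumes A: "A \<in> su2" "norm A = 1" and B: "B \<in> su2" "norm B = 1"
    and n: "filterlim n at_top sequentially"
    and x: "(\<lambda>i. real (n i) * x i) \<longlonglongrightarrow> a" and y: "(\<lambda>i. real (n i) * y i) \<longlonglongrightarrow> b"
  shows "(\<lambda>i. (exp (x i *\<^sub>R A) * exp (y i *\<^sub>R B)) ^ n i) \<longlonglongrightarrow> exp (a *\<^sub>R A + b *\<^sub>R B)"
proof -
  define W where "W = a *\<^sub>R A + b *\<^sub>R B"
  define P where "P = (\<lambda>i. exp (x i *\<^sub>R A) * exp (y i *\<^sub>R B))"
  define Q where "Q = (\<lambda>i. exp (inverse (real (n i)) *\<^sub>R W))"
  have n': "filterlim (\<lambda>i. real (n i)) at_top sequentially"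
    by (rule filterlim_compose[OF filterlim_real_sequentially n])
  have pos: "\<forall>\<^sub>F i in sequentially. 0 < n i"
    using filterlim_at_top_dense[THEN iffD1, OF n', rule_format, of 0] by simp
  have y0: "y \<longlonglongrightarrow> 0"
  proof -
    have "(\<lambda>i. inverse (real (n i)) * (real (n i) * y i)) \<longlonglongrightarrow> 0 * b"
      by (intro tendsto_mult y tendsto_inverse_0_at_top n')
    moreover have "\<forall>\<^sub>F i in sequentially. inverse (real (n i)) * (real (n i) * y i) = y i"
      using pos by eventually_elim simp
    ultimately show ?thesis by (simp add: tendsto_cong)
  qed
  have "(\<lambda>i. exp (y i *\<^sub>R B)) \<longlonglongrightarrow> exp (0 *\<^sub>R B)"
    by (rule continuous_on_tendsto_compose[OF continuous_exp_scaleR[OF continuous_on_id, of UNIV] y0]) auto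
  then have "(\<lambda>i. (real (n i) *\<^sub>R (exp (x i *\<^sub>R A) - 1)) * exp (y i *\<^sub>R B) + real (n i) *\<^sub>R (exp (y i *\<^sub>R B) - 1))
      \<longlonglongrightarrow> (a *\<^sub>R A) * exp (0 *\<^sub>R B) + b *\<^sub>R B"
    by (intro tendsto_intros exp_scaleR_quotient_limit n' x y)
  then have P: "(\<lambda>i. real (n i) *\<^sub>R (P i - 1)) \<longlonglongrightarrow> W"
    by (simp add: P_def W_def algebra_simps)
  have "(\<lambda>i. real (n i) * inverse (real (n i))) \<longlonglongrightarrow> 1"
    by (rule tendsto_eventually) (use pos in eventually_elim, simp)
  then have Q: "(\<lambda>i. real (n i) *\<^sub>R (Q i - 1)) \<longlonglongrightarrow> 1 *\<^sub>R W"
    unfolding Q_def by (intro exp_scaleR_quotient_limit n')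
  have "(\<lambda>i. norm (real (n i) *\<^sub>R (P i - 1) - real (n i) *\<^sub>R (Q i - 1))) \<longlonglongrightarrow> norm (W - 1 *\<^sub>R W)"
    by (intro tendsto_intros P Q)
  moreover have "norm (real (n i) *\<^sub>R (P i - 1) - real (n i) *\<^sub>R (Q i - 1)) = real (n i) * norm (P i - Q i)" for i
    by (simp flip: scaleR_diff_right)
  ultimately have null: "(\<lambda>i. real (n i) * norm (P i - Q i)) \<longlonglongrightarrow> 0" by simp
  have le: "norm (P i ^ n i - Q i ^ n i) \<le> real (n i) * norm (P i - Q i)" for i
  proof (rule norm_power_diff_le)
    show "norm (P i) \<le> 1" using A B by (simp add: P_def quat_norm_mult)
    have "inverse (real (n i)) *\<^sub>R W \<in> su2" using A B by (simp add: W_def su2_def)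
    then show "norm (Q i) \<le> 1" by (simp add: Q_def norm_exp_su2_le)
  qed
  have lim: "(\<lambda>i. P i ^ n i - Q i ^ n i) \<longlonglongrightarrow> 0"
    by (rule Lim_null_comparison[OF always_eventually null]) (simp add: le)
  have "\<forall>\<^sub>F i in sequentially. Q i ^ n i = exp W"
    using pos
  proof eventually_elim
    case (elim i)
    then show ?case
      by (simp add: Q_def flip: exp_real_scaleR)
  qed
  then have "(\<lambda>i. Q i ^ n i) \<longlonglongrightarrow> exp W" by (rule tendsto_eventually)
  from tendsto_add[OF lim this] show ?thesis by (simp add: P_def W_def)
qed

text \<open>Nothing says in advance that \<open>y\<close> is small, but for small \<open>x\<close>
  the relation forces \<open>cos y\<close> to be positive. Then \<open>y\<close> is
  \<open>arctan (q / p * tan x)\<close>, whose derivative in \<open>x\<close> at \<open>0\<close> is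
  \<open>q / p\<close>.\<close>

lemma tangent_relation_limit:
  fixes x y :: "nat \<Rightarrow> real"
  assumes p: "0 < p" "0 < q"
    and x: "\<And>i. 0 < x i" and y: "\<And>i. 0 < y i" "\<And>i. y i < pi"
    and rel: "\<And>i. p * sin (y i) * cos (x i) = q * cos (y i) * sin (x i)"
    and n: "filterlim n at_top sequentially" and nx: "(\<lambda>i. real (n i) * x i) \<longlonglongrightarrow> l"
  shows "(\<lambda>i. real (n i) * y i) \<longlonglongrightarrow> q / p * l"
proof -
  have n': "filterlim (\<lambda>i. real (n i)) at_top sequentially"
    by (rule filterlim_compose[OF filterlim_real_sequentially n])
  have x0: "x \<longlonglongrightarrow> 0"
  proof -
    have "(\<lambda>i. inverse (real (n i)) * (real (n i) * x i)) \<longlonglongrightarrow> 0 * l"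
      by (intro tendsto_mult nx tendsto_inverse_0_at_top n')
    moreover have "\<forall>\<^sub>F i in sequentially. inverse (real (n i)) * (real (n i) * x i) = x i"
      using filterlim_at_top_dense[THEN iffD1, OF n', rule_format, of 0] by eventually_elim simp
    ultimately show ?thesis by (simp add: tendsto_cong)
  qed
  have "((\<lambda>h. arctan (q / p * tan h)) has_real_derivative q / p) (at 0)"
    by (rule derivative_eq_intros refl | simp)+
  then have "((\<lambda>h. arctan (q / p * tan h) / h) \<longlongrightarrow> q / p) (at 0)"
    by (simp add: DERIV_def)
  moreover have "filterlim x (at 0) sequentially"
    using x0 x by (auto simp: filterlim_at less_imp_neq[symmetric])
  ultimately have "(\<lambda>i. arctan (q / p * tan (x i)) / x i) \<longlonglongrightarrow> q / p"
    by (rule filterlim_compose)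
  then have "(\<lambda>i. (real (n i) * x i) * (arctan (q / p * tan (x i)) / x i)) \<longlonglongrightarrow> l * (q / p)"
    by (rule tendsto_mult[OF nx])
  moreover have "\<forall>\<^sub>F i in sequentially. x i < pi / 2"
    using order_tendstoD(2)[OF x0, of "pi / 2"] by simp
  then have "\<forall>\<^sub>F i in sequentially. (real (n i) * x i) * (arctan (q / p * tan (x i)) / x i) = real (n i) * y i"
  proof eventually_elim
    case (elim i)
    have s: "0 < sin (x i)" "0 < cos (x i)"
      using elim x[of i] by (auto intro!: sin_gt_zero2 cos_gt_zero)
    have sy: "0 < sin (y i)" using y by (intro sin_gt_zero)
    have "0 < q * cos (y i) * sin (x i)"
      unfolding rel[symmetric] using s sy p by simp
    then have cy: "0 < cos (y i)"
      using s p by (simp add: zero_less_mult_iff)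
    have "y i < pi / 2"
    proof (rule ccontr)
      assume "\<not> y i < pi / 2"
      then have "cos (y i) \<le> cos (pi / 2)"
        using y[of i] by (intro cos_monotone_0_pi_le) auto
      then show False using cy by simp
    qed
    moreover have "tan (y i) = q / p * tan (x i)"
      using rel[of i] s cy p by (simp add: tan_def field_simps)
    ultimately have "arctan (q / p * tan (x i)) = y i"
      using y[of i] by (metis arctan_unique neg_less_0_iff_less pi_half_gt_zero less_trans)
    then show ?case using x[of i] by simp
  qed
  ultimately show ?thesis by (simp add: tendsto_cong mult.commute)
qed

text \<open>Pigeonhole: if every element of the finite set failed somewhere, all would fail at the
  largest of these indices.\<close>

lemma uniform_choice_of_antimono:
  assumes "finite F" "\<And>N. \<exists>x\<in>F. P N x" and mono: "\<And>M N x. M \<le> N \<Longrightarrow> P N x \<Longrightarrow> P (M::nat) x"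
  shows "\<exists>x\<in>F. \<forall>N. P N x"
proof (rule ccontr)
  assume "\<not> ?thesis"
  then obtain m where m: "\<And>x. x \<in> F \<Longrightarrow> \<not> P (m x) x" by metis
  have "m x \<le> Max (m ` F)" if "x \<in> F" for x using assms(1) that by simp
  moreover obtain x where "x \<in> F" "P (Max (m ` F)) x" using assms(2) by blast
  ultimately show False using m mono by blast
qed

section \<open>The optimal control problem\<close>

locale cost_pair = control_pair X Y c for X Y c +
  fixes \<kappa> :: real
  assumes \<kappa>: "0 \<le> \<kappa>" "c < \<kappa>" "\<kappa> \<le> 1"
begin

abbreviation "k \<equiv> cost_factor X \<kappa>"

lemma cost_factors: "k X = 1" "k Y = \<kappa>"
  using A_neq_B by (auto simp: cost_factor_def)

text \<open>These are the coefficients of \<open>W\<close>. The second is positive by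
  \<open>c < \<kappa>\<close>, the first because \<open>\<bar>c\<bar> < 1\<close> and
  \<open>0 \<le> \<kappa> \<le> 1\<close>.\<close>

lemma weights_pos: "0 < k X - c * k Y" "0 < k Y - c * k X"
proof -
  have "c * \<kappa> \<le> \<bar>c\<bar> * 1"
    using \<kappa> by (metis abs_ge_self abs_ge_zero abs_mult abs_of_nonneg mult_left_mono order_trans)
  then show "0 < k X - c * k Y" "0 < k Y - c * k X"
    using c \<kappa> by (simp_all add: cost_factors)
qed

lemma opt_word_swap: "control_pair.opt_word Y X k w = opt_word k w"
  unfolding control_pair.opt_word_def[OF swap] opt_word_def by (simp add: insert_commute)

lemma altw_of_word:
  assumes "nonneg_word w" "snd ` set w \<subseteq> {X, Y}"
  obtains ts where "nonneg_list ts" "word_val (altw Y X ts) = word_val w" "wcost k (altw Y X ts) = wcost k w"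
  using control_pair.altw_of_admissible[OF swap, of w k] assms by (auto simp: insert_commute)

lemma wcost_nonneg: "nonneg_word w \<Longrightarrow> 0 \<le> wcost k w"
proof (induction w)
  case (Cons x w)
  have "0 \<le> k C" for C using \<kappa> by (simp add: cost_factor_def)
  with Cons show ?case by (cases x) auto
qed simp

text \<open>A list of least length with property \<open>P\<close> is minimized over its times;
  \<open>P\<close> passes to lower costs, and minimality of the length lets no letter but the first
  vanish. Later \<open>P\<close> is a bound by the infimum or a strict bound by the cost of another
  word. The list \<open>ts\<close> is returned for comparing lengths, as \<open>us\<close> may lack
  its vanishing first letter.\<close>

lemma shortest_word:
  assumes ts0: "nonneg_list ts0" "word_val (altw Y X ts0) = g" and P: "P (wcost k (altw Y X ts0))"
    and P_mono: "\<And>a b. P b \<Longrightarrow> a \<le> b \<Longrightarrow> P a"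
  obtains A B us ts where "(A, B) = (Y, X) \<or> (A, B) = (X, Y)"
    "\<forall>t\<in>set us. 0 < t" "\<forall>i<length us. us ! i < (if i = 0 then 2 * pi else pi)"
    "word_val (altw A B us) = g" "P (wcost k (altw A B us))" "opt_times k (altw A B us)"
    "nonneg_list ts" "word_val (altw Y X ts) = g" "P (wcost k (altw Y X ts))" "length ts \<le> Suc (length us)"
proof -
  interpret YX: control_pair Y X c by (rule swap)
  define Q where "Q n \<longleftrightarrow> (\<exists>ts. length ts = n \<and> nonneg_list ts \<and> word_val (altw Y X ts) = g \<and> P (wcost k (altw Y X ts)))" for n
  define n where "n = (LEAST n. Q n)"
  have "Q (length ts0)" using ts0 P unfolding Q_def by blast
  then have "Q n" unfolding n_def by (rule LeastI)
  have least: "n \<le> m" if "Q m" for m unfolding n_def using that by (rule Least_le)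
  from \<open>Q n\<close> obtain ts1 where ts1: "length ts1 = n" "nonneg_list ts1" "word_val (altw Y X ts1) = g" "P (wcost k (altw Y X ts1))"
    unfolding Q_def by blast
  have kk: "0 \<le> k Y" "k Y \<le> k X" using \<kappa> by (simp_all add: cost_factors)
  obtain ts where ts: "length ts = length ts1" "nonneg_list ts"
    "\<forall>i<length ts. ts ! i < (if i = 0 then 2 * pi else pi)"
    "word_val (altw Y X ts) = word_val (altw Y X ts1)"
    and opt: "\<And>vs. length vs = length ts1 \<Longrightarrow> nonneg_list vs \<Longrightarrow> word_val (altw Y X vs) = word_val (altw Y X ts1) \<Longrightarrow>
      wcost k (altw Y X ts) \<le> wcost k (altw Y X vs)"
    using YX.optimal_times_exist[OF ts1(2) kk] by metis
  have Pts: "P (wcost k (altw Y X ts))"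
    using P_mono[OF ts1(4)] opt[OF refl ts1(2) refl] by blast
  have pos: "\<forall>i. Suc i < length ts \<longrightarrow> 0 < ts ! Suc i"
  proof (intro allI impI)
    fix i assume i: "Suc i < length ts"
    have "0 \<le> ts ! Suc i" using ts(2) i by simp
    moreover have "ts ! Suc i \<noteq> 0"
    proof
      assume "ts ! Suc i = 0"
      from altw_shorten[OF i this ts(2), of Y X k]
      obtain vs where "length vs < length ts" "nonneg_list vs"
        "word_val (altw Y X vs) = word_val (altw Y X ts)" "wcost k (altw Y X vs) = wcost k (altw Y X ts)"
        by blast
      then have "Q (length vs)" using ts1 ts Pts unfolding Q_def by metis
      then show False using least \<open>length vs < length ts\<close> ts(1) ts1(1) by fastforce
    qed
    ultimately show "0 < ts ! Suc i" by simp
  qed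
  have opt': "wcost k (altw Y X ts) \<le> wcost k (altw Y X vs)"
    if "length vs = length ts" "nonneg_list vs" "word_val (altw Y X vs) = word_val (altw Y X ts)" for vs
    using opt that ts by simp
  obtain A B us where us: "(A, B) = (Y, X) \<or> (A, B) = (X, Y)" "length us \<le> length ts" "length ts \<le> Suc (length us)"
    "\<forall>t\<in>set us. 0 < t" "\<forall>i<length us. us ! i < (if i = 0 then 2 * pi else pi)"
    "word_val (altw A B us) = word_val (altw Y X ts)" "wcost k (altw A B us) = wcost k (altw Y X ts)"
    "opt_times k (altw A B us)"
    by (rule YX.opt_times_drop_zero[OF refl ts(2) pos opt' ts(3)]) (assumption | rule that)+
  have v: "word_val (altw A B us) = g" "word_val (altw Y X ts) = g"
    by (simp_all only: us(6) ts(4) ts1(3))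
  have Pus: "P (wcost k (altw A B us))" using Pts by (simp only: us(7))
  show ?thesis
    by (rule that[OF us(1,4,5) v(1) Pus us(8) ts(2) v(2) Pts us(3)])
qed

lemma pair_locale:
  assumes "(A, B) = (Y, X) \<or> (A, B) = (X, Y)"
  shows "control_pair A B c" "0 < k A - c * k B" "0 < k B - c * k A"
    "control_pair.opt_word A B k w = opt_word k w"
  using assms swap control_pair_axioms weights_pos opt_word_swap by auto

lemma optimal_alternating_word:
  assumes AB: "(A, B) = (Y, X) \<or> (A, B) = (X, Y)" and opt: "opt_word k (altw A B us)"
    and pos: "\<forall>t\<in>set us. 0 < t" and lt: "\<forall>i<length us. us ! i < (if i = 0 then 2 * pi else pi)"
    and len: "3 \<le> length us"
  shows "\<forall>i<length us. us ! i < pi" "\<forall>i. 0 < i \<and> Suc i < length us \<longrightarrow> pi / 2 \<le> us ! i"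
proof -
  interpret AB: control_pair A B c by (rule pair_locale[OF AB])
  note m = pair_locale(2,3)[OF AB]
  obtain s t u rest where us: "us = s # t # u # rest"
    using len by (metis Suc_le_length_iff numeral_3_eq_3)
  \<comment> \<open>Only the first letter needs an argument; normalization already bounds the others
    by \<open>pi\<close>.\<close>
  have "s < pi"
  proof (rule AB.opt_word_first_lt[OF _ _ _ _ m])
    show "AB.opt_word k ((s, A) # (t, B) # (u, A) # altw B A rest)"
      using opt by (simp add: pair_locale(4)[OF AB] us)
    show "t < pi" using lt by (auto simp: us dest: spec[of _ 1])
  qed (use pos in \<open>auto simp: us\<close>)
  then show "\<forall>i<length us. us ! i < pi"
    using lt by (metis us nth_Cons_0)
  show "\<forall>i. 0 < i \<and> Suc i < length us \<longrightarrow> pi / 2 \<le> us ! i"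
  proof (intro allI impI)
    fix i assume i: "0 < i \<and> Suc i < length us"
    then obtain j where j: "i = Suc j" by (cases i) auto
    have split: "us = take j us @ us ! j # us ! Suc j # us ! Suc (Suc j) # drop (Suc (Suc (Suc j))) us"
      using i j by (simp add: Cons_nth_drop_Suc)
    have ij: "0 < us ! j" "0 < us ! Suc j" "us ! Suc j < pi" "0 < us ! Suc (Suc j)"
      using i j pos lt[rule_format, of "Suc j"] by auto
    show "pi / 2 \<le> us ! i"
    proof (cases "even j")
      case True
      have "altw A B us = altw A B (take j us) @ (us ! j, A) # (us ! Suc j, B) # (us ! Suc (Suc j), A) # altw B A (drop (Suc (Suc (Suc j))) us)"
        using i j True by (subst split) (simp add: altw_append)
      then show ?thesis
        using AB.opt_word_middle_ge[OF _ ij m(1)] opt unfolding pair_locale(4)[OF AB] j by metis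
    next
      case False
      interpret BA: control_pair B A c by (rule AB.swap)
      have "altw A B us = altw A B (take j us) @ (us ! j, B) # (us ! Suc j, A) # (us ! Suc (Suc j), B) # altw A B (drop (Suc (Suc (Suc j))) us)"
        using i j False by (subst split) (simp add: altw_append)
      moreover have "BA.opt_word k w = opt_word k w" for w
        using AB by (intro pair_locale(4)) auto
      ultimately show ?thesis
        using BA.opt_word_middle_ge[OF _ ij m(2)] opt unfolding j by metis
    qed
  qed
qed

lemma tm_altw: "1 \<le> i \<Longrightarrow> i \<le> length us \<Longrightarrow> tm (altw A B us) i = us ! (i - 1)"
  by (simp add: tm_def nth_altw)

lemma ctrl_altw: "1 \<le> i \<Longrightarrow> i \<le> length us \<Longrightarrow> ctrl (altw A B us) i = (if odd i then A else B)"
  by (auto simp: ctrl_def nth_altw)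

text \<open>The bound on the first parameter in \<open>opt_word_first_lt\<close> needs three
  letters. Words with at most two are instead read as instances of the second alternative with
  \<open>t2 = 0\<close>.\<close>

lemma short_word:
  assumes "(A, B) = (Y, X) \<or> (A, B) = (X, Y)" "nonneg_list us" "length us \<le> 2"
  shows "\<exists>C1\<in>{X, Y}. \<exists>C3\<in>{X, Y}. \<exists>t1 t3. 0 \<le> t1 \<and> 0 \<le> t3 \<and>
    word_val (altw A B us) = exp (t1 *\<^sub>R C1) * exp (t3 *\<^sub>R C3) \<and> wcost k (altw A B us) = k C1 * t1 + k C3 * t3"
proof -
  consider "us = []" | s where "us = [s]" | s t where "us = [s, t]"
    using assms(3) by (cases us; cases "tl us") auto
  then have "\<exists>s t. 0 \<le> s \<and> 0 \<le> t \<and> word_val (altw A B us) = exp (s *\<^sub>R A) * exp (t *\<^sub>R B) \<and>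
    wcost k (altw A B us) = k A * s + k B * t"
  proof cases
    case 1
    then show ?thesis by (intro exI[of _ 0]) auto
  next
    case (2 s)
    then show ?thesis using assms(2) by (intro exI[of _ s] exI[of _ 0]) auto
  next
    case (3 s t)
    then show ?thesis using assms(2) by (intro exI[of _ s] exI[of _ t]) auto
  qed
  then show ?thesis using assms(1) by blast
qed

lemma long_word:
  assumes AB: "(A, B) = (Y, X) \<or> (A, B) = (X, Y)" and opt: "opt_word k (altw A B us)" "opt_times k (altw A B us)"
    and pos: "\<forall>t\<in>set us. 0 < t" and lt: "\<forall>i<length us. us ! i < (if i = 0 then 2 * pi else pi)"
    and len: "3 \<le> length us"
  defines "w \<equiv> altw A B us" and "n \<equiv> length us"
  shows "reduced_word w" "strong_pi_condition Y w"
    "\<forall>p. 2 \<le> p \<and> p + 3 \<le> n \<longrightarrow> tm w p = tm w (p + 2)"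
    "\<forall>i\<in>middle w. pi / 2 \<le> tm w i \<and> tm w i < pi"
    "\<forall>i\<in>middle w. \<forall>j\<in>middle w. ctrl w i = X \<and> ctrl w j = Y \<longrightarrow>
       (1 - \<kappa> * c) * sin (tm w j) * cos (tm w i) = (\<kappa> - c) * cos (tm w j) * sin (tm w i)"
proof -
  interpret AB: control_pair A B c by (rule pair_locale[OF AB])
  note m = pair_locale(2,3)[OF AB]
  note ltpi = optimal_alternating_word(1)[OF AB opt(1) pos lt len]
  note gepi2 = optimal_alternating_word(2)[OF AB opt(1) pos lt len]
  have lw: "length w = n" by (simp add: w_def n_def)
  have tm: "tm w i = us ! (i - 1)" if "1 \<le> i" "i \<le> n" for i
    using that by (simp add: w_def n_def tm_altw)
  have tm_lt: "tm w i < pi" if "1 \<le> i" "i \<le> n" for i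
    using that ltpi by (simp add: tm n_def)
  obtain s ts where us: "us = s # ts" using len by (cases us) auto
  have "distinct_adj (map snd (altw A B us))"
    using AB.A_neq_B
  proof (induction us arbitrary: A B)
    case (Cons a us)
    then show ?case by (cases us) fastforce+
  qed simp
  moreover have "0 < t" if "(t, C) \<in> set w" for t C
  proof -
    have "t \<in> set (map fst w)" using that by force
    then show ?thesis using pos by (simp add: w_def)
  qed
  ultimately show "reduced_word w" by (auto simp: reduced_word_def w_def)
  \<comment> \<open>All parameters are less than \<open>pi\<close>, so the clauses on parameters of
    at least \<open>pi\<close> are vacuous.\<close>
  show "strong_pi_condition Y w"
    using tm_lt lw len by (fastforce simp: strong_pi_condition_def pi_condition_def n_def intro: less_imp_le)
  show "\<forall>i\<in>middle w. pi / 2 \<le> tm w i \<and> tm w i < pi"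
  proof
    fix i assume "i \<in> middle w"
    then have i: "2 \<le> i" "i + 1 \<le> n" by (auto simp: middle_def lw)
    have "pi / 2 \<le> us ! (i - 1)" using gepi2 i by (auto simp: n_def)
    then show "pi / 2 \<le> tm w i \<and> tm w i < pi" using i tm_lt[of i] tm[of i] by simp
  qed
  \<comment> \<open>Positions in a word count from 1 and \<open>ts\<close> lacks the first letter,
    hence the shift by two.\<close>
  have tm': "tm w i = ts ! (i - 2)" if "2 \<le> i" "i \<le> n" for i
    using that tm[of i] by (simp add: us nth_Cons' numeral_2_eq_2)
  have mt: "opt_times k (altw A B (s # ts))" "0 < s" "\<forall>t\<in>set ts. 0 < t"
    "\<forall>i. Suc i < length ts \<longrightarrow> ts ! i < pi"
    using opt(2) pos ltpi[rule_format, of "Suc _"] us by auto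
  have n: "n = Suc (length ts)" by (simp add: n_def us)
  show "\<forall>p. 2 \<le> p \<and> p + 3 \<le> n \<longrightarrow> tm w p = tm w (p + 2)"
  proof (intro allI impI)
    fix p assume p: "2 \<le> p \<and> p + 3 \<le> n"
    have "ts ! (p - 2) = ts ! p"
      using p n by (intro AB.middle_times(1)[OF mt m]) auto
    then show "tm w p = tm w (p + 2)" using p by (simp add: tm')
  qed
  show "\<forall>i\<in>middle w. \<forall>j\<in>middle w. ctrl w i = X \<and> ctrl w j = Y \<longrightarrow>
       (1 - \<kappa> * c) * sin (tm w j) * cos (tm w i) = (\<kappa> - c) * cos (tm w j) * sin (tm w i)"
  proof (intro ballI impI)
    fix i j assume "i \<in> middle w" "j \<in> middle w" and C: "ctrl w i = X \<and> ctrl w j = Y"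
    then have ij: "2 \<le> i" "i + 1 \<le> n" "2 \<le> j" "j + 1 \<le> n" by (auto simp: middle_def lw)
    have ij': "Suc (i - 2) < length ts" "Suc (j - 2) < length ts" using ij n by auto
    have CC: "(if odd i then A else B) = X" "(if odd j then A else B) = Y"
      using C ij by (simp_all add: w_def ctrl_altw n_def)
    have tt: "tm w i = ts ! (i - 2)" "tm w j = ts ! (j - 2)" using ij by (simp_all add: tm')
    from AB show "(1 - \<kappa> * c) * sin (tm w j) * cos (tm w i) = (\<kappa> - c) * cos (tm w j) * sin (tm w i)"
    proof
      assume eq: "(A, B) = (Y, X)"
      then have par: "even (i - 2)" "odd (j - 2)"
        using CC A_neq_B ij by (auto split: if_splits)
      have "(k A - c * k B) * sin (ts ! (i - 2)) * cos (ts ! (j - 2)) = (k B - c * k A) * cos (ts ! (i - 2)) * sin (ts ! (j - 2))"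
        by (rule AB.middle_times(2)[OF mt m ij' par])
      then show ?thesis using eq by (simp add: tt cost_factors ac_simps)
    next
      assume eq: "(A, B) = (X, Y)"
      then have par: "odd (i - 2)" "even (j - 2)"
        using CC A_neq_B ij by (auto split: if_splits)
      have "(k A - c * k B) * sin (ts ! (j - 2)) * cos (ts ! (i - 2)) = (k B - c * k A) * cos (ts ! (j - 2)) * sin (ts ! (i - 2))"
        by (rule AB.middle_times(2)[OF mt m ij'(2,1) par(2,1)])
      then show ?thesis using eq by (simp add: tt cost_factors ac_simps)
    qed
  qed
qed

end

section \<open>Long periodic words and their limits\<close>

lemma altw_periodic:
  assumes "\<forall>i. Suc i < length ts \<longrightarrow> ts ! i = (if even i then u else v)" "2 * j < length ts"
  shows "word_val (altw B A ts) = (exp (u *\<^sub>R B) * exp (v *\<^sub>R A)) ^ j * word_val (altw B A (drop (2 * j) ts)) \<and>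
    wcost k (altw B A ts) = real j * (k B * u + k A * v) + wcost k (altw B A (drop (2 * j) ts))"
  using assms
proof (induction j arbitrary: ts)
  case (Suc j)
  then obtain a b ts' where ts: "ts = a # b # ts'"
    by (cases ts; cases "tl ts") auto
  have ab: "a = u" "b = v"
    using Suc.prems(1)[rule_format, of 0] Suc.prems(1)[rule_format, of 1] Suc.prems(2) by (cases ts'; auto simp: ts)+
  have "\<forall>i. Suc i < length ts' \<longrightarrow> ts' ! i = (if even i then u else v)"
    using Suc.prems(1)[rule_format, of "Suc (Suc _)"] by (simp add: ts)
  moreover have "2 * j < length ts'" using Suc.prems(2) by (simp add: ts)
  ultimately have IH: "word_val (altw B A ts') = (exp (u *\<^sub>R B) * exp (v *\<^sub>R A)) ^ j * word_val (altw B A (drop (2 * j) ts'))"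
    "wcost k (altw B A ts') = real j * (k B * u + k A * v) + wcost k (altw B A (drop (2 * j) ts'))"
    using Suc.IH by blast+
  show ?case
    by (simp add: ts ab IH mult.assoc distrib_right)
qed simp

context cost_pair
begin

text \<open>The flag \<open>b\<close> tells whether an unpaired middle letter remains before the last one.\<close>

definition near_optimal :: "quat \<Rightarrow> real \<Rightarrow> nat \<Rightarrow> quat \<Rightarrow> quat \<Rightarrow> bool \<Rightarrow> bool" where
  "near_optimal g D N A B b \<longleftrightarrow> (\<exists>s u v j t. N \<le> j \<and> 0 \<le> s \<and> s \<le> 2 * pi \<and> 0 < u \<and> u < pi \<and> 0 < v \<and> v < pi \<and> 0 \<le> t \<and> t \<le> 2 * pi \<and>
    (k A - c * k B) * sin u * cos v = (k B - c * k A) * cos u * sin v \<and>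
    g = exp (s *\<^sub>R A) * (exp (u *\<^sub>R B) * exp (v *\<^sub>R A)) ^ j * (if b then exp (u *\<^sub>R B) * exp (t *\<^sub>R A) else exp (t *\<^sub>R B)) \<and>
    \<bar>k A * s + real j * (k B * u + k A * v) + (if b then k B * u + k A * t else k B * t) - D\<bar> \<le> 1 / (real N + 1))"

text \<open>\<open>N\<close> bounds the number of pairs from below and, through
  \<open>1 / (real N + 1)\<close>, the error of the cost from above. This monotonicity lets a
  pigeonhole fix \<open>A\<close>, \<open>B\<close> and \<open>b\<close> for all \<open>N\<close> at
  once.\<close>

lemma near_optimal_mono: "M \<le> N \<Longrightarrow> near_optimal g D N A B b \<Longrightarrow> near_optimal g D M A B b"
proof -
  assume MN: "M \<le> N" and "near_optimal g D N A B b"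
  have "1 / (real N + 1) \<le> 1 / (real M + 1)"
    using MN by (intro divide_left_mono) auto
  moreover obtain s u v j t where "N \<le> j" "0 \<le> s" "s \<le> 2 * pi" "0 < u" "u < pi" "0 < v" "v < pi" "0 \<le> t" "t \<le> 2 * pi"
    "(k A - c * k B) * sin u * cos v = (k B - c * k A) * cos u * sin v"
    "g = exp (s *\<^sub>R A) * (exp (u *\<^sub>R B) * exp (v *\<^sub>R A)) ^ j * (if b then exp (u *\<^sub>R B) * exp (t *\<^sub>R A) else exp (t *\<^sub>R B))"
    "\<bar>k A * s + real j * (k B * u + k A * v) + (if b then k B * u + k A * t else k B * t) - D\<bar> \<le> 1 / (real N + 1)"
    using \<open>near_optimal g D N A B b\<close> unfolding near_optimal_def by blast
  ultimately show "near_optimal g D M A B b"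
    unfolding near_optimal_def using MN
    by (intro exI[of _ s] exI[of _ u] exI[of _ v] exI[of _ j] exI[of _ t] conjI) (assumption | linarith)+
qed

lemma near_optimal_of_long_word:
  assumes AB: "(A, B) = (Y, X) \<or> (A, B) = (X, Y)" and opt: "opt_times k (altw A B us)"
    and pos: "\<forall>t\<in>set us. 0 < t" and lt: "\<forall>i<length us. us ! i < (if i = 0 then 2 * pi else pi)"
    and len: "2 * N + 4 \<le> length us" and cost: "\<bar>wcost k (altw A B us) - D\<bar> \<le> 1 / (real N + 1)"
  shows "\<exists>b. near_optimal (word_val (altw A B us)) D N A B b"
proof -
  interpret AB: control_pair A B c by (rule pair_locale[OF AB])
  note m = pair_locale(2,3)[OF AB]
  obtain s ts where us: "us = s # ts" using len by (cases us) auto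
  have mt: "opt_times k (altw A B (s # ts))" "0 < s" "\<forall>t\<in>set ts. 0 < t"
    "\<forall>i. Suc i < length ts \<longrightarrow> ts ! i < pi"
    using opt pos lt[rule_format, of "Suc _"] us by auto
  have tpi: "ts ! i < pi" if "i < length ts" for i
    using lt[rule_format, of "Suc i"] that us by simp
  have tpos: "0 < ts ! i" if "i < length ts" for i
    using mt(3) that by simp
  have s: "s < 2 * pi" using lt[rule_format, of 0] us by simp
  define u where "u = ts ! 0"
  define v where "v = ts ! 1"
  \<comment> \<open>The number of complete pairs among the middle letters; the last entry of
    \<open>ts\<close> is not a middle letter. With \<open>2 * N + 4\<close> letters,
    \<open>u\<close> and \<open>v\<close> are middle parameters and \<open>j\<close> is at least
    \<open>N\<close>.\<close>
  define j where "j = (length ts - 1) div 2"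
  have lts: "2 * N + 3 \<le> length ts" using len us by simp
  have per: "\<forall>i. Suc i < length ts \<longrightarrow> ts ! i = (if even i then u else v)"
  proof (intro allI impI)
    fix i assume i: "Suc i < length ts"
    show "ts ! i = (if even i then u else v)"
      using AB.middle_times(1)[OF mt m i, of 0] AB.middle_times(1)[OF mt m i, of 1] lts
      by (auto simp: u_def v_def)
  qed
  have rel: "(k A - c * k B) * sin u * cos v = (k B - c * k A) * cos u * sin v"
    unfolding u_def v_def using lts by (intro AB.middle_times(2)[OF mt m]) auto
  have jN: "N \<le> j" "2 * j < length ts" using lts by (auto simp: j_def)
  note P = altw_periodic[OF per jN(2), of B A k]
  define b where "b = even (length ts)"
  define t where "t = last ts"
  have t: "0 < t" "t < pi"
    unfolding t_def using tpi[of "length ts - 1"] tpos[of "length ts - 1"] lts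
    by (cases "ts = []"; simp add: last_conv_nth)+
  have ne: "ts \<noteq> []" using lts by auto
  have "drop (2 * j) ts = (if b then [u, t] else [t])"
  proof (cases b)
    case True
    then have l: "length ts = Suc (Suc (2 * j))" using lts unfolding b_def j_def by presburger
    then have "drop (2 * j) ts = [ts ! (2 * j), ts ! Suc (2 * j)]"
      by (simp flip: Cons_nth_drop_Suc)
    then show ?thesis using True per l by (simp add: t_def last_conv_nth[OF ne])
  next
    case False
    then have l: "length ts = Suc (2 * j)" using lts unfolding b_def j_def by presburger
    then have "drop (2 * j) ts = [ts ! (2 * j)]"
      by (simp flip: Cons_nth_drop_Suc)
    then show ?thesis using False l by (simp add: t_def last_conv_nth[OF ne])
  qed
  then have vv: "word_val (altw A B us) = exp (s *\<^sub>R A) * (exp (u *\<^sub>R B) * exp (v *\<^sub>R A)) ^ j * (if b then exp (u *\<^sub>R B) * exp (t *\<^sub>R A) else exp (t *\<^sub>R B))"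
    and cc: "wcost k (altw A B us) = k A * s + real j * (k B * u + k A * v) + (if b then k B * u + k A * t else k B * t)"
    using P by (auto simp: us mult.assoc)
  have "0 < u" "u < pi" "0 < v" "v < pi"
    unfolding u_def v_def using lts tpos[of 0] tpos[of 1] tpi[of 0] tpi[of 1] ne by auto
  then have "near_optimal (word_val (altw A B us)) D N A B b"
    unfolding near_optimal_def vv using rel jN(1) mt(2) s t cost[unfolded cc]
    by (intro exI[of _ s] exI[of _ u] exI[of _ v] exI[of _ j] exI[of _ t]) auto
  then show ?thesis by blast
qed

lemma near_optimal_limit:
  assumes AB: "(A, B) = (Y, X) \<or> (A, B) = (X, Y)" and near: "\<And>N. near_optimal g D N A B b"
  shows "\<exists>s \<tau> t. 0 \<le> s \<and> 0 \<le> \<tau> \<and> 0 \<le> t \<and>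
    g = exp (s *\<^sub>R A) * exp (\<tau> *\<^sub>R ((k X - c * k Y) *\<^sub>R X + (k Y - c * k X) *\<^sub>R Y)) * exp (t *\<^sub>R (if b then A else B)) \<and>
    D = k A * s + (\<kappa>\<^sup>2 - 2 * \<kappa> * c + 1) * \<tau> + k (if b then A else B) * t"
proof -
  interpret AB: control_pair A B c by (rule pair_locale[OF AB])
  note m = pair_locale(2,3)[OF AB]
  from near obtain s u v j t where
    sq: "\<And>N. N \<le> j N" "\<And>N. 0 \<le> s N" "\<And>N. s N \<le> 2 * pi" "\<And>N. 0 < u N" "\<And>N. u N < pi" "\<And>N. 0 < v N" "\<And>N. v N < pi"
      "\<And>N. 0 \<le> t N" "\<And>N. t N \<le> 2 * pi"
    and rel: "\<And>N. (k A - c * k B) * sin (u N) * cos (v N) = (k B - c * k A) * cos (u N) * sin (v N)"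
    and g: "\<And>N. g = exp (s N *\<^sub>R A) * (exp (u N *\<^sub>R B) * exp (v N *\<^sub>R A)) ^ j N *
      (if b then exp (u N *\<^sub>R B) * exp (t N *\<^sub>R A) else exp (t N *\<^sub>R B))"
    and cost: "\<And>N. \<bar>k A * s N + real (j N) * (k B * u N + k A * v N) + (if b then k B * u N + k A * t N else k B * t N) - D\<bar> \<le> 1 / (real N + 1)"
    unfolding near_optimal_def by metis
  define C where "C N = k A * s N + real (j N) * (k B * u N + k A * v N) + (if b then k B * u N + k A * t N else k B * t N)" for N
  have kpos: "0 \<le> k C" for C using \<kappa> by (simp add: cost_factor_def)
  \<comment> \<open>\<open>x\<close> and \<open>y\<close> are the middle parameters of
    \<open>X\<close> and of \<open>Y\<close>. As \<open>X\<close> has cost factor one, the cost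
    bounds \<open>real (j N) * x N\<close>. For \<open>Y\<close> this would fail when
    \<open>\<kappa> = 0\<close>, so \<open>y\<close> is controlled through the tangent relation
    instead.\<close>
  define x where "x = (if A = X then v else u)"
  define y where "y = (if A = X then u else v)"
  have xy: "0 < x N" "0 < y N" "y N < pi" for N using sq by (auto simp: x_def y_def)
  have "real (j N) * x N \<le> D + 1" for N
  proof -
    have "0 \<le> k A * s N" "0 \<le> (if b then k B * u N + k A * t N else k B * t N)"
      "0 \<le> k B * u N" "0 \<le> k A * v N"
      using kpos sq by (auto intro!: mult_nonneg_nonneg add_nonneg_nonneg simp: less_imp_le)
    moreover have "x N \<le> k B * u N + k A * v N"
      using calculation(3,4) AB A_neq_B by (auto simp: x_def cost_factors)
    then have "real (j N) * x N \<le> real (j N) * (k B * u N + k A * v N)"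
      by (intro mult_left_mono) auto
    moreover have "1 / (real N + 1) \<le> 1" by simp
    ultimately show ?thesis using cost[of N] by linarith
  qed
  then have bx: "real (j N) * x N \<in> {0..D + 1}" for N
    using xy(1)[of N] by (auto simp: less_imp_le)
  define K where "K = {0..2 * pi} \<times> {0..2 * pi} \<times> {0..D + 1}"
  define f where "f N = (s N, t N, real (j N) * x N)" for N
  have "compact K" unfolding K_def by (intro compact_Times compact_Icc)
  moreover have "\<forall>N. f N \<in> K" using sq bx by (auto simp: f_def K_def)
  ultimately obtain l r where l: "l \<in> K" and r: "strict_mono r" and fr: "(f \<circ> r) \<longlonglongrightarrow> l"
    using compact_imp_seq_compact seq_compactE by metis
  obtain s' t' L where l_eq: "l = (s', t', L)" by (cases l) auto
  have s: "(\<lambda>i. s (r i)) \<longlonglongrightarrow> s'"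
    using tendsto_fst[OF fr] by (simp add: f_def l_eq comp_def)
  have t: "(\<lambda>i. t (r i)) \<longlonglongrightarrow> t'"
    using tendsto_fst[OF tendsto_snd[OF fr]] by (simp add: f_def l_eq comp_def)
  have jx: "(\<lambda>i. real (j (r i)) * x (r i)) \<longlonglongrightarrow> L"
    using tendsto_snd[OF tendsto_snd[OF fr]] by (simp add: f_def l_eq comp_def)
  have nn: "0 \<le> s'" "0 \<le> t'" "0 \<le> L" using l by (auto simp: K_def l_eq)
  have j: "filterlim (\<lambda>i. j (r i)) at_top sequentially"
  proof (rule filterlim_at_top_mono[OF filterlim_ident])
    have "i \<le> j (r i)" for i using sq(1)[of "r i"] seq_suble[OF r, of i] by linarith
    then show "\<forall>\<^sub>F i in sequentially. i \<le> j (r i)" by simp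
  qed
  define p where "p = k X - c * k Y"
  define q where "q = k Y - c * k X"
  have pq: "0 < p" "0 < q" using weights_pos by (simp_all add: p_def q_def)
  have "p * sin (y N) * cos (x N) = q * cos (y N) * sin (x N)" for N
    using rel[of N] AB A_neq_B by (auto simp: p_def q_def x_def y_def ac_simps)
  then have jy: "(\<lambda>i. real (j (r i)) * y (r i)) \<longlonglongrightarrow> q / p * L"
    by (intro tangent_relation_limit[OF pq _ _ _ _ j jx]) (use xy in auto)
  \<comment> \<open>\<open>p\<close> and \<open>q\<close> are the coefficients of \<open>W\<close>,
    so the accumulated times of \<open>X\<close> and \<open>Y\<close> tend to
    \<open>p * \<tau>\<close> and \<open>q * \<tau>\<close>.\<close>
  define \<tau> where "\<tau> = L / p"
  have \<tau>: "0 \<le> \<tau>" "L = p * \<tau>" "q / p * L = q * \<tau>" using nn pq by (auto simp: \<tau>_def)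
  define wA where "wA = k A - c * k B"
  define wB where "wB = k B - c * k A"
  have ju: "(\<lambda>i. real (j (r i)) * u (r i)) \<longlonglongrightarrow> wB * \<tau>" and jv: "(\<lambda>i. real (j (r i)) * v (r i)) \<longlonglongrightarrow> wA * \<tau>"
    using jx[unfolded \<tau>(2)] jy[unfolded \<tau>(3)] AB A_neq_B by (auto simp: x_def y_def p_def q_def wA_def wB_def)
  have W: "(wB * \<tau>) *\<^sub>R B + (wA * \<tau>) *\<^sub>R A = \<tau> *\<^sub>R (p *\<^sub>R X + q *\<^sub>R Y)"
    using AB by (auto simp: wA_def wB_def p_def q_def scaleR_add_right mult.commute)
  \<comment> \<open>The unpaired middle letter, present if \<open>b\<close> holds, disappears in the
    limit.\<close>
  have u0: "(\<lambda>i. u (r i)) \<longlonglongrightarrow> 0"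
  proof -
    have j': "filterlim (\<lambda>i. real (j (r i))) at_top sequentially"
      by (rule filterlim_compose[OF filterlim_real_sequentially j])
    have "(\<lambda>i. inverse (real (j (r i))) * (real (j (r i)) * u (r i))) \<longlonglongrightarrow> 0 * (wB * \<tau>)"
      by (intro tendsto_mult ju tendsto_inverse_0_at_top j')
    moreover have "\<forall>\<^sub>F i in sequentially. inverse (real (j (r i))) * (real (j (r i)) * u (r i)) = u (r i)"
      using filterlim_at_top_dense[THEN iffD1, OF j', rule_format, of 0] by eventually_elim simp
    ultimately show ?thesis by (simp add: tendsto_cong)
  qed
  have E: "(\<lambda>i. exp (h i *\<^sub>R Z)) \<longlonglongrightarrow> exp (h' *\<^sub>R Z)" if "h \<longlonglongrightarrow> h'" for h h' and Z :: quat
    by (rule continuous_on_tendsto_compose[OF continuous_exp_scaleR[OF continuous_on_id, of UNIV] that]) auto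
  have "(\<lambda>i. exp (s (r i) *\<^sub>R A) * (exp (u (r i) *\<^sub>R B) * exp (v (r i) *\<^sub>R A)) ^ j (r i) *
      (if b then exp (u (r i) *\<^sub>R B) * exp (t (r i) *\<^sub>R A) else exp (t (r i) *\<^sub>R B)))
    \<longlonglongrightarrow> exp (s' *\<^sub>R A) * exp ((wB * \<tau>) *\<^sub>R B + (wA * \<tau>) *\<^sub>R A) *
      (if b then exp (0 *\<^sub>R B) * exp (t' *\<^sub>R A) else exp (t' *\<^sub>R B))"
    by (cases b) (auto intro!: tendsto_mult E s t u0 lie_product_limit AB.A AB.B j ju jv simp del: scaleR_zero_left)
  then have "(\<lambda>i::nat. g) \<longlonglongrightarrow> exp (s' *\<^sub>R A) * exp (\<tau> *\<^sub>R (p *\<^sub>R X + q *\<^sub>R Y)) *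
      (if b then exp (0 *\<^sub>R B) * exp (t' *\<^sub>R A) else exp (t' *\<^sub>R B))"
    unfolding g[symmetric] W .
  then have g': "g = exp (s' *\<^sub>R A) * exp (\<tau> *\<^sub>R (p *\<^sub>R X + q *\<^sub>R Y)) * exp (t' *\<^sub>R (if b then A else B))"
    by (simp add: LIMSEQ_const_iff split: if_splits)
  have "(\<lambda>i. C (r i)) \<longlonglongrightarrow> D"
  proof -
    have "(\<lambda>N. C N - D) \<longlonglongrightarrow> 0"
    proof (rule Lim_null_comparison[OF always_eventually])
      show "\<forall>N. norm (C N - D) \<le> 1 / (real N + 1)" using cost by (simp add: C_def)
      show "(\<lambda>N. 1 / (real N + 1)) \<longlonglongrightarrow> 0"
        using LIMSEQ_inverse_real_of_nat by (simp add: inverse_eq_divide add.commute)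
    qed
    then have "C \<longlonglongrightarrow> D" by (simp add: LIM_zero_iff)
    then show ?thesis using LIMSEQ_subseq_LIMSEQ[OF _ r] by (simp add: comp_def)
  qed
  moreover have "(\<lambda>i. C (r i)) \<longlonglongrightarrow> k A * s' + (k B * (wB * \<tau>) + k A * (wA * \<tau>)) + (if b then k B * 0 + k A * t' else k B * t')"
  proof -
    have "C N = k A * s N + (k B * (real (j N) * u N) + k A * (real (j N) * v N)) + (if b then k B * u N + k A * t N else k B * t N)" for N
      by (simp add: C_def algebra_simps)
    then show ?thesis
      by (cases b) (simp_all only: if_True if_False, (intro tendsto_intros s t u0 ju jv)+)
  qed
  ultimately have "D = k A * s' + (k B * (wB * \<tau>) + k A * (wA * \<tau>)) + (if b then k B * 0 + k A * t' else k B * t')"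
    by (rule LIMSEQ_unique)
  moreover have "k B * (wB * \<tau>) + k A * (wA * \<tau>) = (\<kappa>\<^sup>2 - 2 * \<kappa> * c + 1) * \<tau>"
    using AB by (auto simp: wA_def wB_def cost_factors power2_eq_square algebra_simps)
  ultimately have "D = k A * s' + (\<kappa>\<^sup>2 - 2 * \<kappa> * c + 1) * \<tau> + k (if b then A else B) * t'"
    by (auto split: if_splits)
  with g' nn \<tau>(1) show ?thesis unfolding p_def q_def by blast
qed

end

section \<open>The infimum: not attained or attained\<close>

context cost_pair
begin

text \<open>Length is forced as follows. Let \<open>rs\<close> be cheapest among the alternating
  lists of \<open>M\<close> times. As the infimum is not attained, something cheaper exists, and a
  shortest such list must have more than \<open>M\<close> entries: otherwise it could be padded with
  zeros and would beat \<open>rs\<close>.\<close>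

lemma inf_cost_unattained:
  assumes g: "norm g = 1"
    and "\<And>w. nonneg_word w \<Longrightarrow> snd ` set w \<subseteq> {X, Y} \<Longrightarrow> word_val w = g \<Longrightarrow> D < wcost k w"
    and D: "\<And>e. 0 < e \<Longrightarrow> \<exists>w. nonneg_word w \<and> snd ` set w \<subseteq> {X, Y} \<and> word_val w = g \<and> wcost k w < D + e"
  shows "\<exists>C1\<in>{X, Y}. \<exists>C3\<in>{X, Y}. \<exists>t1 t2 t3. 0 \<le> t1 \<and> 0 \<le> t2 \<and> 0 \<le> t3 \<and>
    g = exp (t1 *\<^sub>R C1) * exp (t2 *\<^sub>R ((k X - c * k Y) *\<^sub>R X + (k Y - c * k X) *\<^sub>R Y)) * exp (t3 *\<^sub>R C3) \<and>
    D = k C1 * t1 + (\<kappa>\<^sup>2 - 2 * \<kappa> * c + 1) * t2 + k C3 * t3"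
proof -
  interpret YX: control_pair Y X c by (rule swap)
  have kk: "0 \<le> k Y" "k Y \<le> k X" using \<kappa> by (simp_all add: cost_factors)
  have above: "D < wcost k (altw Y X ts)" if "nonneg_list ts" "word_val (altw Y X ts) = g" for ts
    using assms(2)[of "altw Y X ts"] controls_altw[of Y X ts] that by auto
  have near: "\<exists>ts. nonneg_list ts \<and> word_val (altw Y X ts) = g \<and> wcost k (altw Y X ts) < D + e" if "0 < e" for e
    using D[OF that] altw_of_word by metis
  define F where "F = {(Y, X), (X, Y)} \<times> (UNIV :: bool set)"
  define P where "P N = (\<lambda>((A, B), b). near_optimal g D N A B b)" for N
  have "\<exists>x\<in>F. P N x" for N
  proof -
    have "0 < 1 / (real N + 1)" by simp
    then obtain ts where ts: "nonneg_list ts" "word_val (altw Y X ts) = g" "wcost k (altw Y X ts) < D + 1 / (real N + 1)"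
      using near by blast
    \<comment> \<open>At least the length of \<open>ts\<close>, so that the minimum for length
      \<open>M\<close> is within \<open>1 / (real N + 1)\<close> of \<open>D\<close>, and large
      enough for \<open>N\<close> pairs of middle letters.\<close>
    define M where "M = max (length ts) (2 * N + 4)"
    obtain vs where vs: "length vs = M" "nonneg_list vs" "word_val (altw Y X vs) = g" "wcost k (altw Y X vs) = wcost k (altw Y X ts)"
      using altw_pad[OF ts(1), of M Y X k] ts(2) unfolding M_def by auto
    obtain rs where rs: "length rs = M" "nonneg_list rs" "word_val (altw Y X rs) = g"
      and least: "\<And>us. length us = M \<Longrightarrow> nonneg_list us \<Longrightarrow> word_val (altw Y X us) = g \<Longrightarrow> wcost k (altw Y X rs) \<le> wcost k (altw Y X us)"
      by (rule YX.optimal_times_exist[OF vs(2) kk, unfolded vs(1,3)]) (rule that)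
    have rs_le: "wcost k (altw Y X rs) < D + 1 / (real N + 1)"
      using least[OF vs(1-3)] vs(4) ts(3) by simp
    obtain ts' where ts': "nonneg_list ts'" "word_val (altw Y X ts') = g" "wcost k (altw Y X ts') < wcost k (altw Y X rs)"
      using near[of "wcost k (altw Y X rs) - D"] above[OF rs(2,3)] by auto
    obtain A B us qs where us: "(A, B) = (Y, X) \<or> (A, B) = (X, Y)"
      "\<forall>t\<in>set us. 0 < t" "\<forall>i<length us. us ! i < (if i = 0 then 2 * pi else pi)"
      "word_val (altw A B us) = g" "wcost k (altw A B us) < wcost k (altw Y X rs)" "opt_times k (altw A B us)"
      and qs: "nonneg_list qs" "word_val (altw Y X qs) = g" "wcost k (altw Y X qs) < wcost k (altw Y X rs)" "length qs \<le> Suc (length us)"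
      by (rule shortest_word[OF ts'(1,2), where P = "\<lambda>a. a < wcost k (altw Y X rs)", OF ts'(3) le_less_trans])
        (assumption | rule that)+
    have "M < length qs"
    proof (rule ccontr)
      assume "\<not> M < length qs"
      then obtain ps where "length ps = M" "nonneg_list ps" "word_val (altw Y X ps) = g" "wcost k (altw Y X ps) = wcost k (altw Y X qs)"
        using altw_pad[OF qs(1), of M Y X k] qs(2) by auto
      then show False using least[of ps] qs(3) by simp
    qed
    then have len: "2 * N + 4 \<le> length us" using qs(4) by (simp add: M_def)
    have "nonneg_word (altw A B us)" using us(2) by (auto simp: less_imp_le)
    moreover have "snd ` set (altw A B us) \<subseteq> {X, Y}" using controls_altw[of A B us] us(1) by auto
    ultimately have "D < wcost k (altw A B us)" using assms(2) us(4) by blast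
    then have "\<bar>wcost k (altw A B us) - D\<bar> \<le> 1 / (real N + 1)"
      using us(5) rs_le by simp
    then obtain b where "near_optimal g D N A B b"
      using near_optimal_of_long_word[OF us(1,6,2,3) len] us(4) by blast
    then show ?thesis using us(1) by (intro bexI[of _ "((A, B), b)"]) (auto simp: P_def F_def)
  qed
  moreover have "P M x" if "M \<le> N" "P N x" for M N x
    using that near_optimal_mono unfolding P_def by (auto split: prod.splits)
  ultimately have "\<exists>x\<in>F. \<forall>N. P N x"
    by (intro uniform_choice_of_antimono) (auto simp: F_def)
  then obtain A B b where AB: "(A, B) = (Y, X) \<or> (A, B) = (X, Y)" and lim: "\<And>N. near_optimal g D N A B b"
    by (auto simp: F_def P_def)
  then have "A \<in> {X, Y}" "(if b then A else B) \<in> {X, Y}" by auto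
  then show ?thesis using near_optimal_limit[OF AB lim] by blast
qed

end

theorem theorem2p8:
  fixes X Y g W :: quat and \<alpha> \<kappa> :: real
  assumes "X \<in> su2" and "Y \<in> su2" and "norm X = 1" and "norm Y = 1"
    and "0 < \<alpha>" and "\<alpha> < pi" and "X \<bullet> Y = cos \<alpha>"
    and "0 \<le> \<kappa>" and "cos \<alpha> < \<kappa>" and "\<kappa> \<le> 1"
    and "W = (1 - \<kappa> * cos \<alpha>) *\<^sub>R X + (\<kappa> - cos \<alpha>) *\<^sub>R Y"
    and "g \<in> SU2"
  shows
    "(\<exists>n w. n_optimal X Y \<kappa> n w \<and> reduced_word w \<and> word_val w = g \<and>
        inf_cost X Y \<kappa> g = ereal (cost X \<kappa> w) \<and>
        strong_pi_condition Y w \<and>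
        (\<forall>p. 2 \<le> p \<and> p + 3 \<le> n \<longrightarrow> tm w p = tm w (p + 2)) \<and>
        (\<forall>i\<in>middle w. pi / 2 \<le> tm w i \<and> tm w i < pi) \<and>
        (4 \<le> n \<longrightarrow>
          (\<forall>i\<in>middle w. \<forall>j\<in>middle w. ctrl w i = X \<and> ctrl w j = Y \<longrightarrow>
             (1 - \<kappa> * cos \<alpha>) * sin (tm w j) * cos (tm w i) =
             (\<kappa> - cos \<alpha>) * cos (tm w j) * sin (tm w i))))
     \<or> (\<exists>C1\<in>{X, Y}. \<exists>C3\<in>{X, Y}. \<exists>t1 t2 t3. 0 \<le> t1 \<and> 0 \<le> t2 \<and> 0 \<le> t3 \<and>
        g = exp (t1 *\<^sub>R C1) * exp (t2 *\<^sub>R W) * exp (t3 *\<^sub>R C3) \<and>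
        inf_cost X Y \<kappa> g =
          ereal (cost_factor X \<kappa> C1 * t1 + (\<kappa>\<^sup>2 - 2 * \<kappa> * cos \<alpha> + 1) * t2
                 + cost_factor X \<kappa> C3 * t3))"
proof -
  define c where "c = cos \<alpha>"
  have "cos \<alpha> < cos 0" "cos pi < cos \<alpha>"
    using assms(5,6) by (intro cos_monotone_0_pi; simp)+
  then interpret cost_pair X Y c \<kappa>
    using assms by unfold_locales (auto simp: c_def abs_less_iff)
  define S where "S = {w. nonneg_word w \<and> snd ` set w \<subseteq> {X, Y} \<and> word_val w = g}"
  have S: "{w. admissible X Y w \<and> word_val w = g} = S"
    by (auto simp: S_def admissible_iff)
  have g: "norm g = 1" using assms(12) by (simp add: SU2_def)
  have W: "W = (k X - c * k Y) *\<^sub>R X + (k Y - c * k X) *\<^sub>R Y"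
    using assms(11) by (simp add: cost_factors c_def mult.commute)
  have "S \<noteq> {}" using word_reachable[OF g] by (auto simp: S_def)
  define D where "D = Inf (wcost k ` S)"
  have bdd: "bdd_below (wcost k ` S)"
    by (rule bdd_belowI[of _ 0]) (auto simp: S_def wcost_nonneg)
  have Dle: "D \<le> wcost k w" if "w \<in> S" for w
    unfolding D_def using bdd that by (intro cInf_lower) auto
  have infD: "inf_cost X Y \<kappa> g = ereal D"
    unfolding inf_cost_def S cost_eq_wcost D_def using bdd \<open>S \<noteq> {}\<close> by (simp add: ereal_Inf' image_image)
  show ?thesis
  proof (cases "\<exists>w\<in>S. wcost k w = D")
    case False
    have "\<exists>C1\<in>{X, Y}. \<exists>C3\<in>{X, Y}. \<exists>t1 t2 t3. 0 \<le> t1 \<and> 0 \<le> t2 \<and> 0 \<le> t3 \<and>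
      g = exp (t1 *\<^sub>R C1) * exp (t2 *\<^sub>R W) * exp (t3 *\<^sub>R C3) \<and>
      D = k C1 * t1 + (\<kappa>\<^sup>2 - 2 * \<kappa> * c + 1) * t2 + k C3 * t3"
      unfolding W
    proof (rule inf_cost_unattained[OF g])
      show "D < wcost k w" if "nonneg_word w" "snd ` set w \<subseteq> {X, Y}" "word_val w = g" for w
        using False Dle[of w] that by (force simp: S_def)
      show "\<exists>w. nonneg_word w \<and> snd ` set w \<subseteq> {X, Y} \<and> word_val w = g \<and> wcost k w < D + e" if "0 < e" for e
        using cInf_lessD[of "wcost k ` S" "D + e"] that \<open>S \<noteq> {}\<close> by (auto simp: D_def S_def)
    qed
    then show ?thesis unfolding infD c_def by blast
  next
    case True
    then obtain w0 where w0: "w0 \<in> S" "wcost k w0 = D" by blast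
    then obtain ts where ts: "nonneg_list ts" "word_val (altw Y X ts) = g" "wcost k (altw Y X ts) = D"
      using altw_of_word[of w0] by (auto simp: S_def)
    \<comment> \<open>Shortest among the minimal words, so that no letter vanishes once a trivial
      first one is dropped.\<close>
    obtain A B us where us: "(A, B) = (Y, X) \<or> (A, B) = (X, Y)"
      "\<forall>t\<in>set us. 0 < t" "\<forall>i<length us. us ! i < (if i = 0 then 2 * pi else pi)"
      "word_val (altw A B us) = g" "wcost k (altw A B us) \<le> D" "opt_times k (altw A B us)"
      by (rule shortest_word[OF ts(1,2), where P = "\<lambda>a. a \<le> D", OF eq_refl[OF ts(3)] order_trans])
        (assumption | rule that)+
    define w where "w = altw A B us"
    have nn: "nonneg_list us" using us(2) by (auto simp: less_imp_le)
    have wS: "w \<in> S" using us nn controls_altw[of A B us] by (auto simp: S_def w_def)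
    then have wD: "wcost k w = D" using Dle us(5) by (fastforce simp: w_def)
    show ?thesis
    proof (cases "length us \<le> 2")
      case True
      obtain C1 C3 t1 t3 where s: "C1 \<in> {X, Y}" "C3 \<in> {X, Y}" "0 \<le> t1" "0 \<le> t3"
        "word_val (altw A B us) = exp (t1 *\<^sub>R C1) * exp (t3 *\<^sub>R C3)" "wcost k (altw A B us) = k C1 * t1 + k C3 * t3"
        using short_word[OF us(1) nn True] by blast
      then have "g = exp (t1 *\<^sub>R C1) * exp (0 *\<^sub>R W) * exp (t3 *\<^sub>R C3)"
        "D = k C1 * t1 + (\<kappa>\<^sup>2 - 2 * \<kappa> * cos \<alpha> + 1) * 0 + k C3 * t3"
        using us(4) wD by (simp_all add: w_def)
      then show ?thesis unfolding infD using s(1-4) by blast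
    next
      case False
      then have len: "3 \<le> length us" by simp
      have opt: "opt_word k w"
        using wS Dle wD by (auto simp: opt_word_def S_def)
      have "n_optimal X Y \<kappa> (length us) w"
        using opt wS by (auto simp: n_optimal_def admissible_iff opt_word_def cost_eq_wcost w_def)
      moreover have "inf_cost X Y \<kappa> g = ereal (cost X \<kappa> w)"
        by (simp add: infD wD cost_eq_wcost)
      ultimately show ?thesis
        using long_word[OF us(1) opt[unfolded w_def] us(6,2,3) len] us(4) unfolding c_def w_def by blast
    qed
  qed
qed

end
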